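(* Let $M$ be a compact manifold, $I=[0,T]$, and let $g(t)$, $t\in I$, be a Ricci flow on $M$, i.e. $\partial g/\partial t=-2\,{\rm Ric}_{g}$. There is a constant $\widehat C<\infty$, depending only on the Ricci flow $(M,g(t))_{t\in I}$, such that for every smooth family of immersed curves $c\colon S^1\times I\to M$ satisfying the curve-shrinking equation $\partial c/\partial t=H$, with $S$ the $g(t)$-unit tangent field, $H=\nabla^g_SS$ the curvature vector and $k=|H|$, we have $$\frac{\partial}{\partial t}k^2\le (k^2)''-2\langle(\nabla_SH)^\perp,(\nabla_SH)^\perp\rangle+2k^4+\widehat C(k^2+k)$$ everywhere on $S^1\times I$, where $'$ denotes the derivative with respect to an arc-length parameter $s$ along the curves, $\nabla$ is the Levi-Civita connection of $\hat g=g(t)+dt^2$ on $M\times I$, and $\perp$ denotes the component orthogonal to $S$.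
   Context: Horizontal directions in $M\times I$ are those tangent to $M$; the vertical direction is spanned by $\partial_t$. $\nabla^g$ denotes the family of Levi-Civita connections of the metrics $g(t)$, applied to horizontal vector fields. The metric $\hat g$ on $M\times I$ is the orthogonal sum of the family $g(t)$ in the horizontal directions and the usual metric on $I$; all inner products are taken with respect to $\hat g$. For a curve-shrinking flow $c$ put $\hat c(x,t)=(c(x,t),t)$, $X=\hat c_*(\partial_x)$, $S=X/|X|$. The fields $X,S,H$ are horizontal vector fields along the immersion $\hat c\colon S^1\times I\to M\times I$, and $\nabla_S$ is covariant differentiation (for $\hat g$) of vector fields along $\hat c$ in the direction $S$. Orthogonality in $(\cdot)^\perp$ is in $T(M\times I)$ with respect to $\hat g$. The derivative $\partial/\partial t$ is taken at fixed $x\in S^1$, and $f'=S(f)=|X|^{-1}\partial_xf$ for a function $f$ on $S^1\times I$. *)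

theory Defs
  imports "HOL-Analysis.Analysis"
begin

section \<open>Smooth functions, up to the boundary\<close>

text \<open>
  All derivatives are taken relative to the set \<open>S\<close>. For the sets used below (open sets, and
  relatively open subsets of a product of a Euclidean space with \<open>[0, T]\<close>, \<open>T > 0\<close>) these
  derivatives are unique, and they are one-sided in the direction of \<open>t\<close> at \<open>t = 0\<close> and \<open>t = T\<close>.
\<close>

primrec Ck_on :: "nat \<Rightarrow> 'a::real_normed_vector set \<Rightarrow> ('a \<Rightarrow> 'b::real_normed_vector) \<Rightarrow> bool" where
  "Ck_on 0 S f \<longleftrightarrow> continuous_on S f"
| "Ck_on (Suc k) S f \<longleftrightarrow>
     (\<exists>f'. (\<forall>x\<in>S. (f has_derivative f' x) (at x within S)) \<and> (\<forall>v. Ck_on k S (\<lambda>x. f' x v)))"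

definition smooth_on :: "'a::real_normed_vector set \<Rightarrow> ('a \<Rightarrow> 'b::real_normed_vector) \<Rightarrow> bool" where
  "smooth_on S f \<longleftrightarrow> (\<forall>k. Ck_on k S f)"


section \<open>Riemannian geometry in a coordinate domain\<close>

text \<open>
  Here \<open>D\<close> is the coordinate domain and \<open>G\<close> the matrix field of the components of a metric.
  The difference quotients only use points of \<open>D\<close>, so that partial derivatives
  are one-sided at boundary points of \<open>D\<close>.
\<close>

definition partial_deriv :: "(real^'m::finite) set \<Rightarrow> (real^'m \<Rightarrow> real) \<Rightarrow> 'm \<Rightarrow> real^'m \<Rightarrow> real" where
  "partial_deriv D f i y =
     vector_derivative (\<lambda>h. f (y + h *\<^sub>R axis i 1)) (at 0 within {h. y + h *\<^sub>R axis i 1 \<in> D})"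

definition metric_inner :: "real^'m::finite^'m \<Rightarrow> real^'m \<Rightarrow> real^'m \<Rightarrow> real" where
  "metric_inner B v w = (\<Sum>i\<in>UNIV. \<Sum>j\<in>UNIV. B $ i $ j * v $ i * w $ j)"

text \<open>\<open>christoffel D G y l i j\<close> is the coefficient with upper index \<open>l\<close> and lower indices \<open>i\<close>, \<open>j\<close>.\<close>

definition christoffel ::
    "(real^'m::finite) set \<Rightarrow> (real^'m \<Rightarrow> real^'m^'m) \<Rightarrow> real^'m \<Rightarrow> 'm \<Rightarrow> 'm \<Rightarrow> 'm \<Rightarrow> real" where
  "christoffel D G y l i j =
     (\<Sum>m\<in>UNIV. matrix_inv (G y) $ l $ m *
        (partial_deriv D (\<lambda>z. G z $ j $ m) i y
         + partial_deriv D (\<lambda>z. G z $ i $ m) j y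
         - partial_deriv D (\<lambda>z. G z $ i $ j) m y)) / 2"

text \<open>
  The lemmas \<open>christoffel_torsion_free_metric\<close> and \<open>christoffel_unique\<close> confirm that these are the coefficients of the Levi-Civita
  connection: the only torsion-free and metric ones.
\<close>

lemma partial_deriv_cong:
  assumes "\<And>z. z \<in> D \<Longrightarrow> f z = f' z" "y \<in> D"
  shows "partial_deriv D f i y = partial_deriv D f' i y"
proof -
  have "((\<lambda>h. f (y + h *\<^sub>R axis i 1)) has_vector_derivative d)
          (at 0 within {h. y + h *\<^sub>R axis i 1 \<in> D}) \<longleftrightarrow>
        ((\<lambda>h. f' (y + h *\<^sub>R axis i 1)) has_vector_derivative d)
          (at 0 within {h. y + h *\<^sub>R axis i 1 \<in> D})" for d
    by (rule has_vector_derivative_cong_ev) (use assms in \<open>auto intro!: always_eventually\<close>)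
  then show ?thesis
    unfolding partial_deriv_def vector_derivative_def by simp
qed

lemma matrix_inv_inverse:
  fixes B :: "real^'m::finite^'m"
  assumes "invertible B"
  shows "B ** matrix_inv B = mat 1" "matrix_inv B ** B = mat 1"
  using someI_ex[OF assms[unfolded invertible_def]] unfolding matrix_inv_def by auto

lemma christoffel_torsion_free_metric:
  fixes G :: "real^'m::finite \<Rightarrow> real^'m^'m"
  assumes sym: "\<And>z i j. z \<in> D \<Longrightarrow> G z $ i $ j = G z $ j $ i"
    and y: "y \<in> D" and inv: "invertible (G y)"
  shows "christoffel D G y l i j = christoffel D G y l j i"
    and "partial_deriv D (\<lambda>z. G z $ i $ j) k y =
           (\<Sum>l\<in>UNIV. christoffel D G y l k i * G y $ l $ j)
           + (\<Sum>l\<in>UNIV. christoffel D G y l k j * G y $ i $ l)"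
proof -
  define d where "d i j k = partial_deriv D (\<lambda>z. G z $ i $ j) k y" for i j k
  have ds: "d i j k = d j i k" for i j k
    unfolding d_def by (rule partial_deriv_cong) (use sym y in auto)
  have chr: "christoffel D G y l i j =
      (\<Sum>m\<in>UNIV. matrix_inv (G y) $ l $ m * (d j m i + d i m j - d i j m)) / 2" for l i j
    unfolding christoffel_def d_def by simp
  show "christoffel D G y l i j = christoffel D G y l j i"
    unfolding chr using ds by (simp add: add.commute)
  have GI: "(\<Sum>l\<in>UNIV. G y $ j $ l * matrix_inv (G y) $ l $ m) = (if j = m then 1 else 0)" for j m
  proof -
    have "(G y ** matrix_inv (G y)) $ j $ m = (mat 1 :: real^'m^'m) $ j $ m"
      using matrix_inv_inverse[OF inv] by simp
    then show ?thesis by (simp add: matrix_matrix_mult_def mat_def)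
  qed
  have lower: "(\<Sum>l\<in>UNIV. christoffel D G y l k i * G y $ j $ l) = (d i j k + d k j i - d k i j) / 2"
    for i j k
  proof -
    have "(\<Sum>l\<in>UNIV. christoffel D G y l k i * G y $ j $ l) =
        (\<Sum>l\<in>UNIV. \<Sum>m\<in>UNIV. (G y $ j $ l * matrix_inv (G y) $ l $ m) * (d i m k + d k m i - d k i m)) / 2"
      unfolding chr sum_divide_distrib sum_distrib_right by (intro sum.cong refl) (simp add: mult_ac)
    also have "\<dots> = (\<Sum>m\<in>UNIV. (\<Sum>l\<in>UNIV. G y $ j $ l * matrix_inv (G y) $ l $ m)
                      * (d i m k + d k m i - d k i m)) / 2"
      by (subst sum.swap) (simp add: sum_distrib_right)
    also have "\<dots> = (d i j k + d k j i - d k i j) / 2"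
      unfolding GI by (simp add: if_distrib[of "\<lambda>x. x * _"] cong: if_cong)
    finally show ?thesis .
  qed
  have "(\<Sum>l\<in>UNIV. christoffel D G y l k i * G y $ l $ j) = (d i j k + d k j i - d k i j) / 2"
    using lower[of k i j] sym[OF y] by (metis (no_types, lifting) sum.cong)
  moreover have "(\<Sum>l\<in>UNIV. christoffel D G y l k j * G y $ i $ l) = (d j i k + d k i j - d k j i) / 2"
    by (rule lower)
  ultimately show "partial_deriv D (\<lambda>z. G z $ i $ j) k y =
           (\<Sum>l\<in>UNIV. christoffel D G y l k i * G y $ l $ j)
           + (\<Sum>l\<in>UNIV. christoffel D G y l k j * G y $ i $ l)"
    using ds[of i j k] by (simp add: d_def[symmetric])
qed

lemma christoffel_unique:
  fixes G :: "real^'m::finite \<Rightarrow> real^'m^'m"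
  assumes sym: "\<And>z i j. z \<in> D \<Longrightarrow> G z $ i $ j = G z $ j $ i"
    and y: "y \<in> D" and inv: "invertible (G y)"
    and tf: "\<And>l i j. \<Gamma> l i j = \<Gamma> l j i"
    and met: "\<And>i j k. partial_deriv D (\<lambda>z. G z $ i $ j) k y =
           (\<Sum>l\<in>UNIV. \<Gamma> l k i * G y $ l $ j) + (\<Sum>l\<in>UNIV. \<Gamma> l k j * G y $ i $ l)"
  shows "\<Gamma> l i j = christoffel D G y l i j"
proof -
  define L where "L i j m = (\<Sum>l\<in>UNIV. \<Gamma> l i j * G y $ m $ l)" for i j m
  have Ls: "L i j m = L j i m" for i j m
    unfolding L_def using tf by simp
  have m: "partial_deriv D (\<lambda>z. G z $ i $ j) k y = L k i j + L k j i" for i j k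
    unfolding met L_def using sym[OF y] by (metis (no_types, lifting) sum.cong)
  have IG: "(\<Sum>m\<in>UNIV. matrix_inv (G y) $ l $ m * G y $ m $ p) = (if l = p then 1 else 0)" for l p
  proof -
    have "(matrix_inv (G y) ** G y) $ l $ p = (mat 1 :: real^'m^'m) $ l $ p"
      using matrix_inv_inverse[OF inv] by simp
    then show ?thesis by (simp add: matrix_matrix_mult_def mat_def)
  qed
  have *: "L i j m + L i m j + (L j i m + L j m i) - (L m i j + L m j i) = 2 * L i j m" for m
    using Ls[of i m j] Ls[of j m i] Ls[of i j m] by simp
  have "christoffel D G y l i j = (\<Sum>m\<in>UNIV. matrix_inv (G y) $ l $ m * L i j m)"
    unfolding christoffel_def m * by (simp add: sum_divide_distrib)
  also have "\<dots> = (\<Sum>p\<in>UNIV. \<Gamma> p i j * (\<Sum>m\<in>UNIV. matrix_inv (G y) $ l $ m * G y $ m $ p))"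
    unfolding L_def sum_distrib_left by (subst sum.swap) (simp add: mult_ac)
  also have "\<dots> = \<Gamma> l i j"
    unfolding IG by (simp add: if_distrib cong: if_cong)
  finally show ?thesis by simp
qed

text \<open>
  \<open>riemann D G y l k i j\<close> is the \<open>l\<close>-th component of \<open>R(\<partial>\<^sub>i, \<partial>\<^sub>j) \<partial>\<^sub>k\<close>, where
  \<open>R(X, Y) Z = \<nabla>\<^sub>X \<nabla>\<^sub>Y Z - \<nabla>\<^sub>Y \<nabla>\<^sub>X Z - \<nabla>\<^bsub>[X, Y]\<^esub> Z\<close>, and \<open>Ric(Y, Z)\<close> is the trace of
  \<open>X \<mapsto> R(X, Y) Z\<close>, so that round spheres have positive Ricci curvature.
\<close>

definition riemann ::
    "(real^'m::finite) set \<Rightarrow> (real^'m \<Rightarrow> real^'m^'m) \<Rightarrow> real^'m \<Rightarrow> 'm \<Rightarrow> 'm \<Rightarrow> 'm \<Rightarrow> 'm \<Rightarrow> real" where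
  "riemann D G y l k i j =
     partial_deriv D (\<lambda>z. christoffel D G z l j k) i y
     - partial_deriv D (\<lambda>z. christoffel D G z l i k) j y
     + (\<Sum>m\<in>UNIV. christoffel D G y l i m * christoffel D G y m j k)
     - (\<Sum>m\<in>UNIV. christoffel D G y l j m * christoffel D G y m i k)"

definition ricci ::
    "(real^'m::finite) set \<Rightarrow> (real^'m \<Rightarrow> real^'m^'m) \<Rightarrow> real^'m \<Rightarrow> 'm \<Rightarrow> 'm \<Rightarrow> real" where
  "ricci D G y j k = (\<Sum>i\<in>UNIV. riemann D G y i k i j)"

text \<open>
  For a curve \<open>\<gamma>\<close> with parameter \<open>x\<close>: the length of its velocity, its unit tangent field \<open>S\<close>, and
  for a vector field \<open>V\<close> along \<open>\<gamma>\<close> the covariant derivative \<open>\<nabla>\<^sub>S V = |\<gamma>'|\<^sup>-\<^sup>1 \<nabla>\<^bsub>\<partial>/\<partial>x\<^esub> V\<close>.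
\<close>

definition speed :: "(real^'m::finite \<Rightarrow> real^'m^'m) \<Rightarrow> (real \<Rightarrow> real^'m) \<Rightarrow> real \<Rightarrow> real" where
  "speed G \<gamma> x = sqrt (metric_inner (G (\<gamma> x)) (vector_derivative \<gamma> (at x)) (vector_derivative \<gamma> (at x)))"

definition unit_tangent ::
    "(real^'m::finite \<Rightarrow> real^'m^'m) \<Rightarrow> (real \<Rightarrow> real^'m) \<Rightarrow> real \<Rightarrow> real^'m" where
  "unit_tangent G \<gamma> x = vector_derivative \<gamma> (at x) /\<^sub>R speed G \<gamma> x"

definition nabla_S ::
    "(real^'m::finite) set \<Rightarrow> (real^'m \<Rightarrow> real^'m^'m) \<Rightarrow> (real \<Rightarrow> real^'m) \<Rightarrow> (real \<Rightarrow> real^'m)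
      \<Rightarrow> real \<Rightarrow> real^'m" where
  "nabla_S D G \<gamma> V x =
     (vector_derivative V (at x)
      + (\<chi> l. \<Sum>i\<in>UNIV. \<Sum>j\<in>UNIV.
           christoffel D G (\<gamma> x) l i j * vector_derivative \<gamma> (at x) $ i * V x $ j)) /\<^sub>R speed G \<gamma> x"

definition normal_part :: "real^'m::finite^'m \<Rightarrow> real^'m \<Rightarrow> real^'m \<Rightarrow> real^'m" where
  "normal_part B S v = v - metric_inner B v S *\<^sub>R S"


section \<open>Manifolds and Ricci flows\<close>

text \<open>
  A chart is a pair of its domain and its coordinate map. A metric is given by its component
  matrices in all charts of the atlas, as functions of the coordinates, subject to the
  transformation law of a covariant 2-tensor.
\<close>

type_synonym ('a, 'n) chart = "'a set \<times> ('a \<Rightarrow> real^'n)"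

type_synonym ('a, 'n) metric = "('a, 'n) chart \<Rightarrow> real^'n \<Rightarrow> real^'n^'n"

definition transition :: "('a, 'n::finite) chart \<Rightarrow> ('a, 'n) chart \<Rightarrow> real^'n \<Rightarrow> real^'n" where
  "transition \<kappa> \<mu> y = snd \<mu> (inv_into (fst \<kappa>) (snd \<kappa>) y)"

definition smooth_manifold :: "'a topology \<Rightarrow> ('a, 'n::finite) chart set \<Rightarrow> bool" where
  "smooth_manifold M A \<longleftrightarrow>
     Hausdorff_space M \<and> second_countable M \<and>
     \<Union> (fst ` A) = topspace M \<and>
     (\<forall>\<kappa>\<in>A. openin M (fst \<kappa>) \<and> open (snd \<kappa> ` fst \<kappa>) \<and>
        homeomorphic_map (subtopology M (fst \<kappa>)) (top_of_set (snd \<kappa> ` fst \<kappa>)) (snd \<kappa>)) \<and>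
     (\<forall>\<kappa>\<in>A. \<forall>\<mu>\<in>A. smooth_on (snd \<kappa> ` (fst \<kappa> \<inter> fst \<mu>)) (transition \<kappa> \<mu>))"

definition riemannian_metric :: "('a, 'n::finite) chart set \<Rightarrow> ('a, 'n) metric \<Rightarrow> bool" where
  "riemannian_metric A g \<longleftrightarrow>
     (\<forall>\<kappa>\<in>A. smooth_on (snd \<kappa> ` fst \<kappa>) (g \<kappa>) \<and>
        (\<forall>y \<in> snd \<kappa> ` fst \<kappa>. transpose (g \<kappa> y) = g \<kappa> y \<and>
           (\<forall>v. v \<noteq> 0 \<longrightarrow> metric_inner (g \<kappa> y) v v > 0))) \<and>
     (\<forall>\<kappa>\<in>A. \<forall>\<mu>\<in>A. \<forall>p \<in> fst \<kappa> \<inter> fst \<mu>. \<forall>v w.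
        metric_inner (g \<kappa> (snd \<kappa> p)) v w =
        metric_inner (g \<mu> (snd \<mu> p))
          (frechet_derivative (transition \<kappa> \<mu>) (at (snd \<kappa> p)) v)
          (frechet_derivative (transition \<kappa> \<mu>) (at (snd \<kappa> p)) w))"

definition ricci_flow ::
    "('a, 'n::finite) chart set \<Rightarrow> real \<Rightarrow> (real \<Rightarrow> ('a, 'n) metric) \<Rightarrow> bool" where
  "ricci_flow A T g \<longleftrightarrow>
     (\<forall>t\<in>{0..T}. riemannian_metric A (g t)) \<and>
     (\<forall>\<kappa>\<in>A. smooth_on ((snd \<kappa> ` fst \<kappa>) \<times> {0..T}) (\<lambda>(y, t). g t \<kappa> y)) \<and>
     (\<forall>\<kappa>\<in>A. \<forall>y \<in> snd \<kappa> ` fst \<kappa>. \<forall>t\<in>{0..T}. \<forall>i j.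
        ((\<lambda>s. g s \<kappa> y $ i $ j) has_real_derivative
           - 2 * ricci (snd \<kappa> ` fst \<kappa>) (g t \<kappa>) y i j) (at t within {0..T}))"


section \<open>The product of the manifold and the time interval\<close>

text \<open>
  A chart \<open>\<kappa>\<close> induces coordinates in \<open>real^('n option)\<close> on the product with \<open>[0, T]\<close>: the index
  \<open>Some i\<close> belongs to the \<open>i\<close>-th coordinate of \<open>\<kappa>\<close> and the index \<open>None\<close> to the time \<open>t\<close>.
\<close>

definition space_part :: "real^('n::finite option) \<Rightarrow> real^'n" where
  "space_part z = (\<chi> i. z $ Some i)"

definition spacetime :: "real^'n::finite \<Rightarrow> real \<Rightarrow> real^('n option)" where
  "spacetime v r = (\<chi> a. case a of None \<Rightarrow> r | Some i \<Rightarrow> v $ i)"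

abbreviation horizontal :: "real^'n::finite \<Rightarrow> real^('n option)" where
  "horizontal v \<equiv> spacetime v 0"

definition spacetime_domain :: "real \<Rightarrow> ('a, 'n::finite) chart \<Rightarrow> (real^('n option)) set" where
  "spacetime_domain T \<kappa> = {z. space_part z \<in> snd \<kappa> ` fst \<kappa> \<and> z $ None \<in> {0..T}}"

definition spacetime_metric ::
    "(real \<Rightarrow> ('a, 'n::finite) metric) \<Rightarrow> ('a, 'n) chart
      \<Rightarrow> real^('n option) \<Rightarrow> real^('n option)^('n option)" where
  "spacetime_metric g \<kappa> z = (\<chi> a b.
     case (a, b) of
       (Some i, Some j) \<Rightarrow> g (z $ None) \<kappa> (space_part z) $ i $ j
     | (None, None) \<Rightarrow> 1
     | _ \<Rightarrow> 0)"


section \<open>Curve-shrinking flows\<close>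

text \<open>
  The circle is the quotient of the real line by the multiples of \<open>2 * pi\<close>, i.e. a map on the
  circle is a \<open>2 * pi\<close>-periodic map.
\<close>

definition smooth_immersed_family ::
    "'a topology \<Rightarrow> ('a, 'n::finite) chart set \<Rightarrow> real \<Rightarrow> (real \<Rightarrow> real \<Rightarrow> 'a) \<Rightarrow> bool" where
  "smooth_immersed_family M A T c \<longleftrightarrow>
     (\<forall>x. \<forall>t\<in>{0..T}. c (x + 2 * pi) t = c x t) \<and>
     continuous_map (top_of_set (UNIV \<times> {0..T})) M (\<lambda>(x, t). c x t) \<and>
     (\<forall>\<kappa>\<in>A. smooth_on {(x, t). t \<in> {0..T} \<and> c x t \<in> fst \<kappa>} (\<lambda>(x, t). snd \<kappa> (c x t))) \<and>
     (\<forall>\<kappa>\<in>A. \<forall>x. \<forall>t\<in>{0..T}. c x t \<in> fst \<kappa> \<longrightarrow>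
        vector_derivative (\<lambda>\<xi>. snd \<kappa> (c \<xi> t)) (at x) \<noteq> 0)"

text \<open>The components in the chart \<open>\<kappa>\<close> of \<open>S\<close> and of \<open>H = \<nabla>\<^sub>S S\<close> (for \<open>g(t)\<close>).\<close>

definition unit_S ::
    "(real \<Rightarrow> ('a, 'n::finite) metric) \<Rightarrow> (real \<Rightarrow> real \<Rightarrow> 'a) \<Rightarrow> ('a, 'n) chart
      \<Rightarrow> real \<Rightarrow> real \<Rightarrow> real^'n" where
  "unit_S g c \<kappa> x t = unit_tangent (g t \<kappa>) (\<lambda>\<xi>. snd \<kappa> (c \<xi> t)) x"

definition curvature_vector ::
    "(real \<Rightarrow> ('a, 'n::finite) metric) \<Rightarrow> (real \<Rightarrow> real \<Rightarrow> 'a) \<Rightarrow> ('a, 'n) chart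
      \<Rightarrow> real \<Rightarrow> real \<Rightarrow> real^'n" where
  "curvature_vector g c \<kappa> x t =
     nabla_S (snd \<kappa> ` fst \<kappa>) (g t \<kappa>) (\<lambda>\<xi>. snd \<kappa> (c \<xi> t)) (\<lambda>\<xi>. unit_S g c \<kappa> \<xi> t) x"

definition curve_shrinking_flow ::
    "'a topology \<Rightarrow> ('a, 'n::finite) chart set \<Rightarrow> real \<Rightarrow> (real \<Rightarrow> ('a, 'n) metric)
      \<Rightarrow> (real \<Rightarrow> real \<Rightarrow> 'a) \<Rightarrow> bool" where
  "curve_shrinking_flow M A T g c \<longleftrightarrow>
     smooth_immersed_family M A T c \<and>
     (\<forall>\<kappa>\<in>A. \<forall>x. \<forall>t\<in>{0..T}. c x t \<in> fst \<kappa> \<longrightarrow>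
        ((\<lambda>s. snd \<kappa> (c x s)) has_vector_derivative curvature_vector g c \<kappa> x t) (at t within {0..T}))"

text \<open>
  The functions below do not depend on the chart around \<open>c x t\<close> used to compute them;
  an arbitrary one is chosen.
\<close>

definition chart_at :: "('a, 'n::finite) chart set \<Rightarrow> 'a \<Rightarrow> ('a, 'n) chart" where
  "chart_at A p = (SOME \<kappa>. \<kappa> \<in> A \<and> p \<in> fst \<kappa>)"

definition curvature ::
    "('a, 'n::finite) chart set \<Rightarrow> (real \<Rightarrow> ('a, 'n) metric) \<Rightarrow> (real \<Rightarrow> real \<Rightarrow> 'a)
      \<Rightarrow> real \<Rightarrow> real \<Rightarrow> real" where
  "curvature A g c x t =
     (let \<kappa> = chart_at A (c x t); H = curvature_vector g c \<kappa> x t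
      in sqrt (metric_inner (g t \<kappa> (snd \<kappa> (c x t))) H H))"

definition arclength_deriv ::
    "('a, 'n::finite) chart set \<Rightarrow> (real \<Rightarrow> ('a, 'n) metric) \<Rightarrow> (real \<Rightarrow> real \<Rightarrow> 'a)
      \<Rightarrow> (real \<Rightarrow> real \<Rightarrow> real) \<Rightarrow> real \<Rightarrow> real \<Rightarrow> real" where
  "arclength_deriv A g c f x t =
     (let \<kappa> = chart_at A (c x t)
      in deriv (\<lambda>\<xi>. f \<xi> t) x / speed (g t \<kappa>) (\<lambda>\<xi>. snd \<kappa> (c \<xi> t)) x)"

text \<open>
  The square of the length of \<open>(\<nabla>\<^sub>S H)\<^sup>\<bottom>\<close>. Here \<open>\<nabla>\<close> is the connection of the spacetime metric
  and the derivative is along the curve \<open>x \<mapsto> (c x t, t)\<close>, so that \<open>\<nabla>\<^sub>S H\<close> may have a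
  vertical component although \<open>H\<close> is horizontal.
\<close>

definition normal_nabla_S_H_sq ::
    "('a, 'n::finite) chart set \<Rightarrow> real \<Rightarrow> (real \<Rightarrow> ('a, 'n) metric) \<Rightarrow> (real \<Rightarrow> real \<Rightarrow> 'a)
      \<Rightarrow> real \<Rightarrow> real \<Rightarrow> real" where
  "normal_nabla_S_H_sq A T g c x t =
     (let \<kappa> = chart_at A (c x t);
          G = spacetime_metric g \<kappa>;
          \<gamma> = (\<lambda>\<xi>. spacetime (snd \<kappa> (c \<xi> t)) t);
          N = normal_part (G (\<gamma> x)) (unit_tangent G \<gamma> x)
                (nabla_S (spacetime_domain T \<kappa>) G \<gamma>
                  (\<lambda>\<xi>. horizontal (curvature_vector g c \<kappa> \<xi> t)) x)
      in metric_inner (G (\<gamma> x)) N N)"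

end

theory Submission
  imports Defs
begin

text \<open>
  In a chart, write \<open>D\<^sub>x\<close> and \<open>D\<^sub>t\<close> for covariant differentiation along the curves and along their
  trajectories, \<open>X\<close> for the velocity and \<open>S = X / |X|\<close>. Since \<open>\<partial>\<^sub>t c = H\<close>, the torsion-free connection gives
  \<open>D\<^sub>t X = D\<^sub>x H\<close>, hence \<open>D\<^sub>t S = \<nabla>\<^sub>S H + a S\<close> with \<open>a = k\<^sup>2 - (\<partial>\<^sub>t g)(S, S) / 2\<close>, and commuting \<open>D\<^sub>t\<close> with
  \<open>D\<^sub>x\<close> in \<open>|X| H = D\<^sub>x S\<close> gives
  \<open>D\<^sub>t H = \<nabla>\<^sub>S \<nabla>\<^sub>S H + a' S + 2 a H + R(H, S) S + (\<partial>\<^sub>t \<Gamma>)(S, S)\<close>. Pairing with \<open>H\<close>, all terms other than those of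
  the claim are quadratic or linear in \<open>H\<close>, with coefficients that are continuous on the space of unit
  vectors over \<open>M \<times> [0, T]\<close> and therefore bounded. The vertical part of \<open>\<nabla>\<^sub>S H\<close> is
  \<open>- (\<partial>\<^sub>t g)(S, H) / 2\<close>, so its square is quadratic in \<open>H\<close> as well.
\<close>

section \<open>Calculus of smooth functions\<close>

text \<open>A quantity such as \<open>curvature\<close> is evaluated in the chart that
  \<open>chart_at\<close> happens to pick at each point, and this choice may jump between
  neighbouring points. Before it can be differentiated it must be shown to be independent of the
  chart, which comes down to the transformation law of the Christoffel symbols. Moreover all
  derivatives live on sets that contain the times 0 and T, so even the commutation of second
  derivatives has to be derived for one-sided ones.

  The equation for \<open>D_t H\<close> produces \<open>4 k^4\<close>. Half of it is used up because
  the horizontal part of \<open>nabla_S H\<close> has the tangential component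
  \<open>- k^2 S\<close>: passing from its full length to the normal part costs
  \<open>2 k^4\<close>.

  The error terms depend on a point of spacetime, a unit vector and a second vector, never on the
  curve as a whole; this is why the constant is the same for all flows. As lengths can be compared
  with Euclidean ones only inside a chart, bounds are found over closed coordinate balls and added
  up over a finite cover.\<close>

lemma Ck_on_SucI:
  assumes "\<And>x. x \<in> S \<Longrightarrow> (f has_derivative f' x) (at x within S)"
    and "\<And>v. Ck_on k S (\<lambda>x. f' x v)"
  shows "Ck_on (Suc k) S f"
  using assms by auto

lemma Ck_on_cong:
  assumes "\<And>x. x \<in> S \<Longrightarrow> f x = g x"
  shows "Ck_on k S f \<longleftrightarrow> Ck_on k S g"
proof -
  have *: "(f has_derivative f') (at x within S) \<longleftrightarrow> (g has_derivative f') (at x within S)"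
    if "x \<in> S" for x f'
    using has_derivative_transform[OF that, of f g f'] has_derivative_transform[OF that, of g f f'] assms
    by auto
  show ?thesis
    by (cases k) (use assms in \<open>auto simp: * cong: continuous_on_cong\<close>)
qed

lemma Ck_on_SucD: "Ck_on (Suc k) S f \<Longrightarrow> Ck_on k S f"
proof (induction k arbitrary: f)
  case 0
  then show ?case
    by (auto simp: continuous_on_eq_continuous_within intro: has_derivative_continuous)
next
  case (Suc k)
  then show ?case by (metis Ck_on.simps(2))
qed

lemma Ck_on_const: "Ck_on k S (\<lambda>x. c)"
  by (induction k arbitrary: c) (auto intro!: exI[of _ "\<lambda>x v. 0"])

lemma Ck_on_linear:
  assumes "bounded_linear L"
  shows "Ck_on k S f \<Longrightarrow> Ck_on k S (\<lambda>x. L (f x))"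
proof (induction k arbitrary: f)
  case 0
  then show ?case by (simp add: bounded_linear.continuous_on[OF assms])
next
  case (Suc k)
  then obtain f' where "\<And>x. x \<in> S \<Longrightarrow> (f has_derivative f' x) (at x within S)"
    "\<And>v. Ck_on k S (\<lambda>x. f' x v)" by auto
  with Suc show ?case
    by (intro Ck_on_SucI[where f' = "\<lambda>x v. L (f' x v)"]) (auto intro: bounded_linear.has_derivative[OF assms])
qed

lemma Ck_on_ident_linear:
  assumes "bounded_linear L"
  shows "Ck_on k S L"
proof (cases k)
  case 0
  then show ?thesis by (simp add: linear_continuous_on assms)
next
  case (Suc j)
  show ?thesis unfolding Suc
    by (intro Ck_on_SucI[where f' = "\<lambda>x. L"])
       (auto intro: bounded_linear_imp_has_derivative assms Ck_on_const)
qed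

lemma Ck_on_add: "Ck_on k S f \<Longrightarrow> Ck_on k S g \<Longrightarrow> Ck_on k S (\<lambda>x. f x + g x)"
proof (induction k arbitrary: f g)
  case 0
  then show ?case by (auto intro: continuous_intros)
next
  case (Suc k)
  obtain f' where f': "\<And>x. x \<in> S \<Longrightarrow> (f has_derivative f' x) (at x within S)"
    "\<And>v. Ck_on k S (\<lambda>x. f' x v)" using Suc.prems(1) by auto
  obtain g' where g': "\<And>x. x \<in> S \<Longrightarrow> (g has_derivative g' x) (at x within S)"
    "\<And>v. Ck_on k S (\<lambda>x. g' x v)" using Suc.prems(2) by auto
  show ?case
    by (rule Ck_on_SucI[where f' = "\<lambda>x v. f' x v + g' x v"]) (auto intro: has_derivative_add f' g' Suc.IH)
qed

lemma Ck_on_sum: "(\<And>i. i \<in> I \<Longrightarrow> Ck_on k S (f i)) \<Longrightarrow> Ck_on k S (\<lambda>x. \<Sum>i\<in>I. f i x)"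
  by (induction I rule: infinite_finite_induct) (auto intro: Ck_on_add Ck_on_const)

text \<open>One Leibniz induction serves every product below: scaling, inner products, matrix-vector
  products and \<open>con1\<close> are all bounded bilinear. \<open>Ck_on_SucD\<close> supplies the
  lower regularity of the factor that is not differentiated.\<close>

lemma Ck_on_bilinear:
  assumes "bounded_bilinear B"
  shows "Ck_on k S f \<Longrightarrow> Ck_on k S g \<Longrightarrow> Ck_on k S (\<lambda>x. B (f x) (g x))"
proof (induction k arbitrary: f g)
  case 0
  then show ?case by (simp add: bounded_bilinear.continuous_on[OF assms])
next
  case (Suc k)
  obtain f' where f': "\<And>x. x \<in> S \<Longrightarrow> (f has_derivative f' x) (at x within S)"
    "\<And>v. Ck_on k S (\<lambda>x. f' x v)" using Suc.prems(1) by auto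
  obtain g' where g': "\<And>x. x \<in> S \<Longrightarrow> (g has_derivative g' x) (at x within S)"
    "\<And>v. Ck_on k S (\<lambda>x. g' x v)" using Suc.prems(2) by auto
  show ?case
  proof (rule Ck_on_SucI[where f' = "\<lambda>x v. B (f x) (g' x v) + B (f' x v) (g x)"])
    show "((\<lambda>x. B (f x) (g x)) has_derivative (\<lambda>v. B (f x) (g' x v) + B (f' x v) (g x))) (at x within S)"
      if "x \<in> S" for x
      using bounded_bilinear.FDERIV[OF assms f'(1)[OF that] g'(1)[OF that]] .
    show "Ck_on k S (\<lambda>x. B (f x) (g' x v) + B (f' x v) (g x))" for v
      using Suc.prems[THEN Ck_on_SucD] by (intro Ck_on_add Suc.IH f'(2) g'(2))
  qed
qed

text \<open>By the chain rule the derivative is \<open>f' (g x) (g' x v)\<close>, whose direction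
  varies with \<open>x\<close>, whereas \<open>Ck_on\<close> controls \<open>f'\<close> in fixed
  directions only. Expanding \<open>g' x v\<close> in \<open>Basis\<close> reduces the former to the
  latter; hence the Euclidean space in the middle.\<close>

lemma Ck_on_compose:
  fixes f :: "'b::euclidean_space \<Rightarrow> 'c::real_normed_vector"
  shows "Ck_on k S' f \<Longrightarrow> Ck_on k S g \<Longrightarrow> (\<And>x. x \<in> S \<Longrightarrow> g x \<in> S') \<Longrightarrow> Ck_on k S (\<lambda>x. f (g x))"
proof (induction k arbitrary: f)
  case 0
  then show ?case by (auto intro: continuous_on_compose2)
next
  case (Suc k)
  obtain f' where f': "\<And>x. x \<in> S' \<Longrightarrow> (f has_derivative f' x) (at x within S')"
    "\<And>v. Ck_on k S' (\<lambda>x. f' x v)" using Suc.prems(1) by auto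
  obtain g' where g': "\<And>x. x \<in> S \<Longrightarrow> (g has_derivative g' x) (at x within S)"
    "\<And>v. Ck_on k S (\<lambda>x. g' x v)" using Suc.prems(2) by auto
  show ?case
  proof (rule Ck_on_SucI[where f' = "\<lambda>x v. f' (g x) (g' x v)"])
    fix x assume x: "x \<in> S"
    have "(f has_derivative f' (g x)) (at (g x) within g ` S)"
      by (rule has_derivative_subset[OF f'(1)]) (use Suc.prems(3) x in auto)
    then show "((\<lambda>x. f (g x)) has_derivative (\<lambda>v. f' (g x) (g' x v))) (at x within S)"
      using has_derivative_in_compose[OF g'(1)[OF x]] by blast
  next
    fix v
    have "Ck_on k S (\<lambda>x. \<Sum>b\<in>Basis. (g' x v \<bullet> b) *\<^sub>R f' (g x) b)"
    proof (intro Ck_on_sum Ck_on_bilinear[OF bounded_bilinear_scaleR])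
      show "Ck_on k S (\<lambda>x. g' x v \<bullet> b)" for b
        by (rule Ck_on_linear[OF bounded_linear_inner_left g'(2)])
      show "Ck_on k S (\<lambda>x. f' (g x) b)" for b
        by (rule Suc.IH) (use f' Suc.prems in \<open>auto dest: Ck_on_SucD simp del: Ck_on.simps\<close>)
    qed
    moreover have "f' (g x) (g' x v) = (\<Sum>b\<in>Basis. (g' x v \<bullet> b) *\<^sub>R f' (g x) b)" if "x \<in> S" for x
    proof -
      have lin: "linear (f' (g x))"
        using f'(1)[OF Suc.prems(3)[OF that]] has_derivative_linear by blast
      have "f' (g x) (\<Sum>b\<in>Basis. (g' x v \<bullet> b) *\<^sub>R b) = (\<Sum>b\<in>Basis. (g' x v \<bullet> b) *\<^sub>R f' (g x) b)"
        unfolding linear_sum[OF lin] linear_cmul[OF lin] ..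
      then show ?thesis
        unfolding euclidean_representation .
    qed
    ultimately show "Ck_on k S (\<lambda>x. f' (g x) (g' x v))"
      by (subst Ck_on_cong) auto
  qed
qed

text \<open>The derivative is a product of constants and \<open>inverse\<close> itself, so the
  induction feeds on its own hypothesis. In the same way \<open>Ck_on_sqrt\<close> writes the
  derivative of \<open>sqrt\<close> through \<open>inverse (sqrt x)\<close>.\<close>

lemma Ck_on_inverse: "Ck_on k {x. x \<noteq> 0} (inverse :: real \<Rightarrow> real)"
proof (induction k)
  case 0
  then show ?case by (auto intro!: continuous_intros)
next
  case (Suc k)
  show ?case
  proof (rule Ck_on_SucI[where f' = "\<lambda>x v. - (inverse x * v * inverse x)"])
    show "Ck_on k {x. x \<noteq> 0} (\<lambda>x. - (inverse x * v * inverse x))" for v :: real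
      by (rule Ck_on_linear[OF bounded_linear_minus[OF bounded_linear_ident]] Ck_on_bilinear[OF bounded_bilinear_mult] Suc Ck_on_const)+
  qed (auto intro: has_derivative_inverse')
qed

lemma Ck_on_sqrt: "Ck_on k {0<..} sqrt"
proof (induction k)
  case 0
  then show ?case by (auto intro!: continuous_intros)
next
  case (Suc k)
  show ?case
  proof (rule Ck_on_SucI[where f' = "\<lambda>x v. inverse (sqrt x) * (v / 2)"])
    show "Ck_on k {0<..} (\<lambda>x. inverse (sqrt x) * (v / 2))" for v :: real
      by (rule Ck_on_bilinear[OF bounded_bilinear_mult] Suc Ck_on_compose[OF Ck_on_inverse] Ck_on_const)+ (auto intro: Ck_on_const)
    show "(sqrt has_derivative (\<lambda>v. inverse (sqrt x) * (v / 2))) (at x within {0<..})"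
      if "x \<in> {0<..}" for x
      using that by (auto intro!: derivative_eq_intros simp: field_simps)
  qed
qed

section \<open>Closure properties of smooth maps\<close>

lemma smooth_on_cong: "(\<And>x. x \<in> S \<Longrightarrow> f x = g x) \<Longrightarrow> smooth_on S f \<longleftrightarrow> smooth_on S g"
  using Ck_on_cong[of S f g] by (simp add: smooth_on_def)

lemma smooth_on_imp_continuous_on: "smooth_on S f \<Longrightarrow> continuous_on S f"
  unfolding smooth_on_def using Ck_on.simps(1) by blast

lemma smooth_on_const: "smooth_on S (\<lambda>x. c)"
  unfolding smooth_on_def using Ck_on_const by blast

lemma smooth_on_linear: "bounded_linear L \<Longrightarrow> smooth_on S f \<Longrightarrow> smooth_on S (\<lambda>x. L (f x))"
  unfolding smooth_on_def using Ck_on_linear by blast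

lemma smooth_on_ident_linear: "bounded_linear L \<Longrightarrow> smooth_on S L"
  unfolding smooth_on_def using Ck_on_ident_linear by blast

lemma smooth_on_add: "smooth_on S f \<Longrightarrow> smooth_on S g \<Longrightarrow> smooth_on S (\<lambda>x. f x + g x)"
  unfolding smooth_on_def using Ck_on_add by blast

lemma smooth_on_minus: "smooth_on S f \<Longrightarrow> smooth_on S (\<lambda>x. - f x)"
  by (rule smooth_on_linear[OF bounded_linear_minus[OF bounded_linear_ident]])

lemma smooth_on_diff: "smooth_on S f \<Longrightarrow> smooth_on S g \<Longrightarrow> smooth_on S (\<lambda>x. f x - g x)"
  using smooth_on_add[OF _ smooth_on_minus, of S f g] by simp

lemma smooth_on_sum: "(\<And>i. i \<in> I \<Longrightarrow> smooth_on S (f i)) \<Longrightarrow> smooth_on S (\<lambda>x. \<Sum>i\<in>I. f i x)"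
  by (simp add: smooth_on_def Ck_on_sum)

lemma smooth_on_bilinear:
  "bounded_bilinear B \<Longrightarrow> smooth_on S f \<Longrightarrow> smooth_on S g \<Longrightarrow> smooth_on S (\<lambda>x. B (f x) (g x))"
  unfolding smooth_on_def using Ck_on_bilinear by blast

lemmas smooth_on_mult = smooth_on_bilinear[OF bounded_bilinear_mult]
lemmas smooth_on_scaleR = smooth_on_bilinear[OF bounded_bilinear_scaleR]

lemma smooth_on_prod:
  fixes f :: "'i \<Rightarrow> 'a::real_normed_vector \<Rightarrow> real"
  shows "(\<And>i. i \<in> I \<Longrightarrow> smooth_on S (f i)) \<Longrightarrow> smooth_on S (\<lambda>x. \<Prod>i\<in>I. f i x)"
  by (induction I rule: infinite_finite_induct) (auto intro: smooth_on_mult smooth_on_const)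

lemma smooth_on_compose:
  fixes f :: "'b::euclidean_space \<Rightarrow> 'c::real_normed_vector"
  shows "smooth_on S' f \<Longrightarrow> smooth_on S g \<Longrightarrow> (\<And>x. x \<in> S \<Longrightarrow> g x \<in> S') \<Longrightarrow> smooth_on S (\<lambda>x. f (g x))"
  unfolding smooth_on_def using Ck_on_compose by blast

lemma smooth_on_inverse:
  fixes f :: "'a::real_normed_vector \<Rightarrow> real"
  assumes "smooth_on S f" "\<And>x. x \<in> S \<Longrightarrow> f x \<noteq> 0"
  shows "smooth_on S (\<lambda>x. inverse (f x))"
proof (rule smooth_on_compose[where f = inverse])
  show "smooth_on {x. x \<noteq> 0} (inverse :: real \<Rightarrow> real)"
    unfolding smooth_on_def using Ck_on_inverse by blast
qed (use assms in auto)

lemma smooth_on_divide: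
  fixes f g :: "'a::real_normed_vector \<Rightarrow> real"
  assumes "smooth_on S f" "smooth_on S g" "\<And>x. x \<in> S \<Longrightarrow> g x \<noteq> 0"
  shows "smooth_on S (\<lambda>x. f x / g x)"
  unfolding divide_inverse by (intro smooth_on_mult smooth_on_inverse assms)

lemma smooth_on_sqrt:
  assumes "smooth_on S f" "\<And>x. x \<in> S \<Longrightarrow> f x > 0"
  shows "smooth_on S (\<lambda>x. sqrt (f x))"
proof (rule smooth_on_compose[where f = sqrt])
  show "smooth_on {0<..} sqrt"
    unfolding smooth_on_def using Ck_on_sqrt by blast
qed (use assms in auto)

lemma smooth_on_vec_nth: "smooth_on S f \<Longrightarrow> smooth_on S (\<lambda>x. f x $ i)"
  by (rule smooth_on_linear[OF bounded_linear_vec_nth])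

lemma bounded_linear_axis: "bounded_linear (axis i :: 'a::real_normed_vector \<Rightarrow> 'a^'n::finite)"
proof (rule bounded_linear_intro[where K = 1])
  fix x :: 'a
  have "(norm (axis i x $ j))\<^sup>2 = (if j = i then (norm x)\<^sup>2 else 0)" for j :: 'n
    by (simp add: axis_def)
  then show "norm (axis i x :: 'a^'n) \<le> norm x * 1"
    by (simp add: norm_vec_def L2_set_def)
qed (auto simp: axis_def vec_eq_iff)

lemma smooth_on_vec_lambda:
  fixes f :: "'a::real_normed_vector \<Rightarrow> 'i::finite \<Rightarrow> 'b::real_normed_vector"
  assumes "\<And>i. smooth_on S (\<lambda>x. f x i)"
  shows "smooth_on S (\<lambda>x. \<chi> i. f x i)"
proof -
  have *: "(\<chi> i. f x i) = (\<Sum>i\<in>UNIV. axis i (f x i))" for x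
    by (simp add: vec_eq_iff axis_def)
  show ?thesis
    unfolding * by (intro smooth_on_sum smooth_on_linear[OF bounded_linear_axis] assms)
qed

lemma smooth_on_Pair:
  assumes "smooth_on S f" "smooth_on S g"
  shows "smooth_on S (\<lambda>x. (f x, g x))"
proof -
  have *: "(f x, g x) = (f x, 0) + (0, g x)" for x by simp
  show ?thesis
    unfolding * by (intro smooth_on_add smooth_on_linear[where L = "\<lambda>v. (v, 0)"]
        smooth_on_linear[where L = "\<lambda>v. (0, v)"] assms)
      (auto intro: bounded_linear_intros)
qed

section \<open>Determinants and inverse matrices\<close>

lemma smooth_on_det:
  fixes B :: "'a::real_normed_vector \<Rightarrow> real^'n^'n::finite"
  assumes "\<And>i j. smooth_on S (\<lambda>x. B x $ i $ j)"
  shows "smooth_on S (\<lambda>x. det (B x))"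
  unfolding det_def
  by (intro smooth_on_sum smooth_on_mult smooth_on_const smooth_on_prod assms)

text \<open>Cramer's rule makes the inverse a quotient of polynomials in the entries. The smoothness
  of inverse matrices, and through it that of the Christoffel symbols, is read off from this
  quotient.\<close>

lemma matrix_inv_cramer:
  fixes B :: "real^'n^'n::finite"
  assumes "invertible B"
  shows "matrix_inv B $ l $ m = det (\<chi> i j. if j = l then axis m 1 $ i else B $ i $ j) / det B"
proof -
  have "B *v (matrix_inv B *v axis m 1) = axis m 1"
    using matrix_inv_inverse[OF assms] by (simp add: matrix_vector_mul_assoc)
  then have "matrix_inv B *v axis m 1 = (\<chi> k. det (\<chi> i j. if j = k then axis m 1 $ i else B $ i $ j) / det B)"
    using cramer assms invertible_det_nz by blast
  then have "(matrix_inv B *v axis m 1) $ l = det (\<chi> i j. if j = l then axis m 1 $ i else B $ i $ j) / det B"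
    by simp
  then show ?thesis
    by (simp add: matrix_vector_mult_basis column_def)
qed

lemma smooth_on_matrix_inv:
  fixes B :: "'a::real_normed_vector \<Rightarrow> real^'n^'n::finite"
  assumes "smooth_on S B" "\<And>x. x \<in> S \<Longrightarrow> invertible (B x)"
  shows "smooth_on S (\<lambda>x. matrix_inv (B x) $ l $ m)"
proof -
  let ?D = "\<lambda>x. det (\<chi> i j. if j = l then axis m 1 $ i else B x $ i $ j) / det (B x)"
  have "smooth_on S (\<lambda>x. matrix_inv (B x) $ l $ m) \<longleftrightarrow> smooth_on S ?D"
    by (rule smooth_on_cong) (rule matrix_inv_cramer[OF assms(2)])
  moreover have "smooth_on S ?D"
  proof (intro smooth_on_divide smooth_on_det)
    fix i j
    show "smooth_on S (\<lambda>x. B x $ i $ j)"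
      using assms(1) by (intro smooth_on_vec_nth)
    then show "smooth_on S (\<lambda>x. (\<chi> i j. if j = l then axis m 1 $ i else B x $ i $ j) $ i $ j)"
      by (cases "j = l") (auto intro: smooth_on_const)
  qed (use assms(2) invertible_det_nz in blast)
  ultimately show ?thesis by blast
qed


section \<open>Partial derivatives of maps of two real variables\<close>

text \<open>The boundary of the rectangle is included, as needed for the times \<open>0\<close> and \<open>T\<close>.\<close>

lemma mixed_partials:
  fixes f :: "real \<Rightarrow> real \<Rightarrow> 'b::euclidean_space"
  assumes ab: "a < b" and cd: "c < d"
    and fx: "\<And>x t. x \<in> {a..b} \<Longrightarrow> t \<in> {c..d} \<Longrightarrow>
      ((\<lambda>x. f x t) has_vector_derivative fx x t) (at x within {a..b})"
    and ft: "\<And>x t. x \<in> {a..b} \<Longrightarrow> t \<in> {c..d} \<Longrightarrow>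
      ((\<lambda>t. f x t) has_vector_derivative ft x t) (at t within {c..d})"
    and fxt: "\<And>x t. x \<in> {a..b} \<Longrightarrow> t \<in> {c..d} \<Longrightarrow>
      ((\<lambda>t. fx x t) has_vector_derivative fxt x t) (at t within {c..d})"
    and ftx: "\<And>x t. x \<in> {a..b} \<Longrightarrow> t \<in> {c..d} \<Longrightarrow>
      ((\<lambda>x. ft x t) has_vector_derivative ftx x t) (at x within {a..b})"
    and cont: "continuous_on ({a..b} \<times> {c..d}) (\<lambda>(x, t). fxt x t)"
    and contx: "continuous_on ({a..b} \<times> {c..d}) (\<lambda>(x, t). fx x t)"
    and x: "x \<in> {a..b}" and t: "t \<in> {c..d}"
  shows "ftx x t = fxt x t"
proof -
  have cx: "continuous_on {a..\<xi>} (\<lambda>x. fx x s)" if "s \<in> {c..d}" "\<xi> \<in> {a..b}" for \<xi> s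
    by (rule continuous_on_compose2[OF contx, of _ "\<lambda>x. (x, s)", simplified])
       (use that in \<open>auto intro!: continuous_intros\<close>)
  have cxt: "continuous_on {a..b} (\<lambda>x. fxt x t)"
    by (rule continuous_on_compose2[OF cont, of _ "\<lambda>x. (x, t)", simplified])
       (use t in \<open>auto intro!: continuous_intros\<close>)
  \<comment> \<open>\<open>f\<close> is recovered from \<open>fx\<close> by integration in
    \<open>x\<close>; Leibniz' rule differentiates under the integral in \<open>t\<close>, and
    comparison with \<open>ft\<close> makes \<open>ft\<close> an integral of \<open>fxt\<close>.
    Differentiating this in \<open>x\<close> gives the claim.\<close>
  have ftint: "ft \<xi> t = ft a t + integral {a..\<xi>} (\<lambda>\<eta>. fxt \<eta> t)" if \<xi>: "\<xi> \<in> {a..b}" for \<xi>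
  proof -
    have ftc: "f \<xi> s = f a s + integral {a..\<xi>} (\<lambda>\<eta>. fx \<eta> s)" if s: "s \<in> {c..d}" for s
    proof -
      have "((\<lambda>\<eta>. fx \<eta> s) has_integral (f \<xi> s - f a s)) {a..\<xi>}"
        by (rule fundamental_theorem_of_calculus)
           (use \<xi> s in \<open>auto intro!: has_vector_derivative_within_subset[OF fx]\<close>)
      then show ?thesis by (simp add: integral_unique)
    qed
    have "((\<lambda>s. integral (cbox a \<xi>) (\<lambda>\<eta>. fx \<eta> s)) has_vector_derivative
        integral (cbox a \<xi>) (\<lambda>\<eta>. fxt \<eta> t)) (at t within {c..d})"
    proof (rule leibniz_rule_vector_derivative)
      show "continuous_on ({c..d} \<times> cbox a \<xi>) (\<lambda>(s, \<eta>). fxt \<eta> s)"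
        unfolding split_beta
        by (rule continuous_on_compose2[OF cont, of _ "\<lambda>p. (snd p, fst p)", simplified split_beta fst_conv snd_conv])
           (use \<xi> in \<open>auto intro!: continuous_intros\<close>)
      show "(\<lambda>\<eta>. fx \<eta> s) integrable_on cbox a \<xi>" if "s \<in> {c..d}" for s
        using cx[OF that \<xi>] integrable_continuous[of a \<xi>] by simp
    qed (use fxt \<xi> t in auto)
    then have "((\<lambda>s. f a s + integral {a..\<xi>} (\<lambda>\<eta>. fx \<eta> s)) has_vector_derivative
        (ft a t + integral {a..\<xi>} (\<lambda>\<eta>. fxt \<eta> t))) (at t within {c..d})"
      using ft[of a t] ab t by (auto intro!: has_vector_derivative_add)
    then have "((\<lambda>s. f \<xi> s) has_vector_derivative
        (ft a t + integral {a..\<xi>} (\<lambda>\<eta>. fxt \<eta> t))) (at t within {c..d})"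
      by (rule has_vector_derivative_transform[OF t, rotated]) (rule ftc)
    with ft[OF \<xi> t] show ?thesis
      using vector_derivative_unique_within_closed_interval[of c d t, unfolded box_real, OF cd t] by blast
  qed
  have "((\<lambda>\<xi>. ft a t + integral {a..\<xi>} (\<lambda>\<eta>. fxt \<eta> t)) has_vector_derivative (0 + fxt x t)) (at x within {a..b})"
    by (intro has_vector_derivative_add has_vector_derivative_const integral_has_vector_derivative cxt x)
  then have "((\<lambda>\<xi>. ft \<xi> t) has_vector_derivative (0 + fxt x t)) (at x within {a..b})"
    by (rule has_vector_derivative_transform[OF x, rotated]) (rule ftint)
  with ftx[OF x t] show ?thesis
    using vector_derivative_unique_within_closed_interval[of a b x, unfolded box_real, OF ab x] by force
qed

definition px :: "(real \<times> real \<Rightarrow> 'b::real_normed_vector) \<Rightarrow> real \<times> real \<Rightarrow> 'b" where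
  "px f p = vector_derivative (\<lambda>\<xi>. f (\<xi>, snd p)) (at (fst p))"

text \<open>The derivative is taken within \<open>[0, T]\<close>, so it is one-sided at both ends.
  The first factor is generic because \<open>pt\<close> serves maps of \<open>(x, t)\<close> along a
  family of curves as well as metrics depending on a coordinate point and on
  \<open>t\<close>.\<close>

definition pt :: "real \<Rightarrow> ('a \<times> real \<Rightarrow> 'b::real_normed_vector) \<Rightarrow> 'a \<times> real \<Rightarrow> 'b" where
  "pt T f p = vector_derivative (\<lambda>s. f (fst p, s)) (at (snd p) within {0..T})"

lemma smooth_on_obtains_derivative:
  assumes "smooth_on S f"
  obtains f' where "\<And>p. p \<in> S \<Longrightarrow> (f has_derivative f' p) (at p within S)"
  using assms unfolding smooth_on_def by (metis Ck_on.simps(2))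

text \<open>Mainly models the parameters \<open>(x, t)\<close> for which the curve stays in a given
  chart: by continuity they form a relatively open set, which may reach the boundary times.\<close>

locale strip =
  fixes T :: real and W :: "(real \<times> real) set"
  assumes T_pos: "0 < T" and W_open: "openin (top_of_set (UNIV \<times> {0..T})) W"
begin

lemma W_time: "p \<in> W \<Longrightarrow> snd p \<in> {0..T}"
  using openin_imp_subset[OF W_open] by auto

lemma W_nbhd:
  assumes "p \<in> W"
  obtains e where "e > 0"
    "\<And>x' t'. \<bar>x' - fst p\<bar> \<le> e \<Longrightarrow> \<bar>t' - snd p\<bar> \<le> e \<Longrightarrow> t' \<in> {0..T} \<Longrightarrow> (x', t') \<in> W"
proof -
  obtain x t where p: "p = (x, t)" by (cases p)
  obtain Q where Q: "open Q" "W = (UNIV \<times> {0..T}) \<inter> Q"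
    using W_open by (auto simp: openin_open)
  obtain A B where AB: "open A" "open B" "x \<in> A" "t \<in> B" "A \<times> B \<subseteq> Q"
    using Q assms p by (metis IntD2 open_prod_elim mem_Sigma_iff)
  obtain r where r: "r > 0" "cball x r \<subseteq> A" using AB open_contains_cball by blast
  obtain s where s: "s > 0" "cball t s \<subseteq> B" using AB open_contains_cball by blast
  have "\<bar>x' - x\<bar> \<le> min r s \<Longrightarrow> \<bar>t' - t\<bar> \<le> min r s \<Longrightarrow> t' \<in> {0..T} \<Longrightarrow> (x', t') \<in> W" for x' t'
  proof -
    assume a: "\<bar>x' - x\<bar> \<le> min r s" "\<bar>t' - t\<bar> \<le> min r s" "t' \<in> {0..T}"
    have "x' \<in> cball x r" "t' \<in> cball t s"
      using a by (auto simp: dist_real_def abs_minus_commute)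
    then show ?thesis using r s AB(5) Q(2) a(3) by blast
  qed
  then show ?thesis using that[of "min r s"] r s p by auto
qed

lemma eventually_x_in_W:
  assumes "p \<in> W"
  shows "eventually (\<lambda>\<xi>. (\<xi>, snd p) \<in> W) (nhds (fst p))"
proof -
  obtain e where e: "e > 0"
    "\<And>x' t'. \<bar>x' - fst p\<bar> \<le> e \<Longrightarrow> \<bar>t' - snd p\<bar> \<le> e \<Longrightarrow> t' \<in> {0..T} \<Longrightarrow> (x', t') \<in> W"
    using W_nbhd[OF assms] by metis
  show ?thesis
    unfolding eventually_nhds_metric
    using e W_time[OF assms] by (auto intro!: exI[of _ e] simp: dist_real_def)
qed

lemma eventually_t_in_W:
  assumes "p \<in> W"
  shows "eventually (\<lambda>s. s \<in> {0..T} \<longrightarrow> (fst p, s) \<in> W) (nhds (snd p))"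
proof -
  obtain e where e: "e > 0"
    "\<And>x' t'. \<bar>x' - fst p\<bar> \<le> e \<Longrightarrow> \<bar>t' - snd p\<bar> \<le> e \<Longrightarrow> t' \<in> {0..T} \<Longrightarrow> (x', t') \<in> W"
    using W_nbhd[OF assms] by metis
  show ?thesis
    unfolding eventually_nhds_metric
    using e by (auto intro!: exI[of _ e] simp: dist_real_def)
qed

lemma has_vector_derivative_x:
  assumes "(f has_derivative f') (at p within W)" "p \<in> W"
  shows "((\<lambda>\<xi>. f (\<xi>, snd p)) has_vector_derivative f' (1, 0)) (at (fst p))"
proof -
  obtain U where U: "open U" "fst p \<in> U" "\<And>\<xi>. \<xi> \<in> U \<Longrightarrow> (\<xi>, snd p) \<in> W"
    using eventually_x_in_W[OF assms(2)] unfolding eventually_nhds by blast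
  have 1: "((\<lambda>\<xi>. (\<xi>, snd p)) has_derivative (\<lambda>h. (h, 0))) (at (fst p) within U)"
    by (auto intro!: derivative_eq_intros)
  have 2: "(f has_derivative f') (at (fst p, snd p) within (\<lambda>\<xi>. (\<xi>, snd p)) ` U)"
    unfolding prod.collapse by (rule has_derivative_subset[OF assms(1)]) (use U in auto)
  have "((\<lambda>\<xi>. f (\<xi>, snd p)) has_derivative (\<lambda>h. f' (h, 0))) (at (fst p))"
    using has_derivative_in_compose[OF 1, of f f'] 2 unfolding at_within_open[OF U(2,1)] by blast
  moreover have "(\<lambda>h. f' (h, 0)) = (\<lambda>h. h *\<^sub>R f' (1, 0))"
    by (simp flip: linear_cmul[OF has_derivative_linear[OF assms(1)]])
  ultimately show ?thesis unfolding has_vector_derivative_def by metis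
qed

lemma has_vector_derivative_t:
  assumes "(f has_derivative f') (at p within W)" "p \<in> W"
  shows "((\<lambda>s. f (fst p, s)) has_vector_derivative f' (0, 1)) (at (snd p) within {0..T})"
proof -
  obtain U where U: "open U" "snd p \<in> U" "\<And>s. s \<in> U \<Longrightarrow> s \<in> {0..T} \<Longrightarrow> (fst p, s) \<in> W"
    using eventually_t_in_W[OF assms(2)] unfolding eventually_nhds by blast
  have 1: "((\<lambda>s. (fst p, s)) has_derivative (\<lambda>h. (0, h))) (at (snd p) within {0..T} \<inter> U)"
    by (auto intro!: derivative_eq_intros)
  have 2: "(f has_derivative f') (at (fst p, snd p) within (\<lambda>s. (fst p, s)) ` ({0..T} \<inter> U))"
    unfolding prod.collapse by (rule has_derivative_subset[OF assms(1)]) (use U in auto)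
  have 3: "at (snd p) within {0..T} \<inter> U = at (snd p) within {0..T}"
    by (rule at_within_nhd[OF U(2,1)]) auto
  have "((\<lambda>s. f (fst p, s)) has_derivative (\<lambda>h. f' (0, h))) (at (snd p) within {0..T})"
    using has_derivative_in_compose[OF 1, of f f'] 2 unfolding 3 by blast
  moreover have "(\<lambda>h. f' (0, h)) = (\<lambda>h. h *\<^sub>R f' (0, 1))"
    by (simp flip: linear_cmul[OF has_derivative_linear[OF assms(1)]])
  ultimately show ?thesis unfolding has_vector_derivative_def by metis
qed

lemma px_eqI:
  "((\<lambda>\<xi>. f (\<xi>, snd p)) has_vector_derivative D) (at (fst p)) \<Longrightarrow> px f p = D"
  unfolding px_def by (rule vector_derivative_at)

text \<open>One-sided derivatives at 0 and T are unique because \<open>0 < T\<close> makes the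
  interval nondegenerate.\<close>

lemma pt_eqI:
  "p \<in> W \<Longrightarrow> ((\<lambda>s. f (fst p, s)) has_vector_derivative D) (at (snd p) within {0..T}) \<Longrightarrow> pt T f p = D"
  unfolding pt_def
  using vector_derivative_within_cbox[of 0 T "snd p" "\<lambda>s. f (fst p, s)" D] T_pos W_time by auto

lemma has_px:
  assumes "smooth_on W f" "p \<in> W"
  shows "((\<lambda>\<xi>. f (\<xi>, snd p)) has_vector_derivative px f p) (at (fst p))"
  using smooth_on_obtains_derivative[OF assms(1)] has_vector_derivative_x[OF _ assms(2)] assms(2) px_eqI
  by metis

lemma has_pt:
  assumes "smooth_on W f" "p \<in> W"
  shows "((\<lambda>s. f (fst p, s)) has_vector_derivative pt T f p) (at (snd p) within {0..T})"
  using smooth_on_obtains_derivative[OF assms(1)] has_vector_derivative_t[OF _ assms(2)] assms(2) pt_eqI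
  by metis

lemma smooth_on_px:
  assumes "smooth_on W f"
  shows "smooth_on W (px f)"
  unfolding smooth_on_def
proof
  fix k
  obtain f' where f': "\<And>p. p \<in> W \<Longrightarrow> (f has_derivative f' p) (at p within W)"
    "\<And>v. Ck_on k W (\<lambda>p. f' p v)"
    using assms unfolding smooth_on_def by (metis Ck_on.simps(2))
  have "Ck_on k W (px f) \<longleftrightarrow> Ck_on k W (\<lambda>p. f' p (1, 0))"
    by (rule Ck_on_cong) (use f' has_vector_derivative_x px_eqI in metis)
  then show "Ck_on k W (px f)" using f' by blast
qed

lemma smooth_on_pt:
  assumes "smooth_on W f"
  shows "smooth_on W (pt T f)"
  unfolding smooth_on_def
proof
  fix k
  obtain f' where f': "\<And>p. p \<in> W \<Longrightarrow> (f has_derivative f' p) (at p within W)"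
    "\<And>v. Ck_on k W (\<lambda>p. f' p v)"
    using assms unfolding smooth_on_def by (metis Ck_on.simps(2))
  have "Ck_on k W (pt T f) \<longleftrightarrow> Ck_on k W (\<lambda>p. f' p (0, 1))"
    by (rule Ck_on_cong) (use f' has_vector_derivative_t pt_eqI in metis)
  then show "Ck_on k W (pt T f)" using f' by blast
qed

text \<open>Identities between fields along the curves hold on \<open>W\<close> only. They may still
  be differentiated, since around each of its points \<open>W\<close> contains an interval in
  \<open>x\<close> and, relative to \<open>[0, T]\<close>, a neighbourhood in time
  (\<open>pt_cong\<close>).\<close>

lemma px_cong:
  assumes "\<And>q. q \<in> W \<Longrightarrow> f q = g q" "p \<in> W"
  shows "px f p = px g p"
  unfolding px_def
  by (rule vector_derivative_cong_eq)
     (use eventually_x_in_W[OF assms(2)] assms in \<open>auto elim: eventually_mono\<close>)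

lemma pt_cong:
  assumes "\<And>q. q \<in> W \<Longrightarrow> f q = g q" "p \<in> W"
  shows "pt T f p = pt T g p"
  unfolding pt_def
  by (rule vector_derivative_cong_eq)
     (use eventually_t_in_W[OF assms(2)] W_time[OF assms(2)] assms in \<open>auto elim: eventually_mono\<close>)

lemma pt_px_commute:
  fixes f :: "real \<times> real \<Rightarrow> 'b::euclidean_space"
  assumes f: "smooth_on W f" and p: "p \<in> W"
  shows "px (pt T f) p = pt T (px f) p"
proof -
  obtain x t where xt: "p = (x, t)" by (cases p)
  obtain e where e: "e > 0"
    "\<And>x' t'. \<bar>x' - x\<bar> \<le> e \<Longrightarrow> \<bar>t' - t\<bar> \<le> e \<Longrightarrow> t' \<in> {0..T} \<Longrightarrow> (x', t') \<in> W"
    using W_nbhd[OF p] xt by auto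
  \<comment> \<open>Cutting the rectangle off at 0 and T keeps it in \<open>W\<close>. It stays
    nondegenerate even for \<open>t = 0\<close> or \<open>t = T\<close> because
    \<open>0 < T\<close>.\<close>
  define c d where "c = max 0 (t - e)" and "d = min T (t + e)"
  have t: "t \<in> {0..T}" using W_time[OF p] xt by simp
  have cd: "c < d" "t \<in> {c..d}" using t e T_pos by (auto simp: c_def d_def)
  have box: "(x', t') \<in> W" if "x' \<in> {x-e..x+e}" "t' \<in> {c..d}" for x' t'
    by (rule e(2)) (use that in \<open>auto simp: c_def d_def\<close>)
  have sub: "{c..d} \<subseteq> {0..T}" by (auto simp: c_def d_def)
  have cont: "continuous_on ({x-e..x+e} \<times> {c..d}) (\<lambda>(x, t). h (x, t))" if "smooth_on W h"
    for h :: "real \<times> real \<Rightarrow> 'b"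
    by (rule continuous_on_subset[OF smooth_on_imp_continuous_on, of W]) (use that box in auto)
  have cpx: "continuous_on ({x-e..x+e} \<times> {c..d}) (\<lambda>(x, t). px f (x, t))"
    and cptx: "continuous_on ({x-e..x+e} \<times> {c..d}) (\<lambda>(x, t). pt T (px f) (x, t))"
    by (intro cont smooth_on_pt smooth_on_px f)+
  show ?thesis
    unfolding xt
  proof (rule mixed_partials[where f = "\<lambda>x t. f (x, t)" and fx = "\<lambda>x t. px f (x, t)" and ft = "\<lambda>x t. pt T f (x, t)"
        and fxt = "\<lambda>x t. pt T (px f) (x, t)" and ftx = "\<lambda>x t. px (pt T f) (x, t)"
        and a = "x - e" and b = "x + e" and c = c and d = d])
    fix x' t' assume xt': "x' \<in> {x-e..x+e}" "t' \<in> {c..d}"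
    show "((\<lambda>x. f (x, t')) has_vector_derivative px f (x', t')) (at x' within {x-e..x+e})"
      using has_px[OF f box[OF xt']] by (auto intro: has_vector_derivative_at_within)
    show "((\<lambda>x. pt T f (x, t')) has_vector_derivative px (pt T f) (x', t')) (at x' within {x-e..x+e})"
      using has_px[OF smooth_on_pt[OF f] box[OF xt']] by (auto intro: has_vector_derivative_at_within)
    show "((\<lambda>t. f (x', t)) has_vector_derivative pt T f (x', t')) (at t' within {c..d})"
      using has_pt[OF f box[OF xt']] sub by (auto intro: has_vector_derivative_within_subset)
    show "((\<lambda>t. px f (x', t)) has_vector_derivative pt T (px f) (x', t')) (at t' within {c..d})"
      using has_pt[OF smooth_on_px[OF f] box[OF xt']] sub by (auto intro: has_vector_derivative_within_subset)
  qed (use e(1) cd cpx cptx in auto)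
qed

end


section \<open>Evolution of the curvature along a flow of curves\<close>

text \<open>With the Christoffel symbols as \<open>B\<close> this is the zeroth-order term of the
  covariant derivative of \<open>v\<close> in direction \<open>u\<close>; with derivatives of them
  as \<open>B\<close> it yields terms of the curvature and the variation of the connection.\<close>

definition con :: "real^'n::finite^'n^'n \<Rightarrow> real^'n \<Rightarrow> real^'n \<Rightarrow> real^'n" where
  "con B u v = (\<chi> l. \<Sum>i\<in>UNIV. \<Sum>j\<in>UNIV. B $ l $ i $ j * u $ i * v $ j)"

section \<open>Algebra and product rules for the contractions\<close>

lemma metric_inner_linear:
  shows "metric_inner (B + C) u v = metric_inner B u v + metric_inner C u v"
    and "metric_inner (c *\<^sub>R B) u v = c * metric_inner B u v"
    and "metric_inner B (u + u') v = metric_inner B u v + metric_inner B u' v"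
    and "metric_inner B u (v + v') = metric_inner B u v + metric_inner B u v'"
    and "metric_inner B (u - u') v = metric_inner B u v - metric_inner B u' v"
    and "metric_inner B u (v - v') = metric_inner B u v - metric_inner B u v'"
    and "metric_inner B (c *\<^sub>R u) v = c * metric_inner B u v"
    and "metric_inner B u (c *\<^sub>R v) = c * metric_inner B u v"
    and "metric_inner B (- u) v = - metric_inner B u v"
    and "metric_inner B u (- v) = - metric_inner B u v"
    and "metric_inner B 0 v = 0"
    and "metric_inner B u 0 = 0"
  unfolding metric_inner_def
  by (simp_all add: algebra_simps sum.distrib sum_distrib_left sum_subtractf sum_negf)

lemma con_linear:
  shows "con (B + C) u v = con B u v + con C u v"
    and "con (c *\<^sub>R B) u v = c *\<^sub>R con B u v"
    and "con B (u + u') v = con B u v + con B u' v"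
    and "con B u (v + v') = con B u v + con B u v'"
    and "con B (c *\<^sub>R u) v = c *\<^sub>R con B u v"
    and "con B u (c *\<^sub>R v) = c *\<^sub>R con B u v"
  unfolding con_def
  by (simp_all add: vec_eq_iff algebra_simps sum.distrib sum_distrib_left)

lemma metric_inner_sym:
  assumes "transpose B = B"
  shows "metric_inner B u v = metric_inner B v u"
proof -
  have "B $ i $ j = B $ j $ i" for i j
    using arg_cong[OF assms, of "\<lambda>C. C $ i $ j"] by (simp add: transpose_def)
  then show ?thesis
    unfolding metric_inner_def by (subst sum.swap) (simp add: mult_ac)
qed

lemma bounded_bilinear_matrix_vector: "bounded_bilinear (\<lambda>(B :: real^'n::finite^'m::finite) v. B *v v)"
  by (simp add: bilinear_conv_bounded_bilinear[symmetric] bilinear_def linear_iff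
      matrix_vector_right_distrib matrix_vector_mult_add_rdistrib matrix_vector_mult_scaleR scaleR_matrix_vector_assoc)

text \<open>\<open>con1\<close> writes the trilinear map \<open>con\<close> as a composition of bilinear ones, so that the product rules for the latter apply.\<close>

definition con1 :: "real^'n::finite^'n^'n \<Rightarrow> real^'n \<Rightarrow> real^'n^'n" where
  "con1 B u = (\<chi> l j. \<Sum>i\<in>UNIV. B $ l $ i $ j * u $ i)"

lemma bounded_bilinear_con1: "bounded_bilinear con1"
  by (simp add: bilinear_conv_bounded_bilinear[symmetric] bilinear_def linear_iff con1_def
      vec_eq_iff algebra_simps sum.distrib sum_distrib_left)

lemma con_eq_matrix_vector: "con B u v = con1 B u *v v"
  unfolding con_def con1_def matrix_vector_mult_def
  by (simp add: vec_eq_iff sum_distrib_right) (intro allI sum.swap)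

lemma metric_inner_eq_inner: "metric_inner B u v = u \<bullet> (B *v v)"
  unfolding metric_inner_def inner_vec_def matrix_vector_mult_def
  by (simp add: sum_distrib_left mult_ac)

lemma smooth_on_metric_inner:
  assumes "smooth_on D B" "smooth_on D u" "smooth_on D v"
  shows "smooth_on D (\<lambda>p. metric_inner (B p) (u p) (v p))"
  unfolding metric_inner_eq_inner
  by (intro smooth_on_bilinear[OF bounded_bilinear_inner] smooth_on_bilinear[OF bounded_bilinear_matrix_vector] assms)

lemma smooth_on_con:
  assumes "smooth_on D B" "smooth_on D u" "smooth_on D v"
  shows "smooth_on D (\<lambda>p. con (B p) (u p) (v p))"
  unfolding con_eq_matrix_vector
  by (intro smooth_on_bilinear[OF bounded_bilinear_con1] smooth_on_bilinear[OF bounded_bilinear_matrix_vector] assms)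

lemma has_vector_derivative_metric_inner:
  assumes "(B has_vector_derivative B') (at x within D)" "(u has_vector_derivative u') (at x within D)"
    "(v has_vector_derivative v') (at x within D)"
  shows "((\<lambda>x. metric_inner (B x) (u x) (v x)) has_vector_derivative
     metric_inner B' (u x) (v x) + metric_inner (B x) u' (v x) + metric_inner (B x) (u x) v') (at x within D)"
  unfolding metric_inner_eq_inner
  using bounded_bilinear.has_vector_derivative[OF bounded_bilinear_inner assms(2)
      bounded_bilinear.has_vector_derivative[OF bounded_bilinear_matrix_vector assms(1,3)]]
  by (simp add: inner_right_distrib algebra_simps)

lemma has_vector_derivative_con:
  assumes "(B has_vector_derivative B') (at x within D)" "(u has_vector_derivative u') (at x within D)"
    "(v has_vector_derivative v') (at x within D)"
  shows "((\<lambda>x. con (B x) (u x) (v x)) has_vector_derivative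
     con B' (u x) (v x) + con (B x) u' (v x) + con (B x) (u x) v') (at x within D)"
  unfolding con_eq_matrix_vector
  using bounded_bilinear.has_vector_derivative[OF bounded_bilinear_matrix_vector
      bounded_bilinear.has_vector_derivative[OF bounded_bilinear_con1 assms(1,2)] assms(3)]
  by (simp add: matrix_vector_mult_add_rdistrib algebra_simps)

text \<open>Collects what the computation has to know about the metric at the moving point:
  \<open>B\<close> is \<open>g(t)\<close>, \<open>Gd\<close> its time derivative at a fixed point of
  the manifold, and \<open>A\<close> the Christoffel symbols. \<open>A_sym\<close> is
  torsion-freeness, and \<open>B_x\<close> and \<open>B_t\<close> are compatibility with the metric,
  to which the change of the metric in time contributes \<open>Gd\<close>.\<close>

locale chart_flow = strip T W for T :: real and W +
  fixes y :: "real \<times> real \<Rightarrow> real^'n::finite"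
    and B Gd :: "real \<times> real \<Rightarrow> real^'n^'n"
    and A :: "real \<times> real \<Rightarrow> real^'n^'n^'n"
  assumes smooth_y: "smooth_on W y" and smooth_B: "smooth_on W B"
    and smooth_Gd: "smooth_on W Gd" and smooth_A: "smooth_on W A"
    and B_sym: "p \<in> W \<Longrightarrow> transpose (B p) = B p"
    and B_pos: "p \<in> W \<Longrightarrow> v \<noteq> 0 \<Longrightarrow> metric_inner (B p) v v > 0"
    and A_sym: "p \<in> W \<Longrightarrow> con (A p) u v = con (A p) v u"
    and B_x: "p \<in> W \<Longrightarrow> metric_inner (px B p) u v =
      metric_inner (B p) (con (A p) (px y p) u) v + metric_inner (B p) u (con (A p) (px y p) v)"
    and B_t: "p \<in> W \<Longrightarrow> metric_inner (pt T B p) u v = metric_inner (Gd p) u v +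
      metric_inner (B p) (con (A p) (pt T y p) u) v + metric_inner (B p) u (con (A p) (pt T y p) v)"
    and immersed: "p \<in> W \<Longrightarrow> px y p \<noteq> 0"
begin

section \<open>Covariant derivatives along a family of curves\<close>

definition ip :: "(real \<times> real \<Rightarrow> real^'n) \<Rightarrow> (real \<times> real \<Rightarrow> real^'n) \<Rightarrow> real \<times> real \<Rightarrow> real" where
  "ip U V p = metric_inner (B p) (U p) (V p)"

definition sp :: "real \<times> real \<Rightarrow> real" where
  "sp p = sqrt (ip (px y) (px y) p)"

definition S :: "real \<times> real \<Rightarrow> real^'n" where
  "S p = px y p /\<^sub>R sp p"

definition Dx :: "(real \<times> real \<Rightarrow> real^'n) \<Rightarrow> real \<times> real \<Rightarrow> real^'n" where
  "Dx V p = px V p + con (A p) (px y p) (V p)"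

definition Dt :: "(real \<times> real \<Rightarrow> real^'n) \<Rightarrow> real \<times> real \<Rightarrow> real^'n" where
  "Dt V p = pt T V p + con (A p) (pt T y p) (V p)"

definition ns :: "(real \<times> real \<Rightarrow> real^'n) \<Rightarrow> real \<times> real \<Rightarrow> real^'n" where
  "ns V p = Dx V p /\<^sub>R sp p"

definition H :: "real \<times> real \<Rightarrow> real^'n" where
  "H = ns S"

text \<open>\<open>pt T A\<close> is taken at the moving point, so it contains the spatial
  derivative of the Christoffel symbols in the direction of motion as well as their explicit time
  derivative. With \<open>Y = pt T y\<close> and \<open>X = px y\<close> the sum is therefore
  \<open>R(Y, X) v\<close> plus the variation of the connection applied to \<open>X\<close> and
  \<open>v\<close>.\<close>

definition curvature_term :: "real \<times> real \<Rightarrow> real^'n \<Rightarrow> real^'n" where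
  "curvature_term p v = con (pt T A p) (px y p) v - con (px A p) (pt T y p) v
     + con (A p) (pt T y p) (con (A p) (px y p) v) - con (A p) (px y p) (con (A p) (pt T y p) v)"

lemma sp_pos: "p \<in> W \<Longrightarrow> sp p > 0"
  unfolding sp_def ip_def using B_pos immersed by simp

lemma smooth_ip: "smooth_on W U \<Longrightarrow> smooth_on W V \<Longrightarrow> smooth_on W (ip U V)"
  unfolding ip_def[abs_def] by (intro smooth_on_metric_inner smooth_B)

lemma smooth_sp: "smooth_on W sp"
  unfolding sp_def[abs_def]
  by (intro smooth_on_sqrt smooth_ip smooth_on_px smooth_y) (auto simp: ip_def B_pos immersed)

lemma smooth_inverse_sp: "smooth_on W (\<lambda>p. inverse (sp p))"
  using sp_pos by (intro smooth_on_inverse smooth_sp) force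

lemma smooth_S: "smooth_on W S"
  unfolding S_def[abs_def] by (intro smooth_on_scaleR smooth_inverse_sp smooth_on_px smooth_y)

lemma smooth_Dx: "smooth_on W V \<Longrightarrow> smooth_on W (Dx V)"
  unfolding Dx_def[abs_def] by (intro smooth_on_add smooth_on_con smooth_on_px smooth_A smooth_y)

lemma smooth_ns: "smooth_on W V \<Longrightarrow> smooth_on W (ns V)"
  unfolding ns_def[abs_def] by (intro smooth_on_scaleR smooth_inverse_sp smooth_Dx)

lemma smooth_H: "smooth_on W H"
  unfolding H_def by (intro smooth_ns smooth_S)

lemma ip_commute: "p \<in> W \<Longrightarrow> ip U V p = ip V U p"
  unfolding ip_def using metric_inner_sym B_sym by blast

lemma px_ip:
  assumes "smooth_on W U" "smooth_on W V" "p \<in> W"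
  shows "px (ip U V) p = ip (Dx U) V p + ip U (Dx V) p"
proof -
  have "px (ip U V) p = metric_inner (px B p) (U p) (V p)
      + metric_inner (B p) (px U p) (V p) + metric_inner (B p) (U p) (px V p)"
    unfolding ip_def[abs_def]
    using has_vector_derivative_metric_inner[OF has_px has_px has_px, OF smooth_B assms(3) assms(1,3) assms(2,3)]
    by (intro px_eqI) simp
  then show ?thesis
    unfolding B_x[OF assms(3)] ip_def Dx_def by (simp add: metric_inner_linear)
qed

lemma pt_ip:
  assumes "smooth_on W U" "smooth_on W V" "p \<in> W"
  shows "pt T (ip U V) p = metric_inner (Gd p) (U p) (V p) + ip (Dt U) V p + ip U (Dt V) p"
proof -
  have "pt T (ip U V) p = metric_inner (pt T B p) (U p) (V p)
      + metric_inner (B p) (pt T U p) (V p) + metric_inner (B p) (U p) (pt T V p)"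
    unfolding ip_def[abs_def]
    using has_vector_derivative_metric_inner[OF has_pt has_pt has_pt, OF smooth_B assms(3) assms(1,3) assms(2,3)]
    by (intro pt_eqI assms) simp
  then show ?thesis
    unfolding B_t[OF assms(3)] ip_def Dt_def by (simp add: metric_inner_linear)
qed

lemma Dx_scaleR:
  assumes "smooth_on W f" "smooth_on W V" "p \<in> W"
  shows "Dx (\<lambda>q. f q *\<^sub>R V q) p = px f p *\<^sub>R V p + f p *\<^sub>R Dx V p"
proof -
  have "px (\<lambda>q. f q *\<^sub>R V q) p = f p *\<^sub>R px V p + px f p *\<^sub>R V p"
    using bounded_bilinear.has_vector_derivative[OF bounded_bilinear_scaleR has_px has_px, OF assms(1,3) assms(2,3)]
    by (intro px_eqI) simp
  then show ?thesis unfolding Dx_def by (simp add: con_linear algebra_simps)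
qed

lemma Dt_scaleR:
  assumes "smooth_on W f" "smooth_on W V" "p \<in> W"
  shows "Dt (\<lambda>q. f q *\<^sub>R V q) p = pt T f p *\<^sub>R V p + f p *\<^sub>R Dt V p"
proof -
  have "pt T (\<lambda>q. f q *\<^sub>R V q) p = f p *\<^sub>R pt T V p + pt T f p *\<^sub>R V p"
    using bounded_bilinear.has_vector_derivative[OF bounded_bilinear_scaleR has_pt has_pt, OF assms(1,3) assms(2,3)]
    by (intro pt_eqI assms) simp
  then show ?thesis unfolding Dt_def by (simp add: con_linear algebra_simps)
qed

lemma Dx_add:
  assumes "smooth_on W U" "smooth_on W V" "p \<in> W"
  shows "Dx (\<lambda>q. U q + V q) p = Dx U p + Dx V p"
proof -
  have "px (\<lambda>q. U q + V q) p = px U p + px V p"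
    by (intro px_eqI has_vector_derivative_add has_px assms)
  then show ?thesis unfolding Dx_def by (simp add: con_linear algebra_simps)
qed

lemma Dx_cong: "(\<And>q. q \<in> W \<Longrightarrow> U q = V q) \<Longrightarrow> p \<in> W \<Longrightarrow> Dx U p = Dx V p"
  unfolding Dx_def using px_cong[of U V p] by simp

lemma Dt_cong: "(\<And>q. q \<in> W \<Longrightarrow> U q = V q) \<Longrightarrow> p \<in> W \<Longrightarrow> Dt U p = Dt V p"
  unfolding Dt_def using pt_cong[of U V p] by simp

text \<open>The second derivatives of \<open>V\<close> and of \<open>y\<close> cancel because mixed
  partials commute, and the first derivatives of \<open>V\<close> occur equally on both sides. What
  is left is algebraic in \<open>V p\<close>.\<close>

lemma Dt_Dx:
  assumes V: "smooth_on W V" and p: "p \<in> W"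
  shows "Dt (Dx V) p = Dx (Dt V) p + curvature_term p (V p)"
proof -
  have 1: "pt T (Dx V) p = pt T (px V) p + (con (pt T A p) (px y p) (V p)
      + con (A p) (pt T (px y) p) (V p) + con (A p) (px y p) (pt T V p))"
    unfolding Dx_def[abs_def]
    using has_vector_derivative_add[OF has_pt[OF smooth_on_px[OF V] p]
        has_vector_derivative_con[OF has_pt[OF smooth_A p] has_pt[OF smooth_on_px[OF smooth_y] p] has_pt[OF V p]]]
    by (intro pt_eqI p) simp
  have 2: "px (Dt V) p = px (pt T V) p + (con (px A p) (pt T y p) (V p)
      + con (A p) (px (pt T y) p) (V p) + con (A p) (pt T y p) (px V p))"
    unfolding Dt_def[abs_def]
    using has_vector_derivative_add[OF has_px[OF smooth_on_pt[OF V] p]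
        has_vector_derivative_con[OF has_px[OF smooth_A p] has_px[OF smooth_on_pt[OF smooth_y] p] has_px[OF V p]]]
    by (intro px_eqI) simp
  show ?thesis
    unfolding Dt_def[of "Dx V"] Dx_def[of "Dt V"] 1 2 pt_px_commute[OF smooth_y p] pt_px_commute[OF V p]
    unfolding Dx_def Dt_def curvature_term_def by (simp add: con_linear algebra_simps)
qed

section \<open>The unit tangent and the curvature vector\<close>

lemma Dx_eq_ns: "p \<in> W \<Longrightarrow> Dx V p = sp p *\<^sub>R ns V p"
  unfolding ns_def using sp_pos[of p] by simp

lemma px_y_eq: "p \<in> W \<Longrightarrow> px y p = sp p *\<^sub>R S p"
  unfolding S_def using sp_pos[of p] by simp

lemma ip_S_S:
  assumes p: "p \<in> W"
  shows "ip S S p = 1"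
proof -
  have "ip (px y) (px y) p = (sp p)\<^sup>2"
    using B_pos[OF p immersed[OF p]] by (simp add: sp_def ip_def)
  then show ?thesis
    using sp_pos[OF p] by (simp add: ip_def S_def metric_inner_linear power2_eq_square field_simps)
qed

lemma px_const_eq_0: "(\<And>q. q \<in> W \<Longrightarrow> f q = c) \<Longrightarrow> p \<in> W \<Longrightarrow> px f p = 0"
  using px_cong[of f "\<lambda>_. c" p] px_eqI[of "\<lambda>_. c" p 0] by auto

lemma pt_const_eq_0: "(\<And>q. q \<in> W \<Longrightarrow> f q = c) \<Longrightarrow> p \<in> W \<Longrightarrow> pt T f p = 0"
  using pt_cong[of f "\<lambda>_. c" p] pt_eqI[of p "\<lambda>_. c" 0] by auto

lemma ip_H_S:
  assumes p: "p \<in> W"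
  shows "ip H S p = 0"
proof -
  have "ip (Dx S) S p + ip S (Dx S) p = 0"
    using px_const_eq_0[of "ip S S" 1 p] ip_S_S p px_ip[OF smooth_S smooth_S p] by simp
  then have "ip (Dx S) S p = 0" using ip_commute[OF p, of S] by simp
  then show ?thesis by (simp add: H_def ns_def ip_def metric_inner_linear)
qed

text \<open>Obtained by differentiating \<open>ip H S = 0\<close> along the curve. This tangential
  component is the difference between \<open>ns H\<close> and its normal part.\<close>

lemma ip_ns_H_S:
  assumes p: "p \<in> W"
  shows "ip (ns H) S p = - ip H H p"
proof -
  have "ip (Dx H) S p + ip H (Dx S) p = 0"
    using px_const_eq_0[of "ip H S" 0 p] ip_H_S p px_ip[OF smooth_H smooth_S p] by simp
  moreover have "ip (Dx H) S p = sp p * ip (ns H) S p" "ip H (Dx S) p = sp p * ip H H p"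
    unfolding ip_def Dx_eq_ns[OF p] H_def by (simp_all add: metric_inner_linear)
  ultimately have "sp p * (ip (ns H) S p + ip H H p) = 0"
    by (simp add: algebra_simps)
  then show ?thesis using sp_pos[OF p] by simp
qed

lemma arclength_px_ip_H:
  assumes p: "p \<in> W"
  shows "px (ip H H) p / sp p = 2 * ip (ns H) H p"
  using px_ip[OF smooth_H smooth_H p] ip_commute[OF p, of H] sp_pos[OF p]
  by (simp add: ip_def Dx_eq_ns[OF p] metric_inner_linear)

text \<open>The first arclength derivative is again an inner product of fields,
  \<open>2 * ip (ns H) H\<close>, on all of \<open>W\<close>. So the metric product rule applies a
  second time, and no derivative of \<open>sp\<close> appears.\<close>

lemma arclength_px2_ip_H:
  assumes p: "p \<in> W"
  shows "px (\<lambda>q. px (ip H H) q / sp q) p / sp p = 2 * ip (ns (ns H)) H p + 2 * ip (ns H) (ns H) p"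
proof -
  have "px (\<lambda>q. px (ip H H) q / sp q) p = px (\<lambda>q. ip (\<lambda>q. 2 *\<^sub>R ns H q) H q) p"
    by (rule px_cong[OF _ p]) (simp add: arclength_px_ip_H ip_def metric_inner_linear)
  also have "\<dots> = ip (Dx (\<lambda>q. 2 *\<^sub>R ns H q)) H p + ip (\<lambda>q. 2 *\<^sub>R ns H q) (Dx H) p"
    by (intro px_ip smooth_on_scaleR smooth_on_const smooth_ns smooth_H p)
  also have "Dx (\<lambda>q. 2 *\<^sub>R ns H q) p = 2 *\<^sub>R Dx (ns H) p"
    using Dx_add[OF smooth_ns smooth_ns, OF smooth_H smooth_H p] by (simp add: scaleR_2)
  then have "ip (Dx (\<lambda>q. 2 *\<^sub>R ns H q)) H p = 2 * ip (Dx (ns H)) H p"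
    by (simp add: ip_def metric_inner_linear)
  also have "ip (Dx (ns H)) H p = sp p * ip (ns (ns H)) H p"
    by (simp add: ip_def Dx_eq_ns[OF p] metric_inner_linear)
  also have "ip (\<lambda>q. 2 *\<^sub>R ns H q) (Dx H) p = sp p * (2 * ip (ns H) (ns H) p)"
    by (simp add: ip_def Dx_eq_ns[OF p] metric_inner_linear)
  finally show ?thesis
    using sp_pos[OF p] by (simp add: add_divide_distrib)
qed

end

locale chart_shrinking = chart_flow T W y B Gd A for T W y B Gd A +
  assumes flow: "p \<in> W \<Longrightarrow> pt T y p = H p"
begin

text \<open>Mixed partials of \<open>y\<close> commute, and torsion-freeness exchanges the two
  arguments of the Christoffel term.\<close>

lemma Dt_px_y:
  assumes p: "p \<in> W"
  shows "Dt (px y) p = Dx H p"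
proof -
  have "pt T (px y) p = px H p"
    using pt_px_commute[OF smooth_y p] px_cong[OF flow p] by simp
  then show ?thesis
    unfolding Dt_def Dx_def flow[OF p] using A_sym[OF p] by simp
qed

text \<open>The \<open>a\<close> of the overview; by \<open>pt_sp\<close> it is minus the
  logarithmic time derivative of the speed.\<close>

definition stretch :: "real \<times> real \<Rightarrow> real" where
  "stretch p = ip H H p - metric_inner (Gd p) (S p) (S p) / 2"

lemma smooth_stretch: "smooth_on W stretch"
  unfolding stretch_def[abs_def]
  by (intro smooth_on_diff smooth_ip smooth_H smooth_on_divide smooth_on_metric_inner smooth_Gd smooth_S smooth_on_const) simp

lemma Dt_sp_S:
  assumes p: "p \<in> W"
  shows "sp p *\<^sub>R ns H p = pt T sp p *\<^sub>R S p + sp p *\<^sub>R Dt S p"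
  using Dt_cong[OF px_y_eq p] Dt_scaleR[OF smooth_sp smooth_S p] Dt_px_y[OF p] Dx_eq_ns[OF p] by simp

text \<open>Pairing \<open>Dt_sp_S\<close> with \<open>S\<close> isolates the derivative of the
  speed. The left side yields \<open>- ip H H\<close> times the speed, and
  \<open>ip (Dt S) S\<close> equals \<open>- Gd(S, S) / 2\<close> because \<open>S\<close> keeps
  unit length for a changing metric.\<close>

lemma pt_sp:
  assumes p: "p \<in> W"
  shows "pt T sp p = - stretch p * sp p"
proof -
  have "metric_inner (B p) (sp p *\<^sub>R ns H p) (S p) = metric_inner (B p) (pt T sp p *\<^sub>R S p + sp p *\<^sub>R Dt S p) (S p)"
    by (simp only: Dt_sp_S[OF p])
  then have "sp p * ip (ns H) S p = pt T sp p * ip S S p + sp p * ip (Dt S) S p"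
    by (simp add: ip_def metric_inner_linear)
  moreover have "ip (Dt S) S p = - metric_inner (Gd p) (S p) (S p) / 2"
    using pt_const_eq_0[of "ip S S" 1 p] ip_S_S p pt_ip[OF smooth_S smooth_S p] ip_commute[OF p, of S "Dt S"] by simp
  ultimately show ?thesis
    unfolding ip_S_S[OF p] ip_ns_H_S[OF p] stretch_def by (simp add: algebra_simps)
qed

lemma Dt_S:
  assumes p: "p \<in> W"
  shows "Dt S p = ns H p + stretch p *\<^sub>R S p"
proof -
  have "sp p *\<^sub>R Dt S p = sp p *\<^sub>R (ns H p + stretch p *\<^sub>R S p)"
    using Dt_sp_S[OF p] unfolding pt_sp[OF p] by (simp add: algebra_simps)
  then show ?thesis using sp_pos[OF p] by simp
qed

text \<open>The relation \<open>sp H = Dx S\<close> is differentiated in time before dividing by the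
  speed. One of the two equal multiples of \<open>H p\<close> stems from the time derivative of
  \<open>sp\<close>, the other from \<open>Dx\<close> of \<open>stretch\<close> times
  \<open>S\<close>, as \<open>Dx S = sp H\<close>.\<close>

lemma Dt_H:
  assumes p: "p \<in> W"
  shows "sp p *\<^sub>R Dt H p = sp p *\<^sub>R ns (ns H) p + px stretch p *\<^sub>R S p + (stretch p * sp p) *\<^sub>R H p + (stretch p * sp p) *\<^sub>R H p
    + curvature_term p (S p)"
proof -
  have "Dt (Dx S) p = Dt (\<lambda>q. sp q *\<^sub>R H q) p"
    by (rule Dt_cong[OF _ p]) (simp add: Dx_eq_ns H_def)
  also have "\<dots> = pt T sp p *\<^sub>R H p + sp p *\<^sub>R Dt H p"
    by (rule Dt_scaleR[OF smooth_sp smooth_H p])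
  finally have 1: "Dt (Dx S) p = pt T sp p *\<^sub>R H p + sp p *\<^sub>R Dt H p" .
  have "Dx (Dt S) p = Dx (\<lambda>q. ns H q + stretch q *\<^sub>R S q) p"
    by (rule Dx_cong[OF Dt_S p])
  also have "\<dots> = Dx (ns H) p + Dx (\<lambda>q. stretch q *\<^sub>R S q) p"
    by (intro Dx_add smooth_ns smooth_H smooth_on_scaleR smooth_stretch smooth_S p)
  also have "\<dots> = Dx (ns H) p + (px stretch p *\<^sub>R S p + stretch p *\<^sub>R Dx S p)"
    by (simp only: Dx_scaleR[OF smooth_stretch smooth_S p])
  finally have 2: "Dx (Dt S) p = Dx (ns H) p + (px stretch p *\<^sub>R S p + stretch p *\<^sub>R Dx S p)" .
  show ?thesis
    using Dt_Dx[OF smooth_S p] unfolding 1 2 pt_sp[OF p] Dx_eq_ns[OF p, of S] Dx_eq_ns[OF p, of "ns H"] H_def[symmetric]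
    by (simp add: algebra_simps)
qed

text \<open>Pairing \<open>Dt_H\<close> with \<open>H\<close> removes the derivative of
  \<open>stretch\<close>, which is multiplied by \<open>S\<close>. The factor 4 arises since
  \<open>ip (Dt H) H\<close> contains \<open>2 * stretch * ip H H\<close> and is counted twice in
  the derivative of a square.\<close>

theorem pt_curvature:
  assumes p: "p \<in> W"
  shows "pt T (ip H H) p = px (\<lambda>q. px (ip H H) q / sp q) p / sp p - 2 * ip (ns H) (ns H) p
    + 4 * (ip H H p)\<^sup>2 - 2 * metric_inner (Gd p) (S p) (S p) * ip H H p + metric_inner (Gd p) (H p) (H p)
    + 2 * metric_inner (B p) (curvature_term p (S p) /\<^sub>R sp p) (H p)"
proof -
  have S0: "metric_inner (B p) (S p) (H p) = 0"
    using ip_H_S[OF p] ip_commute[OF p, of S H] by (simp add: ip_def)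
  have "metric_inner (B p) (sp p *\<^sub>R Dt H p) (H p) = metric_inner (B p) (sp p *\<^sub>R ns (ns H) p + px stretch p *\<^sub>R S p
      + (stretch p * sp p) *\<^sub>R H p + (stretch p * sp p) *\<^sub>R H p + curvature_term p (S p)) (H p)"
    by (simp only: Dt_H[OF p])
  then have "sp p * ip (Dt H) H p = sp p * ip (ns (ns H)) H p + 2 * stretch p * sp p * ip H H p
      + metric_inner (B p) (curvature_term p (S p)) (H p)"
    unfolding ip_def metric_inner_linear S0 by (simp add: algebra_simps)
  then have "ip (Dt H) H p = ip (ns (ns H)) H p + 2 * stretch p * ip H H p
      + metric_inner (B p) (curvature_term p (S p) /\<^sub>R sp p) (H p)"
    using sp_pos[OF p] by (simp add: metric_inner_linear field_simps)
  then show ?thesis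
    unfolding arclength_px2_ip_H[OF p] pt_ip[OF smooth_H smooth_H p] ip_commute[OF p, of H "Dt H"] stretch_def
    by (simp add: algebra_simps power2_eq_square)
qed

end


section \<open>Christoffel symbols of a family of metrics\<close>

text \<open>A coordinate derivative at fixed time, two-sided since it is used over open coordinate
  domains; there it agrees with \<open>partial_deriv\<close>
  (\<open>partial_deriv_eq_pz\<close>).\<close>

definition pz :: "'n::finite \<Rightarrow> ((real^'n) \<times> real \<Rightarrow> 'b::real_normed_vector) \<Rightarrow> (real^'n) \<times> real \<Rightarrow> 'b" where
  "pz i f p = vector_derivative (\<lambda>h. f (fst p + h *\<^sub>R axis i 1, snd p)) (at 0)"

lemma vec_eq_sum_axis: "(w :: real^'n::finite) = (\<Sum>i\<in>UNIV. w $ i *\<^sub>R axis i 1)"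
  by (simp add: vec_eq_iff axis_def if_distrib[of "\<lambda>z. _ * z"] cong: if_cong)

locale cylinder =
  fixes T :: real and V :: "(real^'n::finite) set"
  assumes T_pos: "0 < T" and V_open: "open V"
begin

lemma has_vector_derivative_z:
  assumes "(f has_derivative f') (at p within V \<times> {0..T})" "p \<in> V \<times> {0..T}"
  shows "((\<lambda>h. f (fst p + h *\<^sub>R w, snd p)) has_vector_derivative f' (w, 0)) (at 0)"
proof -
  define U where "U = (\<lambda>h. fst p + h *\<^sub>R w) -` V"
  have U: "open U" "0 \<in> U"
    unfolding U_def using assms(2) by (auto intro!: open_vimage V_open continuous_intros)
  have 1: "((\<lambda>h. (fst p + h *\<^sub>R w, snd p)) has_vector_derivative (w, 0)) (at 0 within U)"
    unfolding has_vector_derivative_def by (auto intro!: derivative_eq_intros)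
  have 2: "(f has_derivative f') (at (fst p + 0 *\<^sub>R w, snd p) within (\<lambda>h. (fst p + h *\<^sub>R w, snd p)) ` U)"
    using assms by (auto simp: U_def intro: has_derivative_subset)
  show ?thesis
    using vector_derivative_diff_chain_within[OF 1 2] at_within_open[OF U(2,1)] by (simp add: o_def)
qed

lemma has_vector_derivative_time:
  assumes "(f has_derivative f') (at p within V \<times> {0..T})" "p \<in> V \<times> {0..T}"
  shows "((\<lambda>s. f (fst p, s)) has_vector_derivative f' (0, 1)) (at (snd p) within {0..T})"
proof -
  have 1: "((\<lambda>s. (fst p, s)) has_vector_derivative (0, 1)) (at (snd p) within {0..T})"
    unfolding has_vector_derivative_def by (auto intro!: derivative_eq_intros)
  have 2: "(f has_derivative f') (at (fst p, snd p) within (\<lambda>s. (fst p, s)) ` {0..T})"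
    unfolding prod.collapse by (rule has_derivative_subset[OF assms(1)]) (use assms(2) in auto)
  show ?thesis
    using vector_derivative_diff_chain_within[OF 1 2] by (simp add: o_def)
qed

lemma pz_eqI:
  "((\<lambda>h. f (fst p + h *\<^sub>R axis i 1, snd p)) has_vector_derivative D) (at 0) \<Longrightarrow> pz i f p = D"
  unfolding pz_def by (rule vector_derivative_at)

lemma pt_eqI:
  "p \<in> V \<times> {0..T} \<Longrightarrow> ((\<lambda>s. f (fst p, s)) has_vector_derivative D) (at (snd p) within {0..T}) \<Longrightarrow> pt T f p = D"
  unfolding pt_def
  using vector_derivative_within_cbox[of 0 T "snd p" "\<lambda>s. f (fst p, s)" D] T_pos by auto

lemma has_pz:
  assumes "smooth_on (V \<times> {0..T}) f" "p \<in> V \<times> {0..T}"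
  shows "((\<lambda>h. f (fst p + h *\<^sub>R axis i 1, snd p)) has_vector_derivative pz i f p) (at 0)"
proof -
  obtain f' where "(f has_derivative f') (at p within V \<times> {0..T})"
    using smooth_on_obtains_derivative[OF assms(1)] assms(2) by metis
  note d = has_vector_derivative_z[OF this assms(2), of "axis i 1"]
  show ?thesis
    unfolding pz_eqI[of f p, OF d] by (rule d)
qed

lemma has_pt:
  assumes "smooth_on (V \<times> {0..T}) f" "p \<in> V \<times> {0..T}"
  shows "((\<lambda>s. f (fst p, s)) has_vector_derivative pt T f p) (at (snd p) within {0..T})"
proof -
  obtain f' where "(f has_derivative f') (at p within V \<times> {0..T})"
    using smooth_on_obtains_derivative[OF assms(1)] assms(2) by metis
  note d = has_vector_derivative_time[OF this assms(2)]
  show ?thesis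
    unfolding pt_eqI[OF assms(2) d] by (rule d)
qed

lemma smooth_pz:
  assumes "smooth_on (V \<times> {0..T}) f"
  shows "smooth_on (V \<times> {0..T}) (pz i f)"
  unfolding smooth_on_def
proof
  fix k
  obtain f' where f': "\<And>p. p \<in> V \<times> {0..T} \<Longrightarrow> (f has_derivative f' p) (at p within V \<times> {0..T})"
    "\<And>v. Ck_on k (V \<times> {0..T}) (\<lambda>p. f' p v)"
    using assms unfolding smooth_on_def by (metis Ck_on.simps(2))
  have "Ck_on k (V \<times> {0..T}) (pz i f) \<longleftrightarrow> Ck_on k (V \<times> {0..T}) (\<lambda>p. f' p (axis i 1, 0))"
    by (rule Ck_on_cong) (use f' has_vector_derivative_z pz_eqI in metis)
  then show "Ck_on k (V \<times> {0..T}) (pz i f)" using f' by blast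
qed

lemma smooth_pt:
  assumes "smooth_on (V \<times> {0..T}) f"
  shows "smooth_on (V \<times> {0..T}) (pt T f)"
  unfolding smooth_on_def
proof
  fix k
  obtain f' where f': "\<And>p. p \<in> V \<times> {0..T} \<Longrightarrow> (f has_derivative f' p) (at p within V \<times> {0..T})"
    "\<And>v. Ck_on k (V \<times> {0..T}) (\<lambda>p. f' p v)"
    using assms unfolding smooth_on_def by (metis Ck_on.simps(2))
  have "Ck_on k (V \<times> {0..T}) (pt T f) \<longleftrightarrow> Ck_on k (V \<times> {0..T}) (\<lambda>p. f' p (0, 1))"
    by (rule Ck_on_cong) (use f' has_vector_derivative_time pt_eqI in metis)
  then show "Ck_on k (V \<times> {0..T}) (pt T f)" using f' by blast
qed

definition Dz :: "((real^'n) \<times> real \<Rightarrow> 'b::real_normed_vector) \<Rightarrow> (real^'n) \<times> real \<Rightarrow> real^'n \<Rightarrow> 'b" where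
  "Dz f p w = (\<Sum>i\<in>UNIV. w $ i *\<^sub>R pz i f p)"

text \<open>Evaluating the total derivative on the coordinate directions identifies it with the
  partial ones. In this form the chain rule along a moving curve separates the motion from the
  explicit dependence on time.\<close>

lemma has_derivative_Dz_pt:
  assumes f: "smooth_on (V \<times> {0..T}) f" and p: "p \<in> V \<times> {0..T}"
  shows "(f has_derivative (\<lambda>w. Dz f p (fst w) + snd w *\<^sub>R pt T f p)) (at p within V \<times> {0..T})"
proof -
  obtain f' where f': "(f has_derivative f') (at p within V \<times> {0..T})"
    using smooth_on_obtains_derivative[OF f] p by metis
  have lin: "linear f'" using f' has_derivative_linear by blast
  have "f' w = Dz f p (fst w) + snd w *\<^sub>R pt T f p" for w
  proof -
    have "w = (\<Sum>i\<in>UNIV. fst w $ i *\<^sub>R (axis i 1, 0)) + snd w *\<^sub>R (0, 1)"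
      using vec_eq_sum_axis[of "fst w"] by (auto simp: prod_eq_iff fst_sum snd_sum)
    then have "f' w = f' ((\<Sum>i\<in>UNIV. fst w $ i *\<^sub>R (axis i 1, 0)) + snd w *\<^sub>R (0, 1))"
      by simp
    also have "\<dots> = (\<Sum>i\<in>UNIV. fst w $ i *\<^sub>R f' (axis i 1, 0)) + snd w *\<^sub>R f' (0, 1)"
      unfolding linear_add[OF lin] linear_sum[OF lin] linear_cmul[OF lin] ..
    also have "f' (0, 1) = pt T f p"
      using pt_eqI[OF p has_vector_derivative_time[OF f' p]] by simp
    also have "(\<Sum>i\<in>UNIV. fst w $ i *\<^sub>R f' (axis i 1, 0)) = Dz f p (fst w)"
      using pz_eqI[OF has_vector_derivative_z[OF f' p]] by (simp add: Dz_def)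
    finally show ?thesis .
  qed
  then have "f' = (\<lambda>w. Dz f p (fst w) + snd w *\<^sub>R pt T f p)" by blast
  with f' show ?thesis by simp
qed

lemma Dz_linear:
  shows "Dz f p (u + v) = Dz f p u + Dz f p v"
    and "Dz f p (c *\<^sub>R u) = c *\<^sub>R Dz f p u"
  by (simp_all add: Dz_def sum.distrib scaleR_add_left scaleR_sum_right)

lemma pz_nth_nth:
  fixes f :: "(real^'n) \<times> real \<Rightarrow> real^'b::finite^'c::finite"
  assumes "smooth_on (V \<times> {0..T}) f" "p \<in> V \<times> {0..T}"
  shows "pz i (\<lambda>p. f p $ a $ b) p = pz i f p $ a $ b"
  using bounded_linear.has_vector_derivative[OF bounded_linear_vec_nth[of b]
      bounded_linear.has_vector_derivative[OF bounded_linear_vec_nth[of a] has_pz[OF assms]]]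
  by (intro pz_eqI) simp

lemma partial_deriv_eq_pz:
  assumes "z \<in> V"
  shows "partial_deriv V (\<lambda>z. f (z, t)) i z = pz i f (z, t)"
proof -
  have c: "continuous_on UNIV (\<lambda>h. z + h *\<^sub>R axis i 1)"
    by (intro continuous_intros)
  have U: "open {h. z + h *\<^sub>R axis i 1 \<in> V}"
    using open_vimage[OF V_open c] by (simp add: vimage_def)
  show ?thesis
    unfolding partial_deriv_def pz_def using at_within_open[OF _ U, of 0] assms by simp
qed

end

section \<open>Smooth families of metrics on a coordinate domain\<close>

locale metric_family = cylinder T V for T and V :: "(real^'n::finite) set" +
  fixes G :: "(real^'n) \<times> real \<Rightarrow> real^'n^'n"
  assumes smooth_G: "smooth_on (V \<times> {0..T}) G"
    and G_sym: "p \<in> V \<times> {0..T} \<Longrightarrow> transpose (G p) = G p"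
    and G_pos: "p \<in> V \<times> {0..T} \<Longrightarrow> v \<noteq> 0 \<Longrightarrow> metric_inner (G p) v v > 0"
begin

definition Gam :: "(real^'n) \<times> real \<Rightarrow> real^'n^'n^'n" where
  "Gam p = (\<chi> l i j. christoffel V (\<lambda>z. G (z, snd p)) (fst p) l i j)"

lemma G_invertible:
  assumes "p \<in> V \<times> {0..T}"
  shows "invertible (G p)"
proof -
  have "v = 0" if "G p *v v = 0" for v
    using G_pos[OF assms, of v] that by (auto simp: metric_inner_eq_inner)
  then have "\<exists>C. C ** G p = mat 1"
    using matrix_left_invertible_ker[of "G p"] by blast
  then show ?thesis
    using invertible_left_inverse by blast
qed

lemma G_nth_sym: "p \<in> V \<times> {0..T} \<Longrightarrow> G p $ i $ j = G p $ j $ i"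
  using arg_cong[OF G_sym, of p "\<lambda>C. C $ i $ j"] by (simp add: transpose_def)

lemma Gam_nth:
  assumes "p \<in> V \<times> {0..T}"
  shows "Gam p $ l $ i $ j = (\<Sum>m\<in>UNIV. matrix_inv (G p) $ l $ m *
    (pz i G p $ j $ m + pz j G p $ i $ m - pz m G p $ i $ j)) / 2"
proof -
  have "partial_deriv V (\<lambda>z. G (z, snd p) $ a $ b) c (fst p) = pz c G p $ a $ b" for a b c
    using partial_deriv_eq_pz[of "fst p" "\<lambda>p. G p $ a $ b" "snd p" c] pz_nth_nth[OF smooth_G assms] assms by auto
  then show ?thesis
    unfolding Gam_def christoffel_def by simp
qed

lemma smooth_Gam: "smooth_on (V \<times> {0..T}) Gam"
proof -
  have "smooth_on (V \<times> {0..T}) (\<lambda>p. \<chi> l i j. (\<Sum>m\<in>UNIV. matrix_inv (G p) $ l $ m *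
    (pz i G p $ j $ m + pz j G p $ i $ m - pz m G p $ i $ j)) / 2)"
    by (intro smooth_on_vec_lambda smooth_on_divide smooth_on_sum smooth_on_mult smooth_on_matrix_inv
        smooth_on_add smooth_on_diff smooth_on_vec_nth smooth_pz smooth_G smooth_on_const G_invertible) auto
  moreover have "Gam p = (\<chi> l i j. (\<Sum>m\<in>UNIV. matrix_inv (G p) $ l $ m *
    (pz i G p $ j $ m + pz j G p $ i $ m - pz m G p $ i $ j)) / 2)" if "p \<in> V \<times> {0..T}" for p
    using Gam_nth[OF that] by (simp add: vec_eq_iff)
  ultimately show ?thesis
    by (subst smooth_on_cong) auto
qed

lemma con_Gam_sym:
  assumes "p \<in> V \<times> {0..T}"
  shows "con (Gam p) u v = con (Gam p) v u"
proof -
  have "Gam p $ l $ i $ j = Gam p $ l $ j $ i" for l i j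
    unfolding Gam_def using assms
    by (simp, intro christoffel_torsion_free_metric) (auto intro: G_nth_sym G_invertible)
  then have "(\<Sum>i\<in>UNIV. \<Sum>j\<in>UNIV. Gam p $ l $ i $ j * u $ i * v $ j)
      = (\<Sum>j\<in>UNIV. \<Sum>i\<in>UNIV. Gam p $ l $ j $ i * v $ j * u $ i)" for l
    by (subst sum.swap) (simp add: mult_ac)
  then show ?thesis
    by (simp add: con_def)
qed

lemma pz_G:
  assumes p: "p \<in> V \<times> {0..T}"
  shows "pz k G p $ i $ j = (\<Sum>l\<in>UNIV. Gam p $ l $ k $ i * G p $ l $ j) + (\<Sum>l\<in>UNIV. Gam p $ l $ k $ j * G p $ i $ l)"
proof -
  obtain z t where zt: "p = (z, t)" by (cases p)
  have z: "z \<in> V" using p zt by auto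
  have "partial_deriv V (\<lambda>z. G (z, t) $ i $ j) k z =
           (\<Sum>l\<in>UNIV. christoffel V (\<lambda>z. G (z, t)) z l k i * G (z, t) $ l $ j)
           + (\<Sum>l\<in>UNIV. christoffel V (\<lambda>z. G (z, t)) z l k j * G (z, t) $ i $ l)"
    using p zt by (intro christoffel_torsion_free_metric(2)) (auto intro: G_nth_sym G_invertible)
  then show ?thesis
    using partial_deriv_eq_pz[OF z, of "\<lambda>p. G p $ i $ j"] pz_nth_nth[OF smooth_G p] zt
    by (simp add: Gam_def)
qed

text \<open>Contracting \<open>pz_G\<close> with \<open>w\<close>, \<open>u\<close> and
  \<open>v\<close> produces both terms; the rest is a reordering of summation indices.\<close>

lemma metric_inner_Dz_G:
  assumes p: "p \<in> V \<times> {0..T}"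
  shows "metric_inner (Dz G p w) u v =
    metric_inner (G p) (con (Gam p) w u) v + metric_inner (G p) u (con (Gam p) w v)"
proof -
  have a: "metric_inner (Dz G p w) u v = (\<Sum>i\<in>UNIV. \<Sum>j\<in>UNIV. \<Sum>k\<in>UNIV. \<Sum>l\<in>UNIV.
      Gam p $ l $ k $ i * G p $ l $ j * w $ k * u $ i * v $ j) +
      (\<Sum>i\<in>UNIV. \<Sum>j\<in>UNIV. \<Sum>k\<in>UNIV. \<Sum>l\<in>UNIV. Gam p $ l $ k $ j * G p $ i $ l * w $ k * u $ i * v $ j)"
    unfolding metric_inner_def Dz_def
    by (simp add: pz_G[OF p] sum_distrib_left sum_distrib_right sum.distrib algebra_simps)
  have "metric_inner (G p) (con (Gam p) w u) v = (\<Sum>l\<in>UNIV. \<Sum>j\<in>UNIV. \<Sum>k\<in>UNIV. \<Sum>i\<in>UNIV.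
      Gam p $ l $ k $ i * G p $ l $ j * w $ k * u $ i * v $ j)"
    unfolding metric_inner_def con_def by (simp add: sum_distrib_left sum_distrib_right mult_ac)
  \<comment> \<open>Neighbouring summations are exchanged one pair at a time until the order is
    \<open>i\<close>, \<open>j\<close>, \<open>k\<close>, \<open>l\<close>, as in
    \<open>a\<close>.\<close>
  also have "\<dots> = (\<Sum>l\<in>UNIV. \<Sum>j\<in>UNIV. \<Sum>i\<in>UNIV. \<Sum>k\<in>UNIV.
      Gam p $ l $ k $ i * G p $ l $ j * w $ k * u $ i * v $ j)"
    by (intro sum.cong[OF refl] sum.swap)
  also have "\<dots> = (\<Sum>l\<in>UNIV. \<Sum>i\<in>UNIV. \<Sum>j\<in>UNIV. \<Sum>k\<in>UNIV.
      Gam p $ l $ k $ i * G p $ l $ j * w $ k * u $ i * v $ j)"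
    by (rule sum.cong[OF refl], rule sum.swap)
  also have "\<dots> = (\<Sum>i\<in>UNIV. \<Sum>l\<in>UNIV. \<Sum>j\<in>UNIV. \<Sum>k\<in>UNIV.
      Gam p $ l $ k $ i * G p $ l $ j * w $ k * u $ i * v $ j)"
    by (rule sum.swap)
  also have "\<dots> = (\<Sum>i\<in>UNIV. \<Sum>j\<in>UNIV. \<Sum>l\<in>UNIV. \<Sum>k\<in>UNIV.
      Gam p $ l $ k $ i * G p $ l $ j * w $ k * u $ i * v $ j)"
    by (rule sum.cong[OF refl], rule sum.swap)
  also have "\<dots> = (\<Sum>i\<in>UNIV. \<Sum>j\<in>UNIV. \<Sum>k\<in>UNIV. \<Sum>l\<in>UNIV.
      Gam p $ l $ k $ i * G p $ l $ j * w $ k * u $ i * v $ j)"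
    by (intro sum.cong[OF refl] sum.swap)
  finally have b: "metric_inner (G p) (con (Gam p) w u) v = (\<Sum>i\<in>UNIV. \<Sum>j\<in>UNIV. \<Sum>k\<in>UNIV. \<Sum>l\<in>UNIV.
      Gam p $ l $ k $ i * G p $ l $ j * w $ k * u $ i * v $ j)" .
  have "metric_inner (G p) u (con (Gam p) w v) = (\<Sum>i\<in>UNIV. \<Sum>l\<in>UNIV. \<Sum>k\<in>UNIV. \<Sum>j\<in>UNIV.
      Gam p $ l $ k $ j * G p $ i $ l * w $ k * u $ i * v $ j)"
    unfolding metric_inner_def con_def by (simp add: sum_distrib_left sum_distrib_right mult_ac)
  also have "\<dots> = (\<Sum>i\<in>UNIV. \<Sum>l\<in>UNIV. \<Sum>j\<in>UNIV. \<Sum>k\<in>UNIV.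
      Gam p $ l $ k $ j * G p $ i $ l * w $ k * u $ i * v $ j)"
    by (intro sum.cong[OF refl] sum.swap)
  also have "\<dots> = (\<Sum>i\<in>UNIV. \<Sum>j\<in>UNIV. \<Sum>l\<in>UNIV. \<Sum>k\<in>UNIV.
      Gam p $ l $ k $ j * G p $ i $ l * w $ k * u $ i * v $ j)"
    by (rule sum.cong[OF refl], rule sum.swap)
  also have "\<dots> = (\<Sum>i\<in>UNIV. \<Sum>j\<in>UNIV. \<Sum>k\<in>UNIV. \<Sum>l\<in>UNIV.
      Gam p $ l $ k $ j * G p $ i $ l * w $ k * u $ i * v $ j)"
    by (intro sum.cong[OF refl] sum.swap)
  finally show ?thesis unfolding a b by simp
qed

end


section \<open>The evolution equation in a chart\<close>

context metric_family
begin

text \<open>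
  With \<open>u = S\<close> and \<open>h = H\<close> these are the terms of the evolution equation of \<open>k\<^sup>2\<close> that have to be estimated, the
  vertical part of \<open>\<nabla>\<^sub>S H\<close> being the last summand of \<open>quad_err\<close>.
\<close>

definition quad_err :: "(real^'n) \<times> real \<Rightarrow> real^'n \<Rightarrow> real^'n \<Rightarrow> real" where
  "quad_err q u h = metric_inner (pt T G q) h h - 2 * metric_inner (pt T G q) u u * metric_inner (G q) h h
    + 2 * metric_inner (G q) (con (Dz Gam q h) u u - con (Dz Gam q u) h u
        + con (Gam q) h (con (Gam q) u u) - con (Gam q) u (con (Gam q) h u)) h
    + (metric_inner (pt T G q) u h)\<^sup>2 / 2"

definition lin_err :: "(real^'n) \<times> real \<Rightarrow> real^'n \<Rightarrow> real^'n \<Rightarrow> real" where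
  "lin_err q u h = 2 * metric_inner (G q) (con (pt T Gam q) u u) h"

text \<open>Homogeneity reduces the estimate to vectors \<open>h\<close> of unit length. Degree two
  here and degree one in \<open>lin_err_scaleR\<close> are the origin of \<open>k^2\<close> and
  \<open>k\<close> in the theorem; the linear term is due to the variation of the
  connection.\<close>

lemma quad_err_scaleR: "quad_err q u (k *\<^sub>R h) = k\<^sup>2 * quad_err q u h"
  by (simp add: quad_err_def metric_inner_linear con_linear Dz_linear power2_eq_square algebra_simps)

lemma lin_err_scaleR: "lin_err q u (k *\<^sub>R h) = k * lin_err q u h"
  by (simp add: lin_err_def metric_inner_linear)

lemma continuous_on_errs:
  shows "continuous_on ((V \<times> {0..T}) \<times> UNIV) (\<lambda>x. quad_err (fst x) (fst (snd x)) (snd (snd x)))"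
    and "continuous_on ((V \<times> {0..T}) \<times> UNIV) (\<lambda>x. lin_err (fst x) (fst (snd x)) (snd (snd x)))"
proof -
  let ?Q = "(V \<times> {0..T}) \<times> (UNIV :: ((real^'n) \<times> (real^'n)) set)"
  have 1: "smooth_on ?Q (\<lambda>x. f (fst x))" if "smooth_on (V \<times> {0..T}) f"
    for f :: "(real^'n) \<times> real \<Rightarrow> 'c::real_normed_vector"
    by (rule smooth_on_compose[OF that smooth_on_ident_linear[OF bounded_linear_fst]]) auto
  have 2: "smooth_on ?Q (\<lambda>x. fst (snd x))" "smooth_on ?Q (\<lambda>x. snd (snd x))"
    by (rule smooth_on_linear[OF bounded_linear_fst smooth_on_ident_linear[OF bounded_linear_snd]]
        smooth_on_linear[OF bounded_linear_snd smooth_on_ident_linear[OF bounded_linear_snd]])+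
  have 3: "smooth_on ?Q (\<lambda>x. Dz Gam (fst x) (w x))" if "smooth_on ?Q w" for w
    unfolding Dz_def by (intro smooth_on_sum smooth_on_scaleR smooth_on_vec_nth that 1 smooth_pz smooth_Gam)
  show "continuous_on ?Q (\<lambda>x. quad_err (fst x) (fst (snd x)) (snd (snd x)))"
    unfolding quad_err_def power2_eq_square
    by (intro smooth_on_imp_continuous_on smooth_on_add smooth_on_diff smooth_on_mult smooth_on_divide
        smooth_on_const smooth_on_metric_inner smooth_on_con 2 3 1[OF smooth_G] 1[OF smooth_pt[OF smooth_G]] 1[OF smooth_Gam]) auto
  show "continuous_on ?Q (\<lambda>x. lin_err (fst x) (fst (snd x)) (snd (snd x)))"
    unfolding lin_err_def
    by (intro smooth_on_imp_continuous_on smooth_on_mult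
        smooth_on_const smooth_on_metric_inner smooth_on_con 2 1[OF smooth_G] 1[OF smooth_pt[OF smooth_Gam]])
qed

text \<open>On the compact product of \<open>K\<close> with the Euclidean unit sphere the squared
  length for the metric attains a positive minimum \<open>m\<close>. By homogeneity, vectors of
  length at most one then have Euclidean norm at most \<open>1 / sqrt m\<close>.\<close>

lemma unit_vectors_bounded:
  assumes K: "compact K" "K \<subseteq> V \<times> {0..T}"
  obtains R where "\<And>q u. q \<in> K \<Longrightarrow> metric_inner (G q) u u \<le> 1 \<Longrightarrow> norm u \<le> R"
proof (cases "K = {}")
  case False
  let ?Q = "K \<times> sphere (0 :: real^'n) 1"
  have "continuous_on ?Q (\<lambda>x. metric_inner (G (fst x)) (snd x) (snd x))"
    by (intro smooth_on_imp_continuous_on smooth_on_metric_inner smooth_on_ident_linear bounded_linear_snd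
        smooth_on_compose[OF smooth_G smooth_on_ident_linear[OF bounded_linear_fst]]) (use K in auto)
  moreover have "compact ?Q" using K by (intro compact_Times) auto
  moreover have "axis (undefined :: 'n) 1 \<in> sphere (0 :: real^'n) 1" by (simp add: norm_axis_1)
  then have "?Q \<noteq> {}" using False by blast
  ultimately obtain x0 where x0: "x0 \<in> ?Q"
    "\<And>x. x \<in> ?Q \<Longrightarrow> metric_inner (G (fst x0)) (snd x0) (snd x0) \<le> metric_inner (G (fst x)) (snd x) (snd x)"
    using continuous_attains_inf[of ?Q "\<lambda>x. metric_inner (G (fst x)) (snd x) (snd x)"] by blast
  define m where "m = metric_inner (G (fst x0)) (snd x0) (snd x0)"
  have m: "m > 0"
    unfolding m_def using x0(1) K by (intro G_pos) auto
  have "norm u \<le> 1 / sqrt m" if q: "q \<in> K" and u: "metric_inner (G q) u u \<le> 1" for q u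
  proof (cases "u = 0")
    case True
    then show ?thesis using m by simp
  next
    case False
    have "m \<le> metric_inner (G q) (u /\<^sub>R norm u) (u /\<^sub>R norm u)"
      using x0(2)[of "(q, u /\<^sub>R norm u)"] q False unfolding m_def by simp
    then have "m * (norm u)\<^sup>2 \<le> metric_inner (G q) u u"
      using False by (simp add: metric_inner_linear field_simps power2_eq_square)
    then have "(norm u)\<^sup>2 \<le> 1 / m" using u m by (simp add: field_simps)
    then show ?thesis
      using real_le_rsqrt by (fastforce simp: real_sqrt_divide)
  qed
  then show ?thesis using that by blast
qed (use that in auto)

lemma errs_bounded:
  assumes K: "compact K" "K \<subseteq> V \<times> {0..T}"
  obtains C where "C \<ge> 0" and "\<And>q u h. q \<in> K \<Longrightarrow> metric_inner (G q) u u = 1 \<Longrightarrow>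
    quad_err q u h + lin_err q u h \<le> C * (metric_inner (G q) h h + sqrt (metric_inner (G q) h h))"
proof -
  obtain R where R: "\<And>q u. q \<in> K \<Longrightarrow> metric_inner (G q) u u \<le> 1 \<Longrightarrow> norm u \<le> R"
    using unit_vectors_bounded[OF K] by metis
  \<comment> \<open>The unit vectors of all metrics over \<open>K\<close> lie in these fixed balls,
    so continuity on a compact set bounds both errors.\<close>
  let ?Q = "K \<times> cball (0 :: real^'n) R \<times> cball (0 :: real^'n) R"
  have Q: "compact ?Q" using K by (intro compact_Times) auto
  have sub: "?Q \<subseteq> (V \<times> {0..T}) \<times> UNIV" using K by auto
  have "bounded ((\<lambda>x. quad_err (fst x) (fst (snd x)) (snd (snd x))) ` ?Q)"
    by (intro compact_imp_bounded compact_continuous_image continuous_on_subset[OF continuous_on_errs(1) sub] Q)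
  then obtain C1 where C1: "\<And>x. x \<in> ?Q \<Longrightarrow> \<bar>quad_err (fst x) (fst (snd x)) (snd (snd x))\<bar> \<le> C1"
    unfolding bounded_iff by (simp only: ball_simps real_norm_def) blast
  have "bounded ((\<lambda>x. lin_err (fst x) (fst (snd x)) (snd (snd x))) ` ?Q)"
    by (intro compact_imp_bounded compact_continuous_image continuous_on_subset[OF continuous_on_errs(2) sub] Q)
  then obtain C2 where C2: "\<And>x. x \<in> ?Q \<Longrightarrow> \<bar>lin_err (fst x) (fst (snd x)) (snd (snd x))\<bar> \<le> C2"
    unfolding bounded_iff by (simp only: ball_simps real_norm_def) blast
  \<comment> \<open>The absolute values matter when \<open>?Q\<close> is empty, as \<open>C1\<close>
    and \<open>C2\<close> may then be negative.\<close>
  define C where "C = \<bar>C1\<bar> + \<bar>C2\<bar>"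
  have "quad_err q u h + lin_err q u h \<le> C * (metric_inner (G q) h h + sqrt (metric_inner (G q) h h))"
    if q: "q \<in> K" and u: "metric_inner (G q) u u = 1" for q u h
  proof (cases "h = 0")
    case True
    then show ?thesis
      using quad_err_scaleR[of q u 0 h] lin_err_scaleR[of q u 0 h] by (simp add: metric_inner_linear)
  next
    case False
    define k where "k = sqrt (metric_inner (G q) h h)"
    have k: "k > 0" "metric_inner (G q) h h = k\<^sup>2"
      using G_pos[of q h] False q K unfolding k_def by auto
    define h' where "h' = h /\<^sub>R k"
    have h: "h = k *\<^sub>R h'" using k by (simp add: h'_def)
    have "metric_inner (G q) h' h' = 1"
      using k by (simp add: h'_def metric_inner_linear power2_eq_square field_simps)
    then have "(q, u, h') \<in> ?Q" using R q u by auto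
    then have "quad_err q u h' \<le> C" "lin_err q u h' \<le> C"
      using C1[of "(q, u, h')"] C2[of "(q, u, h')"] unfolding C_def by auto
    then have "k\<^sup>2 * quad_err q u h' + k * lin_err q u h' \<le> k\<^sup>2 * C + k * C"
      using k by (intro add_mono mult_left_mono) auto
    then show ?thesis
      unfolding k(2) using k(1) by (simp add: h quad_err_scaleR lin_err_scaleR algebra_simps)
  qed
  moreover have "C \<ge> 0" by (simp add: C_def)
  ultimately show ?thesis using that by blast
qed

end

text \<open>Joins a family of curves in coordinates with a family of metrics on the target; fields
  on \<open>V \<times> {0..T}\<close> are pulled back along
  \<open>p \<mapsto> (y p, snd p)\<close>.\<close>

locale chart_curve = strip T W + cyl: metric_family T V G
  for T :: real and W and V :: "(real^'n::finite) set" and G +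
  fixes y :: "real \<times> real \<Rightarrow> real^'n"
  assumes y_smooth: "smooth_on W y" and y_in: "p \<in> W \<Longrightarrow> y p \<in> V"
    and y_immersed: "p \<in> W \<Longrightarrow> px y p \<noteq> 0"
begin

lemma along_in: "p \<in> W \<Longrightarrow> (y p, snd p) \<in> V \<times> {0..T}"
  using y_in W_time by auto

lemma smooth_along:
  "smooth_on (V \<times> {0..T}) f \<Longrightarrow> smooth_on W (\<lambda>p. f (y p, snd p))"
  by (rule smooth_on_compose[where g = "\<lambda>p. (y p, snd p)"])
    (use smooth_on_Pair[OF y_smooth smooth_on_ident_linear[OF bounded_linear_snd]] along_in in auto)

text \<open>The derivative \<open>y'\<close> is handed out together with that of the composition, so
  that \<open>px_along\<close> and \<open>pt_along\<close> can identify its values with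
  \<open>px y\<close> and \<open>pt T y\<close>.\<close>

lemma along_has_derivative:
  assumes f: "smooth_on (V \<times> {0..T}) f" and p: "p \<in> W"
  obtains y' where "(y has_derivative y') (at p within W)"
    "((\<lambda>p. f (y p, snd p)) has_derivative
      (\<lambda>h. cyl.Dz f (y p, snd p) (y' h) + snd h *\<^sub>R pt T f (y p, snd p))) (at p within W)"
proof -
  obtain y' where y': "(y has_derivative y') (at p within W)"
    using smooth_on_obtains_derivative[OF y_smooth] p by metis
  have 1: "((\<lambda>p. (y p, snd p)) has_derivative (\<lambda>h. (y' h, snd h))) (at p within W)"
    by (auto intro!: derivative_eq_intros y')
  have 2: "(f has_derivative (\<lambda>w. cyl.Dz f (y p, snd p) (fst w) + snd w *\<^sub>R pt T f (y p, snd p)))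
      (at (y p, snd p) within (\<lambda>p. (y p, snd p)) ` W)"
    by (rule has_derivative_subset[OF cyl.has_derivative_Dz_pt[OF f along_in[OF p]]]) (use along_in in auto)
  have "((\<lambda>p. f (y p, snd p)) has_derivative
      (\<lambda>h. cyl.Dz f (y p, snd p) (y' h) + snd h *\<^sub>R pt T f (y p, snd p))) (at p within W)"
    using has_derivative_in_compose[OF 1 2] by simp
  with y' show ?thesis using that by blast
qed

lemma px_along:
  assumes f: "smooth_on (V \<times> {0..T}) f" and p: "p \<in> W"
  shows "px (\<lambda>p. f (y p, snd p)) p = cyl.Dz f (y p, snd p) (px y p)"
proof -
  obtain y' where y': "(y has_derivative y') (at p within W)"
    and d: "((\<lambda>p. f (y p, snd p)) has_derivative
      (\<lambda>h. cyl.Dz f (y p, snd p) (y' h) + snd h *\<^sub>R pt T f (y p, snd p))) (at p within W)"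
    by (rule along_has_derivative[OF assms])
  have e: "px y p = y' (1, 0)" by (rule px_eqI[OF has_vector_derivative_x[OF y' p]])
  show ?thesis
    unfolding e using px_eqI[of "\<lambda>p. f (y p, snd p)" p, OF has_vector_derivative_x[OF d p]] by simp
qed

text \<open>The first summand is due to the motion of the point, the second to the explicit
  dependence on time. Applied to \<open>Gam\<close>, the first enters the Riemann curvature and the
  second is the variation of the connection.\<close>

lemma pt_along:
  assumes f: "smooth_on (V \<times> {0..T}) f" and p: "p \<in> W"
  shows "pt T (\<lambda>p. f (y p, snd p)) p = cyl.Dz f (y p, snd p) (pt T y p) + pt T f (y p, snd p)"
proof -
  obtain y' where y': "(y has_derivative y') (at p within W)"
    and d: "((\<lambda>p. f (y p, snd p)) has_derivative
      (\<lambda>h. cyl.Dz f (y p, snd p) (y' h) + snd h *\<^sub>R pt T f (y p, snd p))) (at p within W)"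
    by (rule along_has_derivative[OF assms])
  have e: "pt T y p = y' (0, 1)" by (rule pt_eqI[OF p has_vector_derivative_t[OF y' p]])
  show ?thesis
    unfolding e using pt_eqI[of p "\<lambda>p. f (y p, snd p)", OF p has_vector_derivative_t[OF d p]] by simp
qed

text \<open>\<open>B_x\<close> and \<open>B_t\<close> are metric compatibility at a fixed time,
  contracted with the directions \<open>px y\<close> and \<open>pt T y\<close>; in the latter the
  explicit time derivative of \<open>G\<close> remains and becomes \<open>Gd\<close>.\<close>

sublocale chart_flow T W y "\<lambda>p. G (y p, snd p)" "\<lambda>p. pt T G (y p, snd p)" "\<lambda>p. cyl.Gam (y p, snd p)"
proof
  show "smooth_on W y" by (rule y_smooth)
  show "smooth_on W (\<lambda>p. G (y p, snd p))" by (rule smooth_along[OF cyl.smooth_G])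
  show "smooth_on W (\<lambda>p. pt T G (y p, snd p))" by (rule smooth_along[OF cyl.smooth_pt[OF cyl.smooth_G]])
  show "smooth_on W (\<lambda>p. cyl.Gam (y p, snd p))" by (rule smooth_along[OF cyl.smooth_Gam])
  fix p u v assume p: "p \<in> W"
  show "transpose (G (y p, snd p)) = G (y p, snd p)" by (rule cyl.G_sym[OF along_in[OF p]])
  show "v \<noteq> 0 \<Longrightarrow> metric_inner (G (y p, snd p)) v v > 0" by (rule cyl.G_pos[OF along_in[OF p]])
  show "con (cyl.Gam (y p, snd p)) u v = con (cyl.Gam (y p, snd p)) v u"
    by (rule cyl.con_Gam_sym[OF along_in[OF p]])
  show "metric_inner (px (\<lambda>p. G (y p, snd p)) p) u v =
      metric_inner (G (y p, snd p)) (con (cyl.Gam (y p, snd p)) (px y p) u) v +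
      metric_inner (G (y p, snd p)) u (con (cyl.Gam (y p, snd p)) (px y p) v)"
    unfolding px_along[OF cyl.smooth_G p] by (rule cyl.metric_inner_Dz_G[OF along_in[OF p]])
  show "metric_inner (pt T (\<lambda>p. G (y p, snd p)) p) u v = metric_inner (pt T G (y p, snd p)) u v +
      metric_inner (G (y p, snd p)) (con (cyl.Gam (y p, snd p)) (pt T y p) u) v +
      metric_inner (G (y p, snd p)) u (con (cyl.Gam (y p, snd p)) (pt T y p) v)"
    unfolding pt_along[OF cyl.smooth_G p] metric_inner_linear cyl.metric_inner_Dz_G[OF along_in[OF p]] by simp
  show "px y p \<noteq> 0" by (rule y_immersed[OF p])
qed

end

locale chart_curve_shrinking = chart_curve +
  assumes y_flow: "p \<in> W \<Longrightarrow> pt T y p = H p"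
begin

sublocale chart_shrinking T W y "\<lambda>p. G (y p, snd p)" "\<lambda>p. pt T G (y p, snd p)" "\<lambda>p. cyl.Gam (y p, snd p)"
  by unfold_locales (rule y_flow)

text \<open>Rearranges \<open>pt_curvature\<close> so that the bracket is the squared normal part of
  \<open>nabla_S H\<close> in the product: removing the tangential component subtracts
  \<open>(ip H H)^2\<close>, and the vertical component adds a quarter of a square. This turns the
  factor 4 into 2 and is balanced by the last summand of \<open>quad_err\<close>.\<close>

lemma pt_curvature_err:
  assumes p: "p \<in> W"
  shows "pt T (ip H H) p = px (\<lambda>q. px (ip H H) q / sp q) p / sp p
    - 2 * (ip (ns H) (ns H) p - (ip H H p)\<^sup>2 + (metric_inner (pt T G (y p, snd p)) (S p) (H p))\<^sup>2 / 4)
    + 2 * (ip H H p)\<^sup>2 + cyl.quad_err (y p, snd p) (S p) (H p) + cyl.lin_err (y p, snd p) (S p) (H p)"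
proof -
  let ?q = "(y p, snd p)"
  let ?\<Gamma> = "con (cyl.Gam ?q)"
  have c: "curvature_term p (S p) /\<^sub>R sp p = con (cyl.Dz cyl.Gam ?q (H p)) (S p) (S p)
      + con (pt T cyl.Gam ?q) (S p) (S p) - con (cyl.Dz cyl.Gam ?q (S p)) (H p) (S p)
      + ?\<Gamma> (H p) (?\<Gamma> (S p) (S p)) - ?\<Gamma> (S p) (?\<Gamma> (H p) (S p))"
    unfolding curvature_term_def pt_along[OF cyl.smooth_Gam p] px_along[OF cyl.smooth_Gam p] flow[OF p] px_y_eq[OF p]
    using sp_pos[OF p] by (simp add: con_linear cyl.Dz_linear algebra_simps)
  then show ?thesis
    unfolding pt_curvature[OF p] c cyl.quad_err_def cyl.lin_err_def ip_def
    by (simp add: metric_inner_linear algebra_simps)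
qed

end


section \<open>Change of charts\<close>

lemma smooth_on_open_has_derivative:
  assumes "smooth_on D f" "open D" "z \<in> D"
  shows "(f has_derivative frechet_derivative f (at z)) (at z)"
proof -
  obtain f' where "\<And>z. z \<in> D \<Longrightarrow> (f has_derivative f' z) (at z within D)"
    using smooth_on_obtains_derivative[OF assms(1)] by blast
  then have "(f has_derivative f' z) (at z)"
    using assms(2,3) at_within_open by metis
  then show ?thesis
    using frechet_derivative_works differentiableI by blast
qed

lemma smooth_on_frechet_derivative:
  assumes "smooth_on D f" "open D"
  shows "smooth_on D (\<lambda>z. frechet_derivative f (at z) v)"
  unfolding smooth_on_def
proof
  fix k
  obtain f' where f': "\<And>z. z \<in> D \<Longrightarrow> (f has_derivative f' z) (at z within D)"
    "\<And>v. Ck_on k D (\<lambda>z. f' z v)"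
    using assms unfolding smooth_on_def by (metis Ck_on.simps(2))
  have "frechet_derivative f (at z) v = f' z v" if "z \<in> D" for z
    using f'(1)[OF that] at_within_open[OF that assms(2)] frechet_derivative_at[of f "f' z" z] by simp
  then have "Ck_on k D (\<lambda>z. frechet_derivative f (at z) v) \<longleftrightarrow> Ck_on k D (\<lambda>z. f' z v)"
    by (rule Ck_on_cong)
  with f'(2) show "Ck_on k D (\<lambda>z. frechet_derivative f (at z) v)" by simp
qed

lemma has_vector_derivative_line:
  assumes "(f has_derivative f') (at z)"
  shows "((\<lambda>h. f (z + h *\<^sub>R u)) has_vector_derivative f' u) (at 0)"
proof -
  have 1: "((\<lambda>h. z + h *\<^sub>R u) has_vector_derivative u) (at 0 within UNIV)"
    unfolding has_vector_derivative_def by (auto intro!: derivative_eq_intros)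
  have 2: "(f has_derivative f') (at (z + 0 *\<^sub>R u) within range (\<lambda>h. z + h *\<^sub>R u))"
    using assms by (auto intro: has_derivative_at_withinI)
  show ?thesis
    using vector_derivative_diff_chain_within[OF 1 2] by (simp add: o_def)
qed

text \<open>Pulling \<open>f\<close> back along the affine map
  \<open>(x, t) \<mapsto> z + x u + t v\<close> reduces the claim to \<open>pt_px_commute\<close>.
  Only \<open>t\<close> in \<open>[0, 1]\<close> is used, so the point in question lies on the
  boundary of the strip, where one-sided commutation is enough.\<close>

lemma second_frechet_derivative_sym:
  fixes f :: "'a::euclidean_space \<Rightarrow> 'b::euclidean_space"
  assumes f: "smooth_on D f" and D: "open D" and z: "z \<in> D"
  shows "frechet_derivative (\<lambda>z. frechet_derivative f (at z) v) (at z) u =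
    frechet_derivative (\<lambda>z. frechet_derivative f (at z) u) (at z) v"
proof -
  let ?l = "\<lambda>p. z + fst p *\<^sub>R u + snd p *\<^sub>R v"
  let ?F = "\<lambda>w z. frechet_derivative f (at z) w"
  define W where "W = (UNIV \<times> {0..1}) \<inter> ?l -` D"
  have l: "continuous_on UNIV ?l" by (intro continuous_intros)
  interpret strip 1 W
    by unfold_locales (auto simp: W_def intro!: openin_open_Int open_vimage D l)
  have W: "?l p \<in> D" if "p \<in> W" for p using that by (simp add: W_def)
  have sm: "smooth_on W (\<lambda>p. h (?l p))" if "smooth_on D h" for h :: "'a \<Rightarrow> 'b"
    by (rule smooth_on_compose[OF that, of W ?l])
      (rule smooth_on_add[OF smooth_on_add[OF smooth_on_const smooth_on_scaleR[OF smooth_on_ident_linear[OF bounded_linear_fst]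
        smooth_on_const]] smooth_on_scaleR[OF smooth_on_ident_linear[OF bounded_linear_snd] smooth_on_const]], rule W)
  have dl: "(?l has_derivative (\<lambda>w. fst w *\<^sub>R u + snd w *\<^sub>R v)) (at p within W)" for p
    by (auto intro!: derivative_eq_intros)
  have d: "((\<lambda>p. h (?l p)) has_derivative (\<lambda>w. frechet_derivative h (at (?l p)) (fst w *\<^sub>R u + snd w *\<^sub>R v)))
      (at p within W)" if "smooth_on D h" "p \<in> W" for h :: "'a \<Rightarrow> 'b" and p
    by (rule has_derivative_compose[OF dl smooth_on_open_has_derivative[OF that(1) D W[OF that(2)]]])
  have x: "px (\<lambda>p. h (?l p)) p = frechet_derivative h (at (?l p)) u"
    if "smooth_on D h" "p \<in> W" for h :: "'a \<Rightarrow> 'b" and p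
    using px_eqI[of "\<lambda>p. h (?l p)" p, OF has_vector_derivative_x[OF d[OF that] that(2)]] by simp
  have t: "pt 1 (\<lambda>p. h (?l p)) p = frechet_derivative h (at (?l p)) v"
    if "smooth_on D h" "p \<in> W" for h :: "'a \<Rightarrow> 'b" and p
    using pt_eqI[of p "\<lambda>p. h (?l p)", OF that(2) has_vector_derivative_t[OF d[OF that] that(2)]] by simp
  have 0: "(0, 0) \<in> W" using z by (simp add: W_def)
  have "px (\<lambda>p. ?F v (?l p)) (0, 0) = px (pt 1 (\<lambda>p. f (?l p))) (0, 0)"
    by (rule px_cong[OF _ 0]) (rule t[OF f, symmetric])
  also have "\<dots> = pt 1 (px (\<lambda>p. f (?l p))) (0, 0)"
    by (rule pt_px_commute[OF sm[OF f] 0])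
  also have "\<dots> = pt 1 (\<lambda>p. ?F u (?l p)) (0, 0)"
    by (rule pt_cong[OF _ 0]) (rule x[OF f])
  finally show ?thesis
    using x[OF smooth_on_frechet_derivative[OF f D] 0] t[OF smooth_on_frechet_derivative[OF f D] 0] by simp
qed

section \<open>Isometric coordinate changes\<close>

locale metric_transition = M1: metric_family T V1 G1 + M2: metric_family T V2 G2
  for T :: real and V1 V2 :: "(real^'n::finite) set" and G1 G2 +
  fixes D :: "(real^'n) set" and \<phi> :: "real^'n \<Rightarrow> real^'n"
  assumes D_open: "open D" and D_sub: "D \<subseteq> V1" and smooth_\<phi>: "smooth_on D \<phi>"
    and \<phi>_in: "z \<in> D \<Longrightarrow> \<phi> z \<in> V2"
    and isometry: "z \<in> D \<Longrightarrow> t \<in> {0..T} \<Longrightarrow> metric_inner (G1 (z, t)) v w =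
      metric_inner (G2 (\<phi> z, t)) (frechet_derivative \<phi> (at z) v) (frechet_derivative \<phi> (at z) w)"
begin

abbreviation J :: "real^'n \<Rightarrow> real^'n \<Rightarrow> real^'n" where
  "J z \<equiv> frechet_derivative \<phi> (at z)"

definition hess :: "real^'n \<Rightarrow> real^'n \<Rightarrow> real^'n \<Rightarrow> real^'n" where
  "hess z u v = frechet_derivative (\<lambda>z. J z v) (at z) u"

lemma J_linear: "z \<in> D \<Longrightarrow> linear (J z)"
  using smooth_on_open_has_derivative[OF smooth_\<phi> D_open] has_derivative_linear by blast

text \<open>A nonzero vector in the kernel would have length zero for \<open>G1\<close>, evaluated
  here at time 0.\<close>

lemma J_inj:
  assumes z: "z \<in> D"
  shows "inj (J z)"
proof -
  have "v = 0" if "J z v = 0" for v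
  proof (rule ccontr)
    assume "v \<noteq> 0"
    then have "metric_inner (G1 (z, 0)) v v > 0"
      using z D_sub M1.T_pos by (intro M1.G_pos) auto
    then show False
      using isometry[OF z, of 0 v v] M1.T_pos that by (simp add: metric_inner_linear)
  qed
  then show ?thesis using linear_injective_0[OF J_linear[OF z]] by blast
qed

lemma J_surj: "z \<in> D \<Longrightarrow> surj (J z)"
  using linear_injective_imp_surjective[OF J_linear J_inj] by simp

lemma hess_sym: "z \<in> D \<Longrightarrow> hess z u v = hess z v u"
  unfolding hess_def by (rule second_frechet_derivative_sym[OF smooth_\<phi> D_open])

lemma smooth_J: "smooth_on D (\<lambda>z. J z v)"
  by (rule smooth_on_frechet_derivative[OF smooth_\<phi> D_open])

lemma has_derivative_J: "z \<in> D \<Longrightarrow> ((\<lambda>z. J z v) has_derivative (\<lambda>u. hess z u v)) (at z)"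
  unfolding hess_def by (rule smooth_on_open_has_derivative[OF smooth_J D_open])

text \<open>The isometry property is differentiated along the line through \<open>z\<close> in
  direction \<open>u\<close>. Hessian terms arise because the differential applied to the fixed
  \<open>v\<close> and \<open>w\<close> varies with the base point.\<close>

lemma isometry_derivative:
  assumes z: "z \<in> D" and t: "t \<in> {0..T}"
  shows "metric_inner (M1.Dz G1 (z, t) u) v w = metric_inner (M2.Dz G2 (\<phi> z, t) (J z u)) (J z v) (J z w)
    + metric_inner (G2 (\<phi> z, t)) (hess z u v) (J z w) + metric_inner (G2 (\<phi> z, t)) (J z v) (hess z u w)"
proof -
  have zt: "(z, t) \<in> V1 \<times> {0..T}" "(\<phi> z, t) \<in> V2 \<times> {0..T}"
    using z t D_sub \<phi>_in by auto
  have "((\<lambda>h. G1 (z + h *\<^sub>R u, t)) has_vector_derivative M1.Dz G1 (z, t) u) (at 0)"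
    using M1.has_vector_derivative_z[OF M1.has_derivative_Dz_pt[OF M1.smooth_G zt(1)] zt(1), of u] by simp
  from has_vector_derivative_metric_inner[OF this has_vector_derivative_const has_vector_derivative_const, of v w]
  have 1: "((\<lambda>h. metric_inner (G1 (z + h *\<^sub>R u, t)) v w) has_vector_derivative
      metric_inner (M1.Dz G1 (z, t) u) v w) (at 0)"
    by (simp add: metric_inner_linear)
  define U where "U = (\<lambda>h. z + h *\<^sub>R u) -` D"
  have U: "open U" "0 \<in> U"
    unfolding U_def using z by (auto intro!: open_vimage D_open continuous_intros)
  have a: "((\<lambda>h. \<phi> (z + h *\<^sub>R u)) has_vector_derivative J z u) (at 0 within U)"
    by (rule has_vector_derivative_at_within[OF has_vector_derivative_line[OF
          smooth_on_open_has_derivative[OF smooth_\<phi> D_open z]]])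
  have b: "((\<lambda>h. (\<phi> (z + h *\<^sub>R u), t)) has_vector_derivative (J z u, 0)) (at 0 within U)"
    by (intro has_vector_derivative_Pair a has_vector_derivative_const)
  have "(G2 has_derivative (\<lambda>w. M2.Dz G2 (\<phi> z, t) (fst w) + snd w *\<^sub>R pt T G2 (\<phi> z, t)))
      (at (\<phi> (z + 0 *\<^sub>R u), t) within (\<lambda>h. (\<phi> (z + h *\<^sub>R u), t)) ` U)"
    using M2.has_derivative_Dz_pt[OF M2.smooth_G zt(2)] \<phi>_in t
    by (auto simp: U_def intro: has_derivative_subset)
  from vector_derivative_diff_chain_within[OF b this]
  have c: "((\<lambda>h. G2 (\<phi> (z + h *\<^sub>R u), t)) has_vector_derivative M2.Dz G2 (\<phi> z, t) (J z u)) (at 0)"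
    using at_within_open[OF U(2,1)] by (simp add: o_def)
  have d: "((\<lambda>h. J (z + h *\<^sub>R u) v) has_vector_derivative hess z u v) (at 0)" for v
    by (rule has_vector_derivative_line[OF has_derivative_J[OF z]])
  have 2: "((\<lambda>h. metric_inner (G2 (\<phi> (z + h *\<^sub>R u), t)) (J (z + h *\<^sub>R u) v) (J (z + h *\<^sub>R u) w)) has_vector_derivative
     (metric_inner (M2.Dz G2 (\<phi> z, t) (J z u)) (J z v) (J z w)
    + metric_inner (G2 (\<phi> z, t)) (hess z u v) (J z w) + metric_inner (G2 (\<phi> z, t)) (J z v) (hess z u w))) (at 0)"
    using has_vector_derivative_metric_inner[OF c d d] by simp
  have "((\<lambda>h. metric_inner (G1 (z + h *\<^sub>R u, t)) v w) has_vector_derivative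
     (metric_inner (M2.Dz G2 (\<phi> z, t) (J z u)) (J z v) (J z w)
    + metric_inner (G2 (\<phi> z, t)) (hess z u v) (J z w) + metric_inner (G2 (\<phi> z, t)) (J z v) (hess z u w))) (at 0)"
    by (rule has_vector_derivative_transform_within_open[OF 2 U])
      (use isometry t in \<open>auto simp: U_def\<close>)
  then show ?thesis
    using vector_derivative_unique_at 1 by blast
qed

text \<open>
  The defect \<open>d u v w\<close> of the transformation law is symmetric in \<open>u\<close>, \<open>v\<close> because both connections are
  torsion-free, and antisymmetric in \<open>v\<close>, \<open>w\<close> because both are metric; such a \<open>d\<close> vanishes.
\<close>

lemma christoffel_transition:
  assumes z: "z \<in> D" and t: "t \<in> {0..T}"
  shows "J z (con (M1.Gam (z, t)) u v) = hess z u v + con (M2.Gam (\<phi> z, t)) (J z u) (J z v)"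
proof -
  have zt: "(z, t) \<in> V1 \<times> {0..T}" "(\<phi> z, t) \<in> V2 \<times> {0..T}"
    using z t D_sub \<phi>_in by auto
  define e where "e u v = J z (con (M1.Gam (z, t)) u v) - (hess z u v + con (M2.Gam (\<phi> z, t)) (J z u) (J z v))" for u v
  define d where "d u v w = metric_inner (G2 (\<phi> z, t)) (e u v) (J z w)" for u v w
  have sym: "d u v w = d v u w" for u v w
    unfolding d_def e_def using hess_sym[OF z] M1.con_Gam_sym[OF zt(1)] M2.con_Gam_sym[OF zt(2)] by simp
  have comm: "metric_inner (G2 (\<phi> z, t)) a b = metric_inner (G2 (\<phi> z, t)) b a" for a b
    using metric_inner_sym M2.G_sym[OF zt(2)] by blast
  have anti: "d u v w = - d u w v" for u v w
    using isometry_derivative[OF z t, of u v w]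
    unfolding M1.metric_inner_Dz_G[OF zt(1)] M2.metric_inner_Dz_G[OF zt(2)] isometry[OF z t] d_def e_def metric_inner_linear
    using comm by (simp add: algebra_simps)
  \<comment> \<open>Alternating the two rules, three times each, leads back to
    \<open>d u v w\<close> with the opposite sign.\<close>
  have d0: "d u v w = 0" for w
    using anti[of u v w] sym[of u w v] anti[of w u v] sym[of w v u] anti[of v w u] sym[of v u w] by simp
  \<comment> \<open>Surjectivity of the differential makes \<open>e u v\<close> itself an admissible
    test vector, so its length vanishes.\<close>
  obtain w where "J z w = e u v" using J_surj[OF z] by (metis surjD)
  then have "metric_inner (G2 (\<phi> z, t)) (e u v) (e u v) = 0" using d0[of w] by (simp add: d_def)
  then have "e u v = 0" using M2.G_pos[OF zt(2)] by force
  then show ?thesis by (simp add: e_def)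
qed

text \<open>The coordinate change does not depend on time, so the isometry identity may be
  differentiated in \<open>t\<close> with \<open>J z v\<close> and \<open>J z w\<close> held fixed.
  The vertical part of \<open>nabla_S H\<close> is independent of the chart for this reason.\<close>

lemma isometry_pt:
  assumes z: "z \<in> D" and t: "t \<in> {0..T}"
  shows "metric_inner (pt T G1 (z, t)) v w = metric_inner (pt T G2 (\<phi> z, t)) (J z v) (J z w)"
proof -
  have zt: "(z, t) \<in> V1 \<times> {0..T}" "(\<phi> z, t) \<in> V2 \<times> {0..T}"
    using z t D_sub \<phi>_in by auto
  have 1: "((\<lambda>s. metric_inner (G1 (z, s)) v w) has_vector_derivative metric_inner (pt T G1 (z, t)) v w) (at t within {0..T})"
    using has_vector_derivative_metric_inner[OF M1.has_pt[OF M1.smooth_G zt(1)] has_vector_derivative_const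
      has_vector_derivative_const, of v w] by (simp add: metric_inner_linear)
  have "((\<lambda>s. metric_inner (G2 (\<phi> z, s)) (J z v) (J z w)) has_vector_derivative
      metric_inner (pt T G2 (\<phi> z, t)) (J z v) (J z w)) (at t within {0..T})"
    using has_vector_derivative_metric_inner[OF M2.has_pt[OF M2.smooth_G zt(2)] has_vector_derivative_const
      has_vector_derivative_const, of "J z v" "J z w"] by (simp add: metric_inner_linear)
  then have 2: "((\<lambda>s. metric_inner (G1 (z, s)) v w) has_vector_derivative
      metric_inner (pt T G2 (\<phi> z, t)) (J z v) (J z w)) (at t within {0..T})"
    by (rule has_vector_derivative_transform[OF t, rotated]) (rule isometry[OF z])
  show ?thesis
    using vector_derivative_unique_within_closed_interval[of 0 T t, unfolded box_real, OF M1.T_pos t 1 2] .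
qed

end

locale curve_transition = metric_transition T V1 V2 G1 G2 D \<phi>
    + C1: chart_curve T W1 V1 G1 y1 + C2: chart_curve T W2 V2 G2 y2
  for T :: real and V1 V2 :: "(real^'n::finite) set" and G1 G2 D \<phi> W1 W2 y1 y2 +
  assumes y_transition: "p \<in> W1 \<inter> W2 \<Longrightarrow> y1 p \<in> D \<and> y2 p = \<phi> (y1 p)"
begin

sublocale C12: strip T "W1 \<inter> W2"
  by unfold_locales (use C1.T_pos C1.W_open C2.W_open in auto)

text \<open>Both the base point and the vector depend on \<open>x\<close>. Expanding the vector in
  the standard basis leaves derivatives of \<open>J\<close> in fixed directions, which are Hessian
  terms, and derivatives of scalar components.\<close>

lemma px_J:
  assumes p: "p \<in> W1 \<inter> W2" and V: "smooth_on W1 V"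
  shows "((\<lambda>\<xi>. J (y1 (\<xi>, snd p)) (V (\<xi>, snd p))) has_vector_derivative
    (hess (y1 p) (px y1 p) (V p) + J (y1 p) (px V p))) (at (fst p))"
proof -
  have D: "y1 p \<in> D" and p1: "p \<in> W1" using y_transition[OF p] p by auto
  obtain U where U: "open U" "fst p \<in> U" "\<And>\<xi>. \<xi> \<in> U \<Longrightarrow> (\<xi>, snd p) \<in> W1 \<inter> W2"
    using C12.eventually_x_in_W[OF p] unfolding eventually_nhds by blast
  have J: "J z v = (\<Sum>i\<in>UNIV. v $ i *\<^sub>R J z (axis i 1))" if "z \<in> D" for z v
    using arg_cong[OF vec_eq_sum_axis[of v], of "J z"]
    unfolding linear_sum[OF J_linear[OF that]] linear_cmul[OF J_linear[OF that]] .
  have J1: "((\<lambda>\<xi>. J (y1 (\<xi>, snd p)) v) has_vector_derivative hess (y1 p) (px y1 p) v) (at (fst p))" for v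
    using vector_derivative_diff_chain_within[OF C1.has_px[OF C1.y_smooth p1], of "\<lambda>z. J z v" "\<lambda>u. hess (y1 p) u v"]
      has_derivative_at_withinI[OF has_derivative_J[OF D]] by (simp add: o_def)
  have "((\<lambda>\<xi>. \<Sum>i\<in>UNIV. V (\<xi>, snd p) $ i *\<^sub>R J (y1 (\<xi>, snd p)) (axis i 1)) has_vector_derivative
    (\<Sum>i\<in>UNIV. V p $ i *\<^sub>R hess (y1 p) (px y1 p) (axis i 1) + px V p $ i *\<^sub>R J (y1 p) (axis i 1))) (at (fst p))"
    using bounded_bilinear.has_vector_derivative[OF bounded_bilinear_scaleR
      bounded_linear.has_vector_derivative[OF bounded_linear_vec_nth C1.has_px[OF V p1]] J1]
    by (intro has_vector_derivative_sum) simp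
  moreover have "(\<Sum>i\<in>UNIV. px V p $ i *\<^sub>R J (y1 p) (axis i 1)) = J (y1 p) (px V p)"
    by (rule J[OF D, symmetric])
  moreover have "(\<Sum>i\<in>UNIV. V p $ i *\<^sub>R hess (y1 p) (px y1 p) (axis i 1)) = hess (y1 p) (px y1 p) (V p)"
  proof -
    \<comment> \<open>Linearity in the first argument is that of a derivative; the symmetry of the
      Hessian carries it over to the second.\<close>
    have "linear (\<lambda>v. hess (y1 p) v (px y1 p))"
      using has_derivative_J[OF D] has_derivative_linear by blast
    then have lin: "linear (hess (y1 p) (px y1 p))"
      using hess_sym[OF D, of _ "px y1 p"] by simp
    show ?thesis
      using arg_cong[OF vec_eq_sum_axis[of "V p"], of "hess (y1 p) (px y1 p)"]
      unfolding linear_sum[OF lin] linear_cmul[OF lin] by (rule sym)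
  qed
  ultimately have "((\<lambda>\<xi>. \<Sum>i\<in>UNIV. V (\<xi>, snd p) $ i *\<^sub>R J (y1 (\<xi>, snd p)) (axis i 1)) has_vector_derivative
    (hess (y1 p) (px y1 p) (V p) + J (y1 p) (px V p))) (at (fst p))"
    by (simp add: sum.distrib)
  then show ?thesis
    by (rule has_vector_derivative_transform_within_open[OF _ U(1,2)])
      (use U(3) y_transition J in auto)
qed

lemma px_y_transition:
  assumes p: "p \<in> W1 \<inter> W2"
  shows "px y2 p = J (y1 p) (px y1 p)"
proof -
  have D: "y1 p \<in> D" and p1: "p \<in> W1" using y_transition[OF p] p by auto
  have "px y2 p = px (\<lambda>q. \<phi> (y1 q)) p"
    by (rule C12.px_cong[OF _ p]) (use y_transition in blast)
  also have "\<dots> = J (y1 p) (px y1 p)"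
    using vector_derivative_diff_chain_within[OF C1.has_px[OF C1.y_smooth p1], of \<phi> "J (y1 p)"]
      has_derivative_at_withinI[OF smooth_on_open_has_derivative[OF smooth_\<phi> D_open D]]
    by (intro C1.px_eqI) (simp add: o_def)
  finally show ?thesis .
qed

text \<open>The Hessian term from differentiating \<open>J\<close> is absorbed by
  \<open>christoffel_transition\<close>. The fields need to correspond on the overlap only, which is
  what each step from \<open>S\<close> to \<open>H\<close> to \<open>ns H\<close> provides for the
  next.\<close>

lemma Dx_transition:
  assumes p: "p \<in> W1 \<inter> W2" and U: "smooth_on W1 U"
    and UV: "\<And>q. q \<in> W1 \<inter> W2 \<Longrightarrow> V q = J (y1 q) (U q)"
  shows "C2.Dx V p = J (y1 p) (C1.Dx U p)"
proof -
  have D: "y1 p \<in> D" and y2: "y2 p = \<phi> (y1 p)" using y_transition[OF p] p by auto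
  have t: "snd p \<in> {0..T}" using C12.W_time[OF p] .
  have "px V p = px (\<lambda>q. J (y1 q) (U q)) p"
    by (rule C12.px_cong[OF UV p])
  also have "\<dots> = hess (y1 p) (px y1 p) (U p) + J (y1 p) (px U p)"
    using px_J[OF p U] by (intro C1.px_eqI)
  finally show ?thesis
    unfolding C2.Dx_def C1.Dx_def UV[OF p] px_y_transition[OF p] linear_add[OF J_linear[OF D]]
      christoffel_transition[OF D t] y2 by simp
qed

lemma ip_transition:
  assumes p: "p \<in> W1 \<inter> W2"
    and "U' p = J (y1 p) (U p)" "V' p = J (y1 p) (V p)"
  shows "C2.ip U' V' p = C1.ip U V p"
  using isometry[of "y1 p" "snd p"] y_transition[OF p] C12.W_time[OF p] assms(2,3)
  unfolding C1.ip_def C2.ip_def by simp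

lemma sp_transition: "p \<in> W1 \<inter> W2 \<Longrightarrow> C2.sp p = C1.sp p"
  unfolding C1.sp_def C2.sp_def using ip_transition px_y_transition by simp

lemma S_transition:
  assumes p: "p \<in> W1 \<inter> W2"
  shows "C2.S p = J (y1 p) (C1.S p)"
  unfolding C1.S_def C2.S_def sp_transition[OF p] px_y_transition[OF p]
  using y_transition[OF p] by (simp add: linear_cmul[OF J_linear])

lemma ns_transition:
  assumes p: "p \<in> W1 \<inter> W2" and U: "smooth_on W1 U"
    and UV: "\<And>q. q \<in> W1 \<inter> W2 \<Longrightarrow> V q = J (y1 q) (U q)"
  shows "C2.ns V p = J (y1 p) (C1.ns U p)"
proof -
  have "C2.Dx V p = J (y1 p) (C1.Dx U p)"
    by (rule Dx_transition[OF p U UV])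
  then show ?thesis
    unfolding C1.ns_def C2.ns_def sp_transition[OF p]
    using y_transition[OF p] by (simp add: linear_cmul[OF J_linear])
qed

lemma H_transition: "p \<in> W1 \<inter> W2 \<Longrightarrow> C2.H p = J (y1 p) (C1.H p)"
  unfolding C1.H_def C2.H_def by (rule ns_transition[OF _ C1.smooth_S S_transition])

lemma ns_H_transition: "p \<in> W1 \<inter> W2 \<Longrightarrow> C2.ns C2.H p = J (y1 p) (C1.ns C1.H p)"
  by (rule ns_transition[OF _ C1.smooth_H H_transition])

end


section \<open>The spacetime metric\<close>

definition chart_domain :: "('a, 'n::finite) chart \<Rightarrow> (real^'n) set" where
  "chart_domain \<kappa> = snd \<kappa> ` fst \<kappa>"

definition chart_metric ::
    "(real \<Rightarrow> ('a, 'n::finite) metric) \<Rightarrow> ('a, 'n) chart \<Rightarrow> (real^'n) \<times> real \<Rightarrow> real^'n^'n" where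
  "chart_metric g \<kappa> p = g (snd p) \<kappa> (fst p)"

definition curve_domain :: "real \<Rightarrow> (real \<Rightarrow> real \<Rightarrow> 'a) \<Rightarrow> ('a, 'n::finite) chart \<Rightarrow> (real \<times> real) set" where
  "curve_domain T c \<kappa> = {p. snd p \<in> {0..T} \<and> c (fst p) (snd p) \<in> fst \<kappa>}"

definition curve_coord :: "(real \<Rightarrow> real \<Rightarrow> 'a) \<Rightarrow> ('a, 'n::finite) chart \<Rightarrow> real \<times> real \<Rightarrow> real^'n" where
  "curve_coord c \<kappa> p = snd \<kappa> (c (fst p) (snd p))"

lemma spacetime_nth [simp]: "spacetime v r $ Some i = v $ i" "spacetime v r $ None = r"
  by (simp_all add: spacetime_def)

lemma space_part_spacetime [simp]: "space_part (spacetime v r) = v"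
  by (simp add: space_part_def)

lemma sum_option: "(\<Sum>a\<in>(UNIV :: 'n::finite option set). f a) = f None + (\<Sum>i\<in>UNIV. f (Some i))"
  by (simp add: UNIV_option_conv sum.reindex)

lemma spacetime_axis_Some: "spacetime z t + h *\<^sub>R axis (Some i) 1 = spacetime (z + h *\<^sub>R axis i 1) t"
  by (simp add: vec_eq_iff spacetime_def axis_def split: option.split)

lemma spacetime_axis_None: "spacetime z t + h *\<^sub>R axis None 1 = spacetime z (t + h)"
  by (simp add: vec_eq_iff spacetime_def axis_def split: option.split)

lemma spacetime_linear:
  "spacetime u a + spacetime v b = spacetime (u + v) (a + b)"
  "spacetime u a - spacetime v b = spacetime (u - v) (a - b)"
  "k *\<^sub>R spacetime u a = spacetime (k *\<^sub>R u) (k * a)"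
  by (simp_all add: vec_eq_iff spacetime_def split: option.split)

lemma has_vector_derivative_spacetime:
  fixes f :: "real \<Rightarrow> real^'n::finite"
  assumes "(f has_vector_derivative f') F"
  shows "((\<lambda>\<xi>. spacetime (f \<xi>) r) has_vector_derivative spacetime f' 0) F"
proof -
  have "linear (\<lambda>v. spacetime v 0 :: real^('n option))"
    by (simp add: linear_iff spacetime_linear)
  then have "bounded_linear (\<lambda>v. spacetime v 0 :: real^('n option))"
    by (simp add: linear_conv_bounded_linear)
  from bounded_linear.has_vector_derivative[OF this assms]
  have "((\<lambda>\<xi>. spacetime (f \<xi>) 0 + spacetime 0 r) has_vector_derivative spacetime f' 0 + 0) F"
    by (intro has_vector_derivative_add has_vector_derivative_const)
  then show ?thesis by (simp add: spacetime_linear)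
qed

lemma spacetime_metric_nth:
  "spacetime_metric g \<kappa> (spacetime z t) $ Some i $ Some j = g t \<kappa> z $ i $ j"
  "spacetime_metric g \<kappa> w $ Some i $ None = 0"
  "spacetime_metric g \<kappa> w $ None $ Some j = 0"
  "spacetime_metric g \<kappa> w $ None $ None = 1"
  by (simp_all add: spacetime_metric_def)

lemma metric_inner_spacetime:
  "metric_inner (spacetime_metric g \<kappa> (spacetime z t)) (spacetime u a) (spacetime v b) =
    metric_inner (g t \<kappa> z) u v + a * b"
  by (simp add: metric_inner_def sum_option spacetime_metric_nth)

lemma matrix_inv_eqI:
  fixes B C :: "real^'n::finite^'n"
  assumes "B ** C = mat 1" "C ** B = mat 1"
  shows "matrix_inv B = C"
proof -
  have inv: "invertible B" using assms invertible_def by blast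
  have "matrix_inv B = matrix_inv B ** (B ** C)" using assms by simp
  also have "\<dots> = C" using matrix_inv_inverse(2)[OF inv] by (simp add: matrix_mul_assoc)
  finally show ?thesis .
qed

text \<open>The metric is block diagonal with a unit block for time, and so is its inverse; this
  keeps space and time apart in the Christoffel symbols.\<close>

lemma matrix_inv_spacetime_metric:
  fixes \<kappa> :: "('a, 'n::finite) chart"
  assumes "invertible (g t \<kappa> z)"
  shows "matrix_inv (spacetime_metric g \<kappa> (spacetime z t)) = (\<chi> a b. case (a, b) of
       (Some i, Some j) \<Rightarrow> matrix_inv (g t \<kappa> z) $ i $ j
     | (None, None) \<Rightarrow> 1
     | _ \<Rightarrow> 0)" (is "_ = ?C")
proof (rule matrix_inv_eqI)
  have 1: "(\<Sum>k\<in>UNIV. g t \<kappa> z $ i $ k * matrix_inv (g t \<kappa> z) $ k $ j) = (if i = j then 1 else 0)" for i j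
    using arg_cong[OF matrix_inv_inverse(1)[OF assms], of "\<lambda>C. C $ i $ j"]
    by (simp add: matrix_matrix_mult_def mat_def)
  have 2: "(\<Sum>k\<in>UNIV. matrix_inv (g t \<kappa> z) $ i $ k * g t \<kappa> z $ k $ j) = (if i = j then 1 else 0)" for i j
    using arg_cong[OF matrix_inv_inverse(2)[OF assms], of "\<lambda>C. C $ i $ j"]
    by (simp add: matrix_matrix_mult_def mat_def)
  have "(spacetime_metric g \<kappa> (spacetime z t) ** ?C) $ a $ b = (mat 1 :: real^('n option)^('n option)) $ a $ b" for a b
    by (cases a; cases b) (simp_all add: matrix_matrix_mult_def mat_def sum_option spacetime_metric_nth 1)
  then show "spacetime_metric g \<kappa> (spacetime z t) ** ?C = mat 1" by (simp add: vec_eq_iff)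
  have "(?C ** spacetime_metric g \<kappa> (spacetime z t)) $ a $ b = (mat 1 :: real^('n option)^('n option)) $ a $ b" for a b
    by (cases a; cases b) (simp_all add: matrix_matrix_mult_def mat_def sum_option spacetime_metric_nth 2)
  then show "?C ** spacetime_metric g \<kappa> (spacetime z t) = mat 1" by (simp add: vec_eq_iff)
qed

section \<open>Charts of a manifold with a Ricci flow\<close>

locale ricci_charts =
  fixes M :: "'a topology" and A :: "('a, 'n::finite) chart set" and T :: real
    and g :: "real \<Rightarrow> ('a, 'n) metric"
  assumes manifold: "smooth_manifold M A" and T_pos: "0 < T" and flow: "ricci_flow A T g"
begin

lemma chart_open: "\<kappa> \<in> A \<Longrightarrow> openin M (fst \<kappa>)" "\<kappa> \<in> A \<Longrightarrow> open (chart_domain \<kappa>)"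
  using manifold by (auto simp: smooth_manifold_def chart_domain_def)

lemma chart_homeomorphic:
  "\<kappa> \<in> A \<Longrightarrow> homeomorphic_map (subtopology M (fst \<kappa>)) (top_of_set (chart_domain \<kappa>)) (snd \<kappa>)"
  using manifold by (auto simp: smooth_manifold_def chart_domain_def)

lemma topspace_chart: "\<kappa> \<in> A \<Longrightarrow> topspace (subtopology M (fst \<kappa>)) = fst \<kappa>"
  by (simp add: Int_absorb1 openin_subset chart_open(1))

lemma chart_inj: "\<kappa> \<in> A \<Longrightarrow> inj_on (snd \<kappa>) (fst \<kappa>)"
  using homeomorphic_imp_injective_map[OF chart_homeomorphic] topspace_chart by metis

lemma transition_eq: "\<kappa> \<in> A \<Longrightarrow> p \<in> fst \<kappa> \<Longrightarrow> transition \<kappa> \<mu> (snd \<kappa> p) = snd \<mu> p"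
  unfolding transition_def by (simp add: inv_into_f_f[OF chart_inj])

lemma metric_familyI:
  assumes \<kappa>: "\<kappa> \<in> A"
  shows "metric_family T (chart_domain \<kappa>) (chart_metric g \<kappa>)"
proof
  show "0 < T" by (rule T_pos)
  show "open (chart_domain \<kappa>)" by (rule chart_open(2)[OF \<kappa>])
  have "smooth_on (chart_domain \<kappa> \<times> {0..T}) (\<lambda>(y, t). g t \<kappa> y)"
    using flow \<kappa> unfolding ricci_flow_def chart_domain_def by blast
  moreover have "(\<lambda>(y, t). g t \<kappa> y) = chart_metric g \<kappa>" by (auto simp: chart_metric_def)
  ultimately show "smooth_on (chart_domain \<kappa> \<times> {0..T}) (chart_metric g \<kappa>)" by simp
  fix p v assume p: "p \<in> chart_domain \<kappa> \<times> {0..T}"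
  have "snd p \<in> {0..T}" using p by auto
  then have "riemannian_metric A (g (snd p))" using flow unfolding ricci_flow_def by blast
  then have "\<forall>y \<in> snd \<kappa> ` fst \<kappa>. transpose (g (snd p) \<kappa> y) = g (snd p) \<kappa> y \<and>
      (\<forall>v. v \<noteq> 0 \<longrightarrow> metric_inner (g (snd p) \<kappa> y) v v > 0)"
    using \<kappa> unfolding riemannian_metric_def by blast
  moreover have "fst p \<in> snd \<kappa> ` fst \<kappa>" using p by (auto simp: chart_domain_def)
  ultimately show "transpose (chart_metric g \<kappa> p) = chart_metric g \<kappa> p"
    and "v \<noteq> 0 \<Longrightarrow> 0 < metric_inner (chart_metric g \<kappa> p) v v"
    unfolding chart_metric_def by blast+
qed

lemma metric_transitionI:
  assumes \<kappa>: "\<kappa> \<in> A" and \<mu>: "\<mu> \<in> A"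
  shows "metric_transition T (chart_domain \<kappa>) (chart_domain \<mu>) (chart_metric g \<kappa>) (chart_metric g \<mu>)
    (snd \<kappa> ` (fst \<kappa> \<inter> fst \<mu>)) (transition \<kappa> \<mu>)"
proof -
  interpret M1: metric_family T "chart_domain \<kappa>" "chart_metric g \<kappa>" by (rule metric_familyI[OF \<kappa>])
  interpret M2: metric_family T "chart_domain \<mu>" "chart_metric g \<mu>" by (rule metric_familyI[OF \<mu>])
  show ?thesis
  proof
    \<comment> \<open>The chart is an open map onto its image, and that image is open in the
      coordinate space.\<close>
    have "openin (subtopology M (fst \<kappa>)) (fst \<kappa> \<inter> fst \<mu>)"
      using chart_open(1)[OF \<mu>] by (rule openin_subtopology_Int2)
    then have "openin (top_of_set (chart_domain \<kappa>)) (snd \<kappa> ` (fst \<kappa> \<inter> fst \<mu>))"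
      using homeomorphic_imp_open_map[OF chart_homeomorphic[OF \<kappa>]] unfolding open_map_def by blast
    then show "open (snd \<kappa> ` (fst \<kappa> \<inter> fst \<mu>))"
      using openin_open_eq[OF chart_open(2)[OF \<kappa>]] by blast
    show "snd \<kappa> ` (fst \<kappa> \<inter> fst \<mu>) \<subseteq> chart_domain \<kappa>" by (auto simp: chart_domain_def)
    show "smooth_on (snd \<kappa> ` (fst \<kappa> \<inter> fst \<mu>)) (transition \<kappa> \<mu>)"
      using manifold \<kappa> \<mu> unfolding smooth_manifold_def by blast
    fix z assume "z \<in> snd \<kappa> ` (fst \<kappa> \<inter> fst \<mu>)"
    then obtain p where p: "z = snd \<kappa> p" "p \<in> fst \<kappa>" "p \<in> fst \<mu>" by auto
    show "transition \<kappa> \<mu> z \<in> chart_domain \<mu>"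
      using p transition_eq[OF \<kappa>] by (auto simp: chart_domain_def)
    fix t v w assume "t \<in> {0..T}"
    then have "riemannian_metric A (g t)" using flow unfolding ricci_flow_def by blast
    then have "metric_inner (g t \<kappa> (snd \<kappa> p)) v w =
        metric_inner (g t \<mu> (snd \<mu> p)) (frechet_derivative (transition \<kappa> \<mu>) (at (snd \<kappa> p)) v)
          (frechet_derivative (transition \<kappa> \<mu>) (at (snd \<kappa> p)) w)"
      using p \<kappa> \<mu> unfolding riemannian_metric_def by blast
    then show "metric_inner (chart_metric g \<kappa> (z, t)) v w =
        metric_inner (chart_metric g \<mu> (transition \<kappa> \<mu> z, t)) (frechet_derivative (transition \<kappa> \<mu>) (at z) v)
         (frechet_derivative (transition \<kappa> \<mu>) (at z) w)"
      by (simp add: p transition_eq[OF \<kappa>] chart_metric_def)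
  qed
qed

text \<open>Off the spatial block the metric is constant, so only derivatives of that block survive.
  Up to sign convention, the components with upper time index form the second fundamental form of
  the time slices. Spatial lower indices suffice, since the velocity of
  \<open>x \<mapsto> (c x t, t)\<close> and \<open>H\<close> are both horizontal.\<close>

lemma christoffel_spacetime:
  assumes \<kappa>: "\<kappa> \<in> A" and p: "(z, t) \<in> chart_domain \<kappa> \<times> {0..T}"
  shows "christoffel (spacetime_domain T \<kappa>) (spacetime_metric g \<kappa>) (spacetime z t) (Some l) (Some i) (Some j) =
      metric_family.Gam (chart_domain \<kappa>) (chart_metric g \<kappa>) (z, t) $ l $ i $ j" (is ?A)
    and "christoffel (spacetime_domain T \<kappa>) (spacetime_metric g \<kappa>) (spacetime z t) None (Some i) (Some j) =
      - pt T (chart_metric g \<kappa>) (z, t) $ i $ j / 2" (is ?B)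
proof -
  interpret metric_family T "chart_domain \<kappa>" "chart_metric g \<kappa>" by (rule metric_familyI[OF \<kappa>])
  have dom: "spacetime w r \<in> spacetime_domain T \<kappa> \<longleftrightarrow> w \<in> chart_domain \<kappa> \<and> r \<in> {0..T}" for w r
    by (simp add: spacetime_domain_def chart_domain_def)
  let ?pd = "partial_deriv (spacetime_domain T \<kappa>)"
  \<comment> \<open>In the time direction even the derivative of a constant is taken within
    \<open>[-t, T - t]\<close>; it is well defined at the ends because \<open>0 < T\<close>.\<close>
  have const: "?pd (\<lambda>w. r) a (spacetime z t) = 0" for r a
  proof (cases a)
    case None
    have "{h. t + h \<in> {0..T}} = {-t..T-t}" by auto
    then show ?thesis
      using vector_derivative_within_cbox[of "-t" "T-t" 0 "\<lambda>_. r" 0] p T_pos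
      by (simp add: partial_deriv_def None spacetime_axis_None dom)
  next
    case (Some i)
    have "open {h. z + h *\<^sub>R axis i 1 \<in> chart_domain \<kappa>}"
      using open_vimage[OF V_open, of "\<lambda>h. z + h *\<^sub>R axis i 1"]
      by (simp add: vimage_def continuous_on_add continuous_on_scaleR continuous_on_id continuous_on_const)
    then have "at 0 within {h. z + h *\<^sub>R axis i 1 \<in> chart_domain \<kappa>} = at 0"
      using p by (intro at_within_open) auto
    then show ?thesis
      using p by (simp add: partial_deriv_def Some spacetime_axis_Some dom)
  qed
  have space: "?pd (\<lambda>w. spacetime_metric g \<kappa> w $ Some a $ Some b) (Some k) (spacetime z t) =
      pz k (chart_metric g \<kappa>) (z, t) $ a $ b" for a b k
  proof -
    have "?pd (\<lambda>w. spacetime_metric g \<kappa> w $ Some a $ Some b) (Some k) (spacetime z t) =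
        partial_deriv (chart_domain \<kappa>) (\<lambda>z. chart_metric g \<kappa> (z, t) $ a $ b) k z"
      using p by (simp add: partial_deriv_def spacetime_axis_Some dom spacetime_metric_nth chart_metric_def)
    then show ?thesis
      using partial_deriv_eq_pz[of z "\<lambda>p. chart_metric g \<kappa> p $ a $ b" t k] pz_nth_nth[OF smooth_G p] p by simp
  qed
  have time: "?pd (\<lambda>w. spacetime_metric g \<kappa> w $ Some a $ Some b) None (spacetime z t) =
      pt T (chart_metric g \<kappa>) (z, t) $ a $ b" for a b
  proof -
    \<comment> \<open>\<open>partial_deriv\<close> differentiates at 0 in the increment,
      \<open>pt\<close> at \<open>t\<close> in the time itself; a shift by \<open>t\<close>
      identifies them, also at the ends.\<close>
    have I: "{h. t + h \<in> {0..T}} = {-t..T-t}" by auto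
    have 1: "((\<lambda>h. t + h) has_vector_derivative 1) (at 0 within {-t..T-t})"
      by (auto intro!: derivative_eq_intros simp: has_vector_derivative_def)
    have "((\<lambda>s. chart_metric g \<kappa> (z, s) $ a $ b) has_vector_derivative
        pt T (chart_metric g \<kappa>) (z, t) $ a $ b) (at (t + 0) within (\<lambda>h. t + h) ` {-t..T-t})"
      using bounded_linear.has_vector_derivative[OF bounded_linear_vec_nth[of b]
        bounded_linear.has_vector_derivative[OF bounded_linear_vec_nth[of a] has_pt[OF smooth_G p]]]
      by (simp add: image_add_atLeastAtMost)
    from vector_diff_chain_within[OF 1 this]
    have "((\<lambda>h. chart_metric g \<kappa> (z, t + h) $ a $ b) has_vector_derivative
        pt T (chart_metric g \<kappa>) (z, t) $ a $ b) (at 0 within {-t..T-t})"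
      by (simp add: o_def)
    then have "vector_derivative (\<lambda>h. chart_metric g \<kappa> (z, t + h) $ a $ b) (at 0 within {-t..T-t}) =
        pt T (chart_metric g \<kappa>) (z, t) $ a $ b"
      using vector_derivative_within_cbox[of "-t" "T-t" 0] p T_pos by simp
    then show ?thesis
      using p I by (simp add: partial_deriv_def spacetime_axis_None dom spacetime_metric_nth chart_metric_def)
  qed
  have inv: "invertible (g t \<kappa> z)"
    using G_invertible[OF p] by (simp add: chart_metric_def)
  show ?A
    unfolding christoffel_def matrix_inv_spacetime_metric[of g t \<kappa> z, OF inv] sum_option Gam_nth[OF p]
    by (simp add: space chart_metric_def)
  show ?B
    unfolding christoffel_def matrix_inv_spacetime_metric[of g t \<kappa> z, OF inv] sum_option
    by (simp add: const time spacetime_metric_nth)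
qed

end


section \<open>Curve-shrinking flows in charts\<close>

locale flow_curve = ricci_charts +
  fixes c :: "real \<Rightarrow> real \<Rightarrow> 'a"
  assumes csf: "curve_shrinking_flow M A T g c"
begin

lemma family: "smooth_immersed_family M A T c"
  using csf by (simp add: curve_shrinking_flow_def)

lemma mem_curve_domain: "(x, t) \<in> curve_domain T c \<kappa> \<longleftrightarrow> t \<in> {0..T} \<and> c x t \<in> fst \<kappa>"
  by (simp add: curve_domain_def)

lemma stripI:
  assumes \<kappa>: "\<kappa> \<in> A"
  shows "strip T (curve_domain T c \<kappa>)"
proof
  show "0 < T" by (rule T_pos)
  have cont: "continuous_map (top_of_set (UNIV \<times> {0..T})) M (\<lambda>(x, t). c x t)"
    using family unfolding smooth_immersed_family_def by blast
  have "openin (top_of_set (UNIV \<times> {0..T}))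
      {p \<in> topspace (top_of_set (UNIV \<times> {0..T})). (\<lambda>(x, t). c x t) p \<in> fst \<kappa>}"
    by (rule openin_continuous_map_preimage[OF cont chart_open(1)[OF \<kappa>]])
  also have "{p \<in> topspace (top_of_set (UNIV \<times> {0..T})). (\<lambda>(x, t). c x t) p \<in> fst \<kappa>} = curve_domain T c \<kappa>"
    by (auto simp: curve_domain_def)
  finally show "openin (top_of_set (UNIV \<times> {0..T})) (curve_domain T c \<kappa>)" .
qed

lemma chart_curveI:
  assumes \<kappa>: "\<kappa> \<in> A"
  shows "chart_curve T (curve_domain T c \<kappa>) (chart_domain \<kappa>) (chart_metric g \<kappa>) (curve_coord c \<kappa>)"
proof -
  interpret strip T "curve_domain T c \<kappa>" by (rule stripI[OF \<kappa>])
  interpret metric_family T "chart_domain \<kappa>" "chart_metric g \<kappa>" by (rule metric_familyI[OF \<kappa>])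
  show ?thesis
  proof
    have "smooth_on {(x, t). t \<in> {0..T} \<and> c x t \<in> fst \<kappa>} (\<lambda>(x, t). snd \<kappa> (c x t))"
      using family \<kappa> unfolding smooth_immersed_family_def by blast
    moreover have "{(x, t). t \<in> {0..T} \<and> c x t \<in> fst \<kappa>} = curve_domain T c \<kappa>"
      by (auto simp: curve_domain_def)
    moreover have "(\<lambda>(x, t). snd \<kappa> (c x t)) = curve_coord c \<kappa>"
      by (auto simp: curve_coord_def)
    ultimately show "smooth_on (curve_domain T c \<kappa>) (curve_coord c \<kappa>)" by simp
    fix p assume p: "p \<in> curve_domain T c \<kappa>"
    then show "curve_coord c \<kappa> p \<in> chart_domain \<kappa>"
      by (simp add: curve_domain_def curve_coord_def chart_domain_def)
    have "snd p \<in> {0..T}" "c (fst p) (snd p) \<in> fst \<kappa>" using p by (auto simp: curve_domain_def)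
    then have "vector_derivative (\<lambda>\<xi>. snd \<kappa> (c \<xi> (snd p))) (at (fst p)) \<noteq> 0"
      using family \<kappa> unfolding smooth_immersed_family_def by blast
    then show "px (curve_coord c \<kappa>) p \<noteq> 0"
      by (simp add: px_def curve_coord_def)
  qed
qed

text \<open>Both sides unfold to the same expressions for all \<open>x\<close> and \<open>t\<close>,
  also where the curve is outside the chart. The identities can thus be used as equations between
  functions under derivatives in \<open>\<xi>\<close>.\<close>

lemma chart_quantities:
  assumes \<kappa>: "\<kappa> \<in> A"
  defines "B \<equiv> \<lambda>p. chart_metric g \<kappa> (curve_coord c \<kappa> p, snd p)"
    and "\<Gamma> \<equiv> \<lambda>p. metric_family.Gam (chart_domain \<kappa>) (chart_metric g \<kappa>) (curve_coord c \<kappa> p, snd p)"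
  shows "speed (g t \<kappa>) (\<lambda>\<xi>. snd \<kappa> (c \<xi> t)) x = chart_flow.sp (curve_coord c \<kappa>) B (x, t)"
    and "unit_S g c \<kappa> x t = chart_flow.S (curve_coord c \<kappa>) B (x, t)"
    and "curvature_vector g c \<kappa> x t = chart_flow.H (curve_coord c \<kappa>) B \<Gamma> (x, t)"
proof -
  interpret chart_curve T "curve_domain T c \<kappa>" "chart_domain \<kappa>" "chart_metric g \<kappa>" "curve_coord c \<kappa>"
    by (rule chart_curveI[OF \<kappa>])
  have sp: "speed (g t \<kappa>) (\<lambda>\<xi>. snd \<kappa> (c \<xi> t)) x = sp (x, t)" for x
    unfolding speed_def sp_def ip_def by (simp add: px_def curve_coord_def chart_metric_def)
  have S: "unit_S g c \<kappa> x t = S (x, t)" for x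
    unfolding unit_S_def unit_tangent_def S_def sp by (simp add: px_def curve_coord_def)
  have H: "curvature_vector g c \<kappa> x t = H (x, t)"
    unfolding curvature_vector_def nabla_S_def sp S unfolding H_def unfolding ns_def Dx_def
    unfolding con_def cyl.Gam_def
    by (simp add: px_def curve_coord_def chart_metric_def chart_domain_def)
  show "speed (g t \<kappa>) (\<lambda>\<xi>. snd \<kappa> (c \<xi> t)) x = chart_flow.sp (curve_coord c \<kappa>) B (x, t)"
    using sp by (simp add: B_def)
  show "unit_S g c \<kappa> x t = chart_flow.S (curve_coord c \<kappa>) B (x, t)"
    using S by (simp add: B_def)
  show "curvature_vector g c \<kappa> x t = chart_flow.H (curve_coord c \<kappa>) B \<Gamma> (x, t)"
    using H by (simp add: B_def \<Gamma>_def)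
qed

lemma chart_curve_shrinkingI:
  assumes \<kappa>: "\<kappa> \<in> A"
  shows "chart_curve_shrinking T (curve_domain T c \<kappa>) (chart_domain \<kappa>) (chart_metric g \<kappa>) (curve_coord c \<kappa>)"
proof -
  interpret chart_curve T "curve_domain T c \<kappa>" "chart_domain \<kappa>" "chart_metric g \<kappa>" "curve_coord c \<kappa>"
    by (rule chart_curveI[OF \<kappa>])
  show ?thesis
  proof
    fix p assume p: "p \<in> curve_domain T c \<kappa>"
    then have "((\<lambda>s. snd \<kappa> (c (fst p) s)) has_vector_derivative curvature_vector g c \<kappa> (fst p) (snd p))
        (at (snd p) within {0..T})"
      using csf \<kappa> unfolding curve_shrinking_flow_def curve_domain_def by blast
    then show "pt T (curve_coord c \<kappa>) p = H p"
      using pt_eqI[OF p, of "curve_coord c \<kappa>"] by (simp add: curve_coord_def chart_quantities[OF \<kappa>])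
  qed
qed

lemma curve_transitionI:
  assumes \<kappa>: "\<kappa> \<in> A" and \<mu>: "\<mu> \<in> A"
  shows "curve_transition T (chart_domain \<kappa>) (chart_domain \<mu>) (chart_metric g \<kappa>) (chart_metric g \<mu>)
    (snd \<kappa> ` (fst \<kappa> \<inter> fst \<mu>)) (transition \<kappa> \<mu>)
    (curve_domain T c \<kappa>) (curve_domain T c \<mu>) (curve_coord c \<kappa>) (curve_coord c \<mu>)"
proof -
  interpret metric_transition T "chart_domain \<kappa>" "chart_domain \<mu>" "chart_metric g \<kappa>" "chart_metric g \<mu>"
    "snd \<kappa> ` (fst \<kappa> \<inter> fst \<mu>)" "transition \<kappa> \<mu>" by (rule metric_transitionI[OF assms])
  interpret C1: chart_curve T "curve_domain T c \<kappa>" "chart_domain \<kappa>" "chart_metric g \<kappa>" "curve_coord c \<kappa>"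
    by (rule chart_curveI[OF \<kappa>])
  interpret C2: chart_curve T "curve_domain T c \<mu>" "chart_domain \<mu>" "chart_metric g \<mu>" "curve_coord c \<mu>"
    by (rule chart_curveI[OF \<mu>])
  show ?thesis
    by unfold_locales (auto simp: curve_domain_def curve_coord_def transition_eq[OF \<kappa>])
qed

lemma chart_at:
  assumes "t \<in> {0..T}"
  shows "chart_at A (c x t) \<in> A" "c x t \<in> fst (chart_at A (c x t))"
proof -
  have "continuous_map (top_of_set (UNIV \<times> {0..T})) M (\<lambda>(x, t). c x t)"
    using family unfolding smooth_immersed_family_def by blast
  then have "c x t \<in> topspace M"
    using assms by (auto simp: continuous_map_def Pi_iff)
  then have "\<exists>\<kappa>. \<kappa> \<in> A \<and> c x t \<in> fst \<kappa>"
    using manifold unfolding smooth_manifold_def by blast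
  from someI_ex[OF this] show "chart_at A (c x t) \<in> A" "c x t \<in> fst (chart_at A (c x t))"
    unfolding chart_at_def by blast+
qed

text \<open>By \<open>ip_ns_H_S\<close> the normal part has the horizontal component
  \<open>ns H + k^2 S\<close> with \<open>k^2 = ip H H\<close>, whose squared length is
  \<open>ip (ns H) (ns H) - k^4\<close>. The vertical component, produced by the Christoffel symbols
  with upper time index, is orthogonal to it and to \<open>S\<close> and contributes the last
  square.\<close>

lemma normal_nabla_S_H_sq_in_chart:
  assumes \<kappa>: "\<kappa> \<in> A" and xt: "(x, t) \<in> curve_domain T c \<kappa>"
  defines "B \<equiv> \<lambda>p. chart_metric g \<kappa> (curve_coord c \<kappa> p, snd p)"
    and "\<Gamma> \<equiv> \<lambda>p. metric_family.Gam (chart_domain \<kappa>) (chart_metric g \<kappa>) (curve_coord c \<kappa> p, snd p)"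
  defines "G \<equiv> spacetime_metric g \<kappa>" and "\<gamma> \<equiv> (\<lambda>\<xi>. spacetime (snd \<kappa> (c \<xi> t)) t)"
  defines "N \<equiv> normal_part (G (\<gamma> x)) (unit_tangent G \<gamma> x)
                (nabla_S (spacetime_domain T \<kappa>) G \<gamma>
                  (\<lambda>\<xi>. horizontal (curvature_vector g c \<kappa> \<xi> t)) x)"
  shows "metric_inner (G (\<gamma> x)) N N =
    chart_flow.ip B (chart_flow.ns (curve_coord c \<kappa>) B \<Gamma> (chart_flow.H (curve_coord c \<kappa>) B \<Gamma>))
      (chart_flow.ns (curve_coord c \<kappa>) B \<Gamma> (chart_flow.H (curve_coord c \<kappa>) B \<Gamma>)) (x, t)
    - (chart_flow.ip B (chart_flow.H (curve_coord c \<kappa>) B \<Gamma>) (chart_flow.H (curve_coord c \<kappa>) B \<Gamma>) (x, t))\<^sup>2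
    + (metric_inner (pt T (chart_metric g \<kappa>) (curve_coord c \<kappa> (x, t), t))
        (chart_flow.S (curve_coord c \<kappa>) B (x, t)) (chart_flow.H (curve_coord c \<kappa>) B \<Gamma> (x, t)))\<^sup>2 / 4"
proof -
  interpret K: chart_curve T "curve_domain T c \<kappa>" "chart_domain \<kappa>" "chart_metric g \<kappa>" "curve_coord c \<kappa>"
    by (rule chart_curveI[OF \<kappa>])
  define p where "p = (x, t)"
  have p: "p \<in> curve_domain T c \<kappa>" using xt p_def by simp
  define z where "z = curve_coord c \<kappa> p"
  have zt: "(z, t) \<in> chart_domain \<kappa> \<times> {0..T}" using K.along_in[OF p] by (simp add: z_def p_def)
  have \<gamma>x: "\<gamma> x = spacetime z t" by (simp add: \<gamma>_def z_def p_def curve_coord_def)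
  have d\<gamma>: "vector_derivative \<gamma> (at x) = spacetime (px (curve_coord c \<kappa>) p) 0"
    using K.has_px[OF K.y_smooth p] has_vector_derivative_spacetime[of "\<lambda>\<xi>. snd \<kappa> (c \<xi> t)" _ "at x" t]
    by (intro vector_derivative_at) (simp add: \<gamma>_def p_def curve_coord_def)
  have gip: "metric_inner (G (\<gamma> x)) (spacetime u a) (spacetime v b) =
      metric_inner (chart_metric g \<kappa> (z, t)) u v + a * b" for u v a b
    unfolding G_def \<gamma>x metric_inner_spacetime by (simp add: chart_metric_def)
  have Bp: "B p = chart_metric g \<kappa> (z, t)" by (simp add: B_def z_def p_def)
  have sp: "speed G \<gamma> x = K.sp p"
    unfolding speed_def d\<gamma> gip K.sp_def K.ip_def by (simp add: z_def p_def)
  have S: "unit_tangent G \<gamma> x = spacetime (K.S p) 0"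
    unfolding unit_tangent_def sp d\<gamma> by (simp add: K.S_def spacetime_linear)
  have dH: "vector_derivative (\<lambda>\<xi>. horizontal (curvature_vector g c \<kappa> \<xi> t)) (at x) = spacetime (px K.H p) 0"
    using K.has_px[OF K.smooth_H p] has_vector_derivative_spacetime[of "\<lambda>\<xi>. K.H (\<xi>, t)" _ "at x" 0]
    by (intro vector_derivative_at) (simp add: p_def chart_quantities[OF \<kappa>])
  let ?chr = "christoffel (spacetime_domain T \<kappa>) G (\<gamma> x)"
  \<comment> \<open>The time component of the connection term, still with the full velocity;
    division by the speed turns it into \<open>- m / 2\<close>.\<close>
  define r where "r = - metric_inner (pt T (chart_metric g \<kappa>) (z, t)) (px (curve_coord c \<kappa>) p) (K.H p) / 2"
  have con: "(\<chi> l. \<Sum>i\<in>UNIV. \<Sum>j\<in>UNIV. ?chr l i j * vector_derivative \<gamma> (at x) $ i *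
      horizontal (curvature_vector g c \<kappa> x t) $ j) =
    spacetime (con (K.cyl.Gam (z, t)) (px (curve_coord c \<kappa>) p) (K.H p)) r"
  proof -
    have "(\<Sum>i\<in>UNIV. \<Sum>j\<in>UNIV. ?chr l i j * vector_derivative \<gamma> (at x) $ i *
      horizontal (curvature_vector g c \<kappa> x t) $ j) =
      spacetime (con (K.cyl.Gam (z, t)) (px (curve_coord c \<kappa>) p) (K.H p)) r $ l" for l
    proof (cases l)
      case None
      then show ?thesis
        unfolding d\<gamma> chart_quantities[OF \<kappa>] sum_option G_def \<gamma>x
        by (simp add: christoffel_spacetime(2)[OF \<kappa> zt] r_def metric_inner_def p_def
            sum_divide_distrib flip: sum_negf)
    next
      case (Some i)
      then show ?thesis
        unfolding d\<gamma> chart_quantities[OF \<kappa>] sum_option G_def \<gamma>x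
        by (simp add: christoffel_spacetime(1)[OF \<kappa> zt] con_def p_def)
    qed
    then show ?thesis by (simp add: vec_eq_iff)
  qed
  define m where "m = metric_inner (pt T (chart_metric g \<kappa>) (z, t)) (K.S p) (K.H p)"
  have r: "r / K.sp p = - m / 2"
    using K.sp_pos[OF p] unfolding r_def m_def K.px_y_eq[OF p] by (simp add: metric_inner_linear)
  have nabla: "nabla_S (spacetime_domain T \<kappa>) G \<gamma> (\<lambda>\<xi>. horizontal (curvature_vector g c \<kappa> \<xi> t)) x =
      spacetime (K.ns K.H p) (- m / 2)"
    unfolding nabla_S_def con dH sp spacetime_linear K.ns_def K.Dx_def r[symmetric]
    by (simp add: z_def p_def divide_inverse mult.commute)
  have "N = spacetime (K.ns K.H p + K.ip K.H K.H p *\<^sub>R K.S p) (- m / 2)"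
    using K.ip_ns_H_S[OF p]
    unfolding N_def normal_part_def nabla S gip
    by (simp add: spacetime_linear K.ip_def z_def p_def)
  then have "metric_inner (G (\<gamma> x)) N N = metric_inner (chart_metric g \<kappa> (z, t)) (K.ns K.H p + K.ip K.H K.H p *\<^sub>R K.S p)
      (K.ns K.H p + K.ip K.H K.H p *\<^sub>R K.S p) + m\<^sup>2 / 4"
    by (simp add: gip power2_eq_square)
  also have "metric_inner (chart_metric g \<kappa> (z, t)) (K.ns K.H p + K.ip K.H K.H p *\<^sub>R K.S p)
      (K.ns K.H p + K.ip K.H K.H p *\<^sub>R K.S p) =
      K.ip (K.ns K.H) (K.ns K.H) p + 2 * K.ip K.H K.H p * K.ip (K.ns K.H) K.S p + (K.ip K.H K.H p)\<^sup>2 * K.ip K.S K.S p"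
    using K.ip_commute[OF p, of "K.ns K.H" K.S]
    by (simp add: K.ip_def z_def p_def metric_inner_linear power2_eq_square algebra_simps)
  finally show ?thesis
    unfolding K.ip_ns_H_S[OF p] K.ip_S_S[OF p]
    by (simp add: m_def z_def p_def B_def \<Gamma>_def power2_eq_square)
qed

end


section \<open>The differential inequality\<close>

context flow_curve
begin

lemma speed_invariant:
  assumes \<kappa>: "\<kappa> \<in> A" and \<mu>: "\<mu> \<in> A" and p: "(x, t) \<in> curve_domain T c \<kappa>" "(x, t) \<in> curve_domain T c \<mu>"
  shows "speed (g t \<mu>) (\<lambda>\<xi>. snd \<mu> (c \<xi> t)) x = speed (g t \<kappa>) (\<lambda>\<xi>. snd \<kappa> (c \<xi> t)) x"
proof -
  interpret curve_transition T "chart_domain \<kappa>" "chart_domain \<mu>" "chart_metric g \<kappa>" "chart_metric g \<mu>"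
    "snd \<kappa> ` (fst \<kappa> \<inter> fst \<mu>)" "transition \<kappa> \<mu>" "curve_domain T c \<kappa>" "curve_domain T c \<mu>"
    "curve_coord c \<kappa>" "curve_coord c \<mu>"
    by (rule curve_transitionI[OF \<kappa> \<mu>])
  show ?thesis
    unfolding chart_quantities(1)[OF \<kappa>] chart_quantities(1)[OF \<mu>] by (rule sp_transition) (use p in auto)
qed

text \<open>Invariance under transitions replaces the chart chosen at each point by a single chart
  \<open>\<kappa>\<close> near \<open>(x, t)\<close>, which makes the curvature accessible to
  \<open>px\<close> and \<open>pt\<close>.\<close>

lemma curvature_in_chart:
  assumes \<kappa>: "\<kappa> \<in> A" and p: "(x, t) \<in> curve_domain T c \<kappa>"
  shows "curvature A g c x t = sqrt (metric_inner (g t \<kappa> (snd \<kappa> (c x t)))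
    (curvature_vector g c \<kappa> x t) (curvature_vector g c \<kappa> x t))"
proof -
  define \<mu> where "\<mu> = chart_at A (c x t)"
  have t: "t \<in> {0..T}" using p mem_curve_domain by blast
  have \<mu>: "\<mu> \<in> A" and p': "(x, t) \<in> curve_domain T c \<mu>"
    using chart_at[OF t, of x] t unfolding \<mu>_def mem_curve_domain by blast+
  interpret curve_transition T "chart_domain \<kappa>" "chart_domain \<mu>" "chart_metric g \<kappa>" "chart_metric g \<mu>"
    "snd \<kappa> ` (fst \<kappa> \<inter> fst \<mu>)" "transition \<kappa> \<mu>" "curve_domain T c \<kappa>" "curve_domain T c \<mu>"
    "curve_coord c \<kappa>" "curve_coord c \<mu>"
    by (rule curve_transitionI[OF \<kappa> \<mu>])
  have pp: "(x, t) \<in> curve_domain T c \<kappa> \<inter> curve_domain T c \<mu>" using p p' by simp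
  have "C2.ip C2.H C2.H (x, t) = C1.ip C1.H C1.H (x, t)"
    by (intro ip_transition H_transition pp)
  then show ?thesis
    unfolding curvature_def Let_def \<mu>_def[symmetric] chart_quantities(3)[OF \<kappa>] chart_quantities(3)[OF \<mu>]
      C1.ip_def C2.ip_def
    by (simp add: chart_metric_def curve_coord_def)
qed

lemma curvature_evolution:
  assumes \<kappa>: "\<kappa> \<in> A" and xt: "(x, t) \<in> curve_domain T c \<kappa>"
  shows "vector_derivative (\<lambda>s. (curvature A g c x s)\<^sup>2) (at t within {0..T}) =
    arclength_deriv A g c (arclength_deriv A g c (\<lambda>\<xi> s. (curvature A g c \<xi> s)\<^sup>2)) x t
    - 2 * normal_nabla_S_H_sq A T g c x t + 2 * (curvature A g c x t) ^ 4
    + metric_family.quad_err T (chart_domain \<kappa>) (chart_metric g \<kappa>) (curve_coord c \<kappa> (x, t), t)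
        (unit_S g c \<kappa> x t) (curvature_vector g c \<kappa> x t)
    + metric_family.lin_err T (chart_domain \<kappa>) (chart_metric g \<kappa>) (curve_coord c \<kappa> (x, t), t)
        (unit_S g c \<kappa> x t) (curvature_vector g c \<kappa> x t)"
proof -
  let ?W = "curve_domain T c \<kappa>"
  interpret K: chart_curve_shrinking T ?W "chart_domain \<kappa>" "chart_metric g \<kappa>" "curve_coord c \<kappa>"
    by (rule chart_curve_shrinkingI[OF \<kappa>])
  let ?k2 = "K.ip K.H K.H"
  have nonneg: "?k2 p \<ge> 0" if "p \<in> ?W" for p
    unfolding K.ip_def using K.B_pos[OF that, of "K.H p"]
    by (cases "K.H p = 0") (auto simp: metric_inner_linear)
  have curv: "curvature A g c (fst p) (snd p) = sqrt (?k2 p)" if "p \<in> ?W" for p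
    using curvature_in_chart[OF \<kappa>, of "fst p" "snd p"] that
    unfolding K.ip_def chart_quantities(3)[OF \<kappa>] by (simp add: chart_metric_def curve_coord_def)
  have curv2: "(curvature A g c (fst p) (snd p))\<^sup>2 = ?k2 p" if "p \<in> ?W" for p
    using curv[OF that] nonneg[OF that] by simp
  \<comment> \<open>The formula \<open>f\<close> represents \<open>F\<close> on \<open>?W\<close>
    only, but this contains an interval in \<open>x\<close> around each point, so the derivatives
    agree.\<close>
  have deriv: "deriv (\<lambda>\<xi>. F \<xi> (snd p)) (fst p) = px f p"
    if F: "\<And>q. q \<in> ?W \<Longrightarrow> F (fst q) (snd q) = f q" and f: "smooth_on ?W f" and p: "p \<in> ?W"
    for F :: "real \<Rightarrow> real \<Rightarrow> real" and f p
  proof -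
    have "deriv (\<lambda>\<xi>. F \<xi> (snd p)) (fst p) = deriv (\<lambda>\<xi>. f (\<xi>, snd p)) (fst p)"
      using K.eventually_x_in_W[OF p] F by (intro deriv_cong_ev) (auto elim: eventually_mono)
    also have "\<dots> = px f p"
      using K.has_px[OF f p] by (intro DERIV_imp_deriv) (simp add: has_real_derivative_iff_has_vector_derivative)
    finally show ?thesis .
  qed
  have arc: "arclength_deriv A g c F (fst p) (snd p) = px f p / K.sp p"
    if F: "\<And>q. q \<in> ?W \<Longrightarrow> F (fst q) (snd q) = f q" and f: "smooth_on ?W f" and p: "p \<in> ?W"
    for F :: "real \<Rightarrow> real \<Rightarrow> real" and f p
  proof -
    have t: "snd p \<in> {0..T}" using K.W_time[OF p] .
    have "(fst p, snd p) \<in> curve_domain T c (chart_at A (c (fst p) (snd p)))"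
      unfolding mem_curve_domain using t chart_at(2)[OF t] by blast
    then have "speed (g (snd p) (chart_at A (c (fst p) (snd p))))
        (\<lambda>\<xi>. snd (chart_at A (c (fst p) (snd p))) (c \<xi> (snd p))) (fst p) = K.sp p"
      using speed_invariant[OF \<kappa> chart_at(1)[OF t], of "fst p"] p by (simp add: chart_quantities(1)[OF \<kappa>])
    moreover have "deriv (\<lambda>\<xi>. F \<xi> (snd p)) (fst p) = px f p"
      by (rule deriv[OF F f p])
    ultimately show ?thesis
      unfolding arclength_deriv_def Let_def by simp
  qed
  have smooth_k2: "smooth_on ?W ?k2" by (intro K.smooth_ip K.smooth_H)
  have smooth_dk2: "smooth_on ?W (\<lambda>q. px ?k2 q / K.sp q)"
    using K.sp_pos by (intro smooth_on_divide K.smooth_on_px smooth_k2 K.smooth_sp) force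
  \<comment> \<open>The inner use of \<open>arc\<close> is valid at every point of
    \<open>?W\<close>, which is the premise of the outer one.\<close>
  have arc2: "arclength_deriv A g c (arclength_deriv A g c (\<lambda>\<xi> s. (curvature A g c \<xi> s)\<^sup>2)) x t =
      px (\<lambda>q. px ?k2 q / K.sp q) (x, t) / K.sp (x, t)"
    using arc[of "arclength_deriv A g c (\<lambda>\<xi> s. (curvature A g c \<xi> s)\<^sup>2)" "\<lambda>q. px ?k2 q / K.sp q" "(x, t)",
        OF arc[of "\<lambda>\<xi> s. (curvature A g c \<xi> s)\<^sup>2" ?k2, OF curv2 smooth_k2] smooth_dk2 xt]
    by simp
  have lhs: "vector_derivative (\<lambda>s. (curvature A g c x s)\<^sup>2) (at t within {0..T}) = pt T ?k2 (x, t)"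
    using K.pt_cong[of "\<lambda>q. (curvature A g c (fst q) (snd q))\<^sup>2" ?k2 "(x, t)", OF curv2 xt]
    by (simp add: pt_def)
  have normal: "normal_nabla_S_H_sq A T g c x t = K.ip (K.ns K.H) (K.ns K.H) (x, t) - (?k2 (x, t))\<^sup>2
      + (metric_inner (pt T (chart_metric g \<kappa>) (curve_coord c \<kappa> (x, t), t)) (K.S (x, t)) (K.H (x, t)))\<^sup>2 / 4"
  proof -
    \<comment> \<open>The normal part is defined in the chart picked at \<open>c x t\<close>; the
      three terms found there are carried over to \<open>\<kappa>\<close> one by one.\<close>
    define \<mu> where "\<mu> = chart_at A (c x t)"
    have t: "t \<in> {0..T}" using xt mem_curve_domain by blast
    have \<mu>: "\<mu> \<in> A" and xt': "(x, t) \<in> curve_domain T c \<mu>"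
      using chart_at[OF t, of x] t unfolding \<mu>_def mem_curve_domain by blast+
    interpret tr: curve_transition T "chart_domain \<kappa>" "chart_domain \<mu>" "chart_metric g \<kappa>" "chart_metric g \<mu>"
      "snd \<kappa> ` (fst \<kappa> \<inter> fst \<mu>)" "transition \<kappa> \<mu>" ?W "curve_domain T c \<mu>"
      "curve_coord c \<kappa>" "curve_coord c \<mu>"
      by (rule curve_transitionI[OF \<kappa> \<mu>])
    have p: "(x, t) \<in> ?W \<inter> curve_domain T c \<mu>" using xt xt' by simp
    have D: "curve_coord c \<kappa> (x, t) \<in> snd \<kappa> ` (fst \<kappa> \<inter> fst \<mu>)"
      and y: "curve_coord c \<mu> (x, t) = transition \<kappa> \<mu> (curve_coord c \<kappa> (x, t))"
      using tr.y_transition[OF p] by auto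
    have 1: "tr.C2.ip tr.C2.H tr.C2.H (x, t) = ?k2 (x, t)"
      by (intro tr.ip_transition tr.H_transition p)
    have 2: "tr.C2.ip (tr.C2.ns tr.C2.H) (tr.C2.ns tr.C2.H) (x, t) = K.ip (K.ns K.H) (K.ns K.H) (x, t)"
      by (intro tr.ip_transition tr.ns_H_transition p)
    have 3: "metric_inner (pt T (chart_metric g \<mu>) (curve_coord c \<mu> (x, t), t)) (tr.C2.S (x, t)) (tr.C2.H (x, t)) =
        metric_inner (pt T (chart_metric g \<kappa>) (curve_coord c \<kappa> (x, t), t)) (K.S (x, t)) (K.H (x, t))"
      unfolding y tr.S_transition[OF p] tr.H_transition[OF p] by (rule tr.isometry_pt[OF D t, symmetric])
    show ?thesis
      unfolding normal_nabla_S_H_sq_def Let_def \<mu>_def[symmetric]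
        normal_nabla_S_H_sq_in_chart[OF \<mu> xt'] 1 2 3 ..
  qed
  have k4: "(curvature A g c x t) ^ 4 = (?k2 (x, t))\<^sup>2"
    using curv2[OF xt] power_mult[of "curvature A g c x t" 2 2] by simp
  show ?thesis
    unfolding lhs arc2 normal k4 K.pt_curvature_err[OF xt] chart_quantities(2,3)[OF \<kappa>] by simp
qed

end

section \<open>From local to global bounds\<close>

context ricci_charts
begin

text \<open>The constant is fixed by the metrics over a closed coordinate ball before any flow of
  curves is considered. Nonnegativity of the curvature is recorded because it makes the bound
  monotone in \<open>C\<close>, so that constants can be enlarged later.\<close>

lemma local_bound:
  assumes p: "p \<in> topspace M"
  obtains U C where "openin M U" "p \<in> U" "C \<ge> 0"
    "\<And>c x t. curve_shrinking_flow M A T g c \<Longrightarrow> t \<in> {0..T} \<Longrightarrow> c x t \<in> U \<Longrightarrow>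
       vector_derivative (\<lambda>s. (curvature A g c x s)\<^sup>2) (at t within {0..T})
       \<le> arclength_deriv A g c (arclength_deriv A g c (\<lambda>\<xi> s. (curvature A g c \<xi> s)\<^sup>2)) x t
         - 2 * normal_nabla_S_H_sq A T g c x t
         + 2 * (curvature A g c x t) ^ 4
         + C * ((curvature A g c x t)\<^sup>2 + curvature A g c x t) \<and> curvature A g c x t \<ge> 0"
proof -
  obtain \<kappa> where \<kappa>: "\<kappa> \<in> A" "p \<in> fst \<kappa>"
    using p manifold unfolding smooth_manifold_def by blast
  interpret F: metric_family T "chart_domain \<kappa>" "chart_metric g \<kappa>" by (rule metric_familyI[OF \<kappa>(1)])
  have "snd \<kappa> p \<in> chart_domain \<kappa>" using \<kappa>(2) by (simp add: chart_domain_def)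
  then obtain r where r: "r > 0" "cball (snd \<kappa> p) r \<subseteq> chart_domain \<kappa>"
    using chart_open(2)[OF \<kappa>(1)] open_contains_cball by blast
  let ?K = "cball (snd \<kappa> p) r \<times> {0..T}"
  have "compact ?K" by (intro compact_Times) auto
  moreover have "?K \<subseteq> chart_domain \<kappa> \<times> {0..T}" using r(2) by auto
  ultimately obtain C where C: "C \<ge> 0"
    "\<And>q u h. q \<in> ?K \<Longrightarrow> metric_inner (chart_metric g \<kappa> q) u u = 1 \<Longrightarrow> F.quad_err q u h + F.lin_err q u h
      \<le> C * (metric_inner (chart_metric g \<kappa> q) h h + sqrt (metric_inner (chart_metric g \<kappa> q) h h))"
    by (rule F.errs_bounded) blast
  \<comment> \<open>The open ball gives a neighbourhood for the cover; its closure lies in the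
    coordinate domain and supplied the compactness for \<open>C\<close>.\<close>
  define U where "U = {q \<in> fst \<kappa>. snd \<kappa> q \<in> ball (snd \<kappa> p) r}"
  have "openin (top_of_set (chart_domain \<kappa>)) (ball (snd \<kappa> p) r)"
    using r(2) chart_open(2)[OF \<kappa>(1)] by (simp add: openin_open_eq) (meson ball_subset_cball subset_trans)
  then have "openin (subtopology M (fst \<kappa>)) {q \<in> topspace (subtopology M (fst \<kappa>)). snd \<kappa> q \<in> ball (snd \<kappa> p) r}"
    by (rule openin_continuous_map_preimage[OF homeomorphic_imp_continuous_map[OF chart_homeomorphic[OF \<kappa>(1)]]])
  then have "openin M U"
    unfolding topspace_chart[OF \<kappa>(1)] U_def[symmetric] using openin_trans_full chart_open(1)[OF \<kappa>(1)] by blast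
  moreover have "p \<in> U" using \<kappa>(2) r(1) by (simp add: U_def)
  moreover have "vector_derivative (\<lambda>s. (curvature A g c x s)\<^sup>2) (at t within {0..T})
       \<le> arclength_deriv A g c (arclength_deriv A g c (\<lambda>\<xi> s. (curvature A g c \<xi> s)\<^sup>2)) x t
         - 2 * normal_nabla_S_H_sq A T g c x t
         + 2 * (curvature A g c x t) ^ 4
         + C * ((curvature A g c x t)\<^sup>2 + curvature A g c x t) \<and> curvature A g c x t \<ge> 0"
    if c: "curve_shrinking_flow M A T g c" and t: "t \<in> {0..T}" and U: "c x t \<in> U" for c x t
  proof -
    interpret flow_curve M A T g c by unfold_locales (rule c)
    have xt: "(x, t) \<in> curve_domain T c \<kappa>" using t U by (simp add: mem_curve_domain U_def)
    interpret K: chart_curve T "curve_domain T c \<kappa>" "chart_domain \<kappa>" "chart_metric g \<kappa>" "curve_coord c \<kappa>"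
      by (rule chart_curveI[OF \<kappa>(1)])
    let ?q = "(curve_coord c \<kappa> (x, t), t)"
    let ?H = "curvature_vector g c \<kappa> x t"
    have q: "?q \<in> ?K" using U t by (auto simp: U_def curve_coord_def)
    have u: "metric_inner (chart_metric g \<kappa> ?q) (unit_S g c \<kappa> x t) (unit_S g c \<kappa> x t) = 1"
      using K.ip_S_S[OF xt] unfolding K.ip_def chart_quantities(2)[OF \<kappa>(1)] by simp
    have k: "curvature A g c x t = sqrt (metric_inner (chart_metric g \<kappa> ?q) ?H ?H)"
      using curvature_in_chart[OF \<kappa>(1) xt] by (simp add: chart_metric_def curve_coord_def)
    have nn: "metric_inner (chart_metric g \<kappa> ?q) ?H ?H \<ge> 0"
      using K.B_pos[OF xt, of ?H] by (cases "?H = 0") (auto simp: metric_inner_linear)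
    have k2: "metric_inner (chart_metric g \<kappa> ?q) ?H ?H = (curvature A g c x t)\<^sup>2"
      using nn by (simp add: k)
    have "curvature A g c x t \<ge> 0" using nn by (simp add: k)
    moreover have "F.quad_err ?q (unit_S g c \<kappa> x t) ?H + F.lin_err ?q (unit_S g c \<kappa> x t) ?H \<le>
        C * ((curvature A g c x t)\<^sup>2 + curvature A g c x t)"
      using C(2)[OF q u, of ?H] unfolding k[symmetric] unfolding k2 .
    ultimately show ?thesis
      unfolding curvature_evolution[OF \<kappa>(1) xt] by linarith
  qed
  ultimately show ?thesis using that C(1) by blast
qed

end

theorem corollary0p3:
  fixes M :: "'a topology"
    and A :: "('a, 'n::finite) chart set"
    and T :: real
    and g :: "real \<Rightarrow> ('a, 'n) metric"
  assumes "smooth_manifold M A"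
    and "compact_space M"
    and "0 < T"
    and "ricci_flow A T g"
  shows "\<exists>C::real. \<forall>c. curve_shrinking_flow M A T g c \<longrightarrow>
    (\<forall>x. \<forall>t\<in>{0..T}.
       vector_derivative (\<lambda>s. (curvature A g c x s)\<^sup>2) (at t within {0..T})
       \<le> arclength_deriv A g c (arclength_deriv A g c (\<lambda>\<xi> s. (curvature A g c \<xi> s)\<^sup>2)) x t
         - 2 * normal_nabla_S_H_sq A T g c x t
         + 2 * (curvature A g c x t) ^ 4
         + C * ((curvature A g c x t)\<^sup>2 + curvature A g c x t))"
proof -
  interpret ricci_charts M A T g by unfold_locales (fact assms)+
  let ?L = "\<lambda>c x t. vector_derivative (\<lambda>s. (curvature A g c x s)\<^sup>2) (at t within {0..T})"
  let ?R = "\<lambda>c x t. arclength_deriv A g c (arclength_deriv A g c (\<lambda>\<xi> s. (curvature A g c \<xi> s)\<^sup>2)) x t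
         - 2 * normal_nabla_S_H_sq A T g c x t + 2 * (curvature A g c x t) ^ 4"
  let ?E = "\<lambda>c x t. (curvature A g c x t)\<^sup>2 + curvature A g c x t"
  let ?bound = "\<lambda>U C. C \<ge> 0 \<and> (\<forall>c x t. curve_shrinking_flow M A T g c \<longrightarrow> t \<in> {0..T} \<longrightarrow> c x t \<in> U \<longrightarrow>
      ?L c x t \<le> ?R c x t + C * ?E c x t \<and> curvature A g c x t \<ge> 0)"
  \<comment> \<open>Only the existence of a bound is recorded for each set, so constants need to be
    chosen just for the members of the finite subcover.\<close>
  define \<U> where "\<U> = {U. openin M U \<and> (\<exists>C. ?bound U C)}"
  have "\<exists>U\<in>\<U>. p \<in> U" if p: "p \<in> topspace M" for p
  proof -
    obtain U C where "openin M U" "p \<in> U" "C \<ge> 0"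
      "\<And>c x t. curve_shrinking_flow M A T g c \<Longrightarrow> t \<in> {0..T} \<Longrightarrow> c x t \<in> U \<Longrightarrow>
        ?L c x t \<le> ?R c x t + C * ?E c x t \<and> curvature A g c x t \<ge> 0"
      by (rule local_bound[OF p]) blast
    then show ?thesis unfolding \<U>_def by blast
  qed
  then have "topspace M \<subseteq> \<Union>\<U>" by blast
  moreover have "\<And>U. U \<in> \<U> \<Longrightarrow> openin M U" by (simp add: \<U>_def)
  ultimately obtain \<F> where \<F>: "finite \<F>" "\<F> \<subseteq> \<U>" "topspace M \<subseteq> \<Union>\<F>"
    using assms(2) unfolding compact_space_def by (metis compactinD)
  have "\<forall>U\<in>\<F>. \<exists>C. ?bound U C" using \<F>(2) unfolding \<U>_def by blast
  then obtain C where C: "\<And>U. U \<in> \<F> \<Longrightarrow> ?bound U (C U)" by metis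
  have "?L c x t \<le> ?R c x t + (\<Sum>U\<in>\<F>. C U) * ?E c x t"
    if c: "curve_shrinking_flow M A T g c" and t: "t \<in> {0..T}" for c x t
  proof -
    interpret flow_curve M A T g c by unfold_locales (rule c)
    have "c x t \<in> topspace M"
      using chart_at[OF t, of x] openin_subset[OF chart_open(1)] by blast
    then obtain U where U: "U \<in> \<F>" "c x t \<in> U" using \<F>(3) by blast
    have "?L c x t \<le> ?R c x t + C U * ?E c x t" and k: "curvature A g c x t \<ge> 0"
      using C[OF U(1)] c t U(2) by blast+
    \<comment> \<open>All the \<open>C U\<close> are nonnegative, so their sum over the subcover
      dominates each of them.\<close>
    moreover have "C U \<le> (\<Sum>U\<in>\<F>. C U)"
      using C by (intro member_le_sum U(1) \<F>(1)) auto
    then have "C U * ?E c x t \<le> (\<Sum>U\<in>\<F>. C U) * ?E c x t"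
      using k by (intro mult_right_mono) auto
    ultimately show ?thesis by linarith
  qed
  then show ?thesis by blast
qed

end
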